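(* Let $p$ and $q$ be different primes, let $v\ge 1$ be an integer, and let $u$ be the multiplicative order of $p$ in the group of units of the residue-class ring $Z_q$ modulo $q$. Let $G$ be a finite group. Then $G$ is isomorphic to a Schmidt group with parameters $p, q$ and $v$ if and only if there exists $x\in I_0(G)$ such that all of the following hold: (1) $K_G(x)\cong \mathrm{End}(C(q^v))$ (isomorphism of semigroups); (2) $H_G(x)=\{0\}$; (3) $I_0(G)=[x]$; (4) $|I_0(G)|=p^u$; (5) $\mathrm{End}(G)\setminus \mathrm{Aut}(G)=\bigcup_{y\in I_0(G)}K_G(y)$; (6) for every $z\in\mathrm{End}(G)$: $z\in\bigcap_{y\in I_0(G)}K_G(y)$ if and only if $z^v=0$; (7) $D_G(x)$ is a $p'$-subgroup of $V_G(x)$; (8) each Sylow $p$-subgroup of $V_G(x)$ is an elementary abelian group of order $p^u$.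
   Context: A Schmidt group is a non-nilpotent finite group in which each proper subgroup is nilpotent. Every Schmidt group $G$ is a semidirect product of its derived subgroup $G'$ (normal), which is a $p$-group, and a cyclic group $\langle b\rangle$ of order $q^v$, for some different primes $p,q$ and some integer $v\ge 1$; these $p,q,v$ are called the parameters of $G$. $C(q^v)$ is the cyclic group of order $q^v$. $\mathrm{End}(G)$ is the semigroup of all endomorphisms of $G$ under composition. Maps are written to the right of their arguments, so $xy$ means first $x$, then $y$. $0\in \mathrm{End}(G)$ is the endomorphism sending every element to the identity, and $1$ is the identity endomorphism. $I_0(G)$ is the set of all idempotents of $\mathrm{End}(G)$ different from $0$ and $1$. For $x\in\mathrm{End}(G)$: $[x]=\{y\in\mathrm{End}(G) : y^2=y,\ xy=y,\ yx=x\}$; $K_G(x)=\{y\in\mathrm{End}(G) : yx=xy=y\}$; $H_G(x)=\{y\in\mathrm{End}(G) : xy=y,\ yx=0\}$; $V_G(x)=\{y\in\mathrm{Aut}(G) : yx=x\}$; $D_G(x)=\{y\in\mathrm{Aut}(G) : yx=xy=x\}$. $V_G(x)$ and $D_G(x)$ are subgroups of $\mathrm{Aut}(G)$. A $p'$-group is a finite group of order not divisible by $p$. *)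

theory Defs
  imports "HOL-Algebra.Bij" "HOL-Algebra.Elementary_Groups" "HOL-Number_Theory.Number_Theory"
begin

section \<open>Schmidt groups\<close>

primrec lower_central :: "('a, 'b) monoid_scheme \<Rightarrow> nat \<Rightarrow> 'a set" where
  "lower_central G 0 = carrier G"
| "lower_central G (Suc n) = generate G
     (\<Union>g \<in> lower_central G n. \<Union>h \<in> carrier G.
        {g \<otimes>\<^bsub>G\<^esub> h \<otimes>\<^bsub>G\<^esub> inv\<^bsub>G\<^esub> g \<otimes>\<^bsub>G\<^esub> inv\<^bsub>G\<^esub> h})"

definition nilpotent_group :: "('a, 'b) monoid_scheme \<Rightarrow> bool" where
  "nilpotent_group G \<longleftrightarrow> group G \<and> (\<exists>n. lower_central G n = {\<one>\<^bsub>G\<^esub>})"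

definition schmidt_group :: "('a, 'b) monoid_scheme \<Rightarrow> bool" where
  "schmidt_group G \<longleftrightarrow>
     group G \<and> finite (carrier G) \<and> \<not> nilpotent_group G \<and>
     (\<forall>H. subgroup H G \<and> H \<noteq> carrier G \<longrightarrow> nilpotent_group (G\<lparr>carrier := H\<rparr>))"

definition internal_semidirect ::
    "('a, 'b) monoid_scheme \<Rightarrow> 'a set \<Rightarrow> 'a set \<Rightarrow> bool" where
  "internal_semidirect G N H \<longleftrightarrow>
     N \<lhd> G \<and> subgroup H G \<and> N \<inter> H = {\<one>\<^bsub>G\<^esub>} \<and> N <#>\<^bsub>G\<^esub> H = carrier G"

definition schmidt_group_params ::
    "('a, 'b) monoid_scheme \<Rightarrow> nat \<Rightarrow> nat \<Rightarrow> nat \<Rightarrow> bool" where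
  "schmidt_group_params G p q v \<longleftrightarrow>
     schmidt_group G \<and> prime p \<and> prime q \<and> p \<noteq> q \<and> v \<ge> 1 \<and>
     (\<exists>n. card (derived G (carrier G)) = p ^ n) \<and>
     (\<exists>b \<in> carrier G. card (generate G {b}) = q ^ v \<and>
        internal_semidirect G (derived G (carrier G)) (generate G {b}))"


section \<open>The endomorphism semigroup\<close>

text \<open>Maps act on the right: the product of x and y is first x, then y.
  Endomorphisms are taken extensional, so that equality of functions is equality on the
  carrier. Only the multiplication of the endomorphism monoid matters for the sub-semigroups
  obtained by updating the carrier, since \<^const>\<open>hom\<close> and \<open>\<cong>\<close> do not mention the unit.\<close>

definition End_monoid :: "('a, 'b) monoid_scheme \<Rightarrow> ('a \<Rightarrow> 'a) monoid" where
  "End_monoid G =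
     \<lparr>carrier = hom G G \<inter> extensional (carrier G),
      monoid.mult = (\<lambda>x y. compose (carrier G) y x),
      one = (\<lambda>a \<in> carrier G. a)\<rparr>"

definition End_zero :: "('a, 'b) monoid_scheme \<Rightarrow> 'a \<Rightarrow> 'a" where
  "End_zero G = (\<lambda>a \<in> carrier G. \<one>\<^bsub>G\<^esub>)"

definition I0 :: "('a, 'b) monoid_scheme \<Rightarrow> ('a \<Rightarrow> 'a) set" where
  "I0 G = {y \<in> carrier (End_monoid G). y \<otimes>\<^bsub>End_monoid G\<^esub> y = y
             \<and> y \<noteq> End_zero G \<and> y \<noteq> \<one>\<^bsub>End_monoid G\<^esub>}"

definition idem_class :: "('a, 'b) monoid_scheme \<Rightarrow> ('a \<Rightarrow> 'a) \<Rightarrow> ('a \<Rightarrow> 'a) set" where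
  "idem_class G x = {y \<in> carrier (End_monoid G). y \<otimes>\<^bsub>End_monoid G\<^esub> y = y
             \<and> x \<otimes>\<^bsub>End_monoid G\<^esub> y = y \<and> y \<otimes>\<^bsub>End_monoid G\<^esub> x = x}"

definition K_set :: "('a, 'b) monoid_scheme \<Rightarrow> ('a \<Rightarrow> 'a) \<Rightarrow> ('a \<Rightarrow> 'a) set" where
  "K_set G x = {y \<in> carrier (End_monoid G).
             y \<otimes>\<^bsub>End_monoid G\<^esub> x = y \<and> x \<otimes>\<^bsub>End_monoid G\<^esub> y = y}"

definition H_set :: "('a, 'b) monoid_scheme \<Rightarrow> ('a \<Rightarrow> 'a) \<Rightarrow> ('a \<Rightarrow> 'a) set" where
  "H_set G x = {y \<in> carrier (End_monoid G).
             x \<otimes>\<^bsub>End_monoid G\<^esub> y = y \<and> y \<otimes>\<^bsub>End_monoid G\<^esub> x = End_zero G}"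

definition V_set :: "('a, 'b) monoid_scheme \<Rightarrow> ('a \<Rightarrow> 'a) \<Rightarrow> ('a \<Rightarrow> 'a) set" where
  "V_set G x = {y \<in> auto G. y \<otimes>\<^bsub>End_monoid G\<^esub> x = x}"

definition D_set :: "('a, 'b) monoid_scheme \<Rightarrow> ('a \<Rightarrow> 'a) \<Rightarrow> ('a \<Rightarrow> 'a) set" where
  "D_set G x = {y \<in> auto G. y \<otimes>\<^bsub>End_monoid G\<^esub> x = x \<and> x \<otimes>\<^bsub>End_monoid G\<^esub> y = x}"

text \<open>The multiplication is that of \<^const>\<open>End_monoid\<close>, opposite to the one of
  \<^const>\<open>AutoGroup\<close>.\<close>

definition V_group :: "('a, 'b) monoid_scheme \<Rightarrow> ('a \<Rightarrow> 'a) \<Rightarrow> ('a \<Rightarrow> 'a) monoid" where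
  "V_group G x = (End_monoid G)\<lparr>carrier := V_set G x\<rparr>"


section \<open>Sylow and related notions\<close>

text \<open>A p-prime-group: a finite group of order prime to p.\<close>

definition p_complement_group :: "nat \<Rightarrow> ('a, 'b) monoid_scheme \<Rightarrow> bool" where
  "p_complement_group p A \<longleftrightarrow> group A \<and> finite (carrier A) \<and> \<not> p dvd order A"

definition sylow_subgroup :: "nat \<Rightarrow> 'a set \<Rightarrow> ('a, 'b) monoid_scheme \<Rightarrow> bool" where
  "sylow_subgroup p P A \<longleftrightarrow> subgroup P A \<and> card P = p ^ multiplicity p (order A)"

definition elementary_abelian :: "nat \<Rightarrow> ('a, 'b) monoid_scheme \<Rightarrow> bool" where
  "elementary_abelian p A \<longleftrightarrow>
     comm_group A \<and> (\<forall>a \<in> carrier A. a [^]\<^bsub>A\<^esub> p = \<one>\<^bsub>A\<^esub>)"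

end

theory Submission
  imports Defs "HOL-Algebra.Sylow"
begin

text \<open>
Both sides of the equivalence are statements about one picture: \<open>G\<close> is the semidirect product of a
normal subgroup \<open>M\<close> and a cyclic group \<open>\<langle>b\<rangle>\<close>, where \<open>b\<close> has order \<open>q ^ v\<close> and \<open>q\<close> does not divide
\<open>|M|\<close>, together with the projection \<open>x\<close> of \<open>G\<close> onto \<open>\<langle>b\<rangle>\<close> with kernel \<open>M\<close>. Let \<open>C\<close> be the
centralizer of \<open>b\<close> in \<open>M\<close>. If \<open>w\<close> satisfies \<open>w ^ (q ^ v) = 1\<close> and \<open>x w = b ^ j\<close>, then the map
taking \<open>m\<close> to \<open>w m b ^ (- j)\<close> permutes \<open>M\<close> with order a power of \<open>q\<close>, so it fixes some \<open>m\<close>, and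
\<open>w\<close> is the conjugate of \<open>b ^ j\<close> by \<open>m\<close> (\<open>conjugate_of_power\<close>). This makes the objects of the
criterion computable: the idempotents in the class of \<open>x\<close> are the projections with kernel \<open>M\<close> onto
the conjugates of \<open>\<langle>b\<rangle>\<close>, and there are \<open>|M : C|\<close> of them; an endomorphism lies in \<open>K\<close> of such a
projection if and only if it kills \<open>M\<close> and maps \<open>b\<close> into the corresponding conjugate of \<open>\<langle>b\<rangle>\<close>; and
\<open>V(x)\<close> permutes the conjugates of \<open>b\<close> transitively with stabilizer \<open>D(x)\<close>, so that
\<open>|V(x)| = |M : C| |D(x)|\<close>.

Let \<open>G\<close> be a Schmidt group and \<open>M = G'\<close>, a \<open>p\<close>-group. A proper subgroup of \<open>M\<close> normalized by \<open>b\<close>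
generates together with \<open>b\<close> a proper, hence nilpotent, subgroup, where elements of coprime order
commute; so it lies in \<open>C\<close> (\<open>proper_invariant_in_C\<close>). In the same way \<open>b ^ q\<close> centralizes \<open>M\<close>. An
endomorphism that is not injective has a nilpotent image and therefore kills \<open>M\<close>, because \<open>M\<close> is
generated by commutators (\<open>noninjective_kills_M\<close>). These facts describe \<open>I\<^sub>0\<close>, the
non-automorphisms and the nilpotent endomorphisms. Moreover \<open>C\<close> is central and \<open>M / C\<close> is abelian
with an irreducible action of \<open>b\<close> for which \<open>b ^ (p ^ u)\<close> acts like \<open>b\<close>. By Schur's lemma the
endomorphisms of \<open>M / C\<close> that commute with \<open>b\<close> form a finite field, and all its elements satisfy
\<open>f ^ (p ^ u) = f\<close>; hence \<open>|M / C| \<le> p ^ u\<close>. Counting the conjugates of \<open>b\<close> modulo \<open>q\<close> gives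
\<open>|M / C| = p ^ k\<close> with \<open>u\<close> dividing \<open>k\<close>, so there is equality (\<open>card_cnj\<close>). Finally an
automorphism in \<open>D(x)\<close> of order \<open>p\<close> acts trivially on \<open>M / C\<close> and is then trivial; so \<open>p\<close> does not
divide \<open>|D(x)|\<close>, and the inner automorphisms by \<open>M\<close> form the only Sylow \<open>p\<close>-subgroup of \<open>V(x)\<close>.

Conversely, the isomorphism of \<open>K(x)\<close> with the endomorphisms of a cyclic group forces the image of
\<open>x\<close> to be cyclic of order \<open>q ^ v\<close> (\<open>cyclic_image_if_K_set_iso\<close>), the condition on \<open>H(x)\<close> says that
\<open>q\<close> does not divide \<open>|M|\<close>, and the remaining conditions imply that \<open>|M : C| = p ^ u\<close>, that an
endomorphism killing \<open>b\<close> also kills \<open>M\<close>, that \<open>b ^ q\<close> is central, that \<open>p\<close>-elements of \<open>C\<close> are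
central, and that inner automorphisms by \<open>M\<close> commute. Some Sylow \<open>p\<close>-subgroup \<open>S\<close> of \<open>M\<close> is
normalized by \<open>b\<close>; it contains \<open>N = [M, b]\<close>, and \<open>M = N C\<close>. The transfer gives an endomorphism of
\<open>C\<close> with kernel \<open>S \<inter> C\<close>; it extends to an endomorphism of \<open>G\<close> killing \<open>b\<close>, hence is trivial, so
that \<open>C\<close> and \<open>M\<close> are \<open>p\<close>-groups (\<open>M_p_group\<close>). Similarly a homomorphism onto a group of prime
order shows \<open>M = [M, b]\<close>, so \<open>G' = M\<close> and \<open>G\<close> is not nilpotent. A subgroup of \<open>M\<close> normalized by
\<open>b\<close> moves \<open>b\<close> to \<open>p ^ k\<close> conjugates with \<open>p ^ k\<close> congruent to \<open>1\<close> modulo \<open>q\<close> and \<open>k \<le> u\<close>; so it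
lies in \<open>C\<close> or moves \<open>b\<close> to all of its conjugates. From this every proper subgroup is nilpotent.
\<close>

section \<open>Words, powers and subgroups\<close>

lemma (in group) inv_mult_cancel:
  assumes "a \<in> carrier G" "b \<in> carrier G"
  shows "inv a \<otimes> (a \<otimes> b) = b" "a \<otimes> (inv a \<otimes> b) = b"
  using assms by (simp_all flip: m_assoc)

abbreviation (in group) commutator :: "'a \<Rightarrow> 'a \<Rightarrow> 'a"
  where "commutator a c \<equiv> a \<otimes> c \<otimes> inv a \<otimes> inv c"

abbreviation (in group) conjugate :: "'a \<Rightarrow> 'a \<Rightarrow> 'a"
  where "conjugate a c \<equiv> a \<otimes> c \<otimes> inv a"

text \<open>Rewriting with these rules brings group words into freely reduced form, so that identities
  that hold in every group are proved by simplification.\<close>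

lemmas (in group) word_simps = m_assoc inv_mult_group inv_mult_cancel

lemma (in group) hom_simps_self:
  assumes "f \<in> hom G G"
  shows "f \<one> = \<one>" "a \<in> carrier G \<Longrightarrow> f a \<in> carrier G"
    "a \<in> carrier G \<Longrightarrow> c \<in> carrier G \<Longrightarrow> f (a \<otimes> c) = f a \<otimes> f c"
    "a \<in> carrier G \<Longrightarrow> f (a [^] (k::nat)) = f a [^] k"
  using assms hom_one[OF assms] hom_nat_pow[OF assms, of a k] by (auto simp: hom_def)

lemma (in group) conjugate_funpow:
  assumes c: "c \<in> carrier G" and g: "g \<in> carrier G"
  shows "(conjugate c ^^ i) g = conjugate (c [^] (i::nat)) g"
proof (induction i)
  case (Suc i)
  have e: "c \<otimes> c [^] i = c [^] Suc i" by (simp only: nat_pow_Suc2[OF c])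
  have "(conjugate c ^^ Suc i) g = conjugate (c \<otimes> c [^] i) g"
    unfolding funpow.simps comp_def Suc using c g by (simp add: word_simps)
  then show ?case by (simp only: e)
qed (use g in simp)

lemma (in group) conjugate_pow_closed:
  assumes c: "c \<in> carrier G" and R: "R \<subseteq> carrier G" "\<And>a. a \<in> R \<Longrightarrow> conjugate c a \<in> R" and a: "a \<in> R"
  shows "conjugate (c [^] (i::nat)) a \<in> R"
proof -
  have "(conjugate c ^^ i) a \<in> R" by (induction i) (use R a in auto)
  then show ?thesis using conjugate_funpow[OF c, of a i] R(1) a by auto
qed

lemma (in group) commute_mult:
  assumes "c \<in> carrier G" "d \<in> carrier G" "g \<in> carrier G" "c \<otimes> g = g \<otimes> c" "d \<otimes> g = g \<otimes> d"
  shows "(c \<otimes> d) \<otimes> g = g \<otimes> (c \<otimes> d)"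
proof -
  have "(c \<otimes> d) \<otimes> g = c \<otimes> (g \<otimes> d)" using assms by (simp add: m_assoc)
  also have "\<dots> = (g \<otimes> c) \<otimes> d" using assms by (simp flip: m_assoc)
  finally show ?thesis using assms by (simp add: m_assoc)
qed

lemma (in group) commute_inv:
  assumes "c \<in> carrier G" "g \<in> carrier G" "c \<otimes> g = g \<otimes> c"
  shows "inv c \<otimes> g = g \<otimes> inv c"
proof -
  have "inv c \<otimes> (g \<otimes> c) \<otimes> inv c = inv c \<otimes> (c \<otimes> g) \<otimes> inv c" by (simp add: assms)
  then show ?thesis using assms(1,2) by (simp add: word_simps)
qed

lemma (in group) commute_pow:
  assumes "c \<in> carrier G" "g \<in> carrier G" "c \<otimes> g = g \<otimes> c"
  shows "c [^] (n::nat) \<otimes> g = g \<otimes> c [^] n"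
  by (induction n) (use assms commute_mult in auto)

lemma (in group) commutator_mult_central:
  assumes G: "c \<in> carrier G" "d \<in> carrier G" "g \<in> carrier G" "h \<in> carrier G"
    and c: "\<And>k. k \<in> carrier G \<Longrightarrow> c \<otimes> k = k \<otimes> c" and d: "\<And>k. k \<in> carrier G \<Longrightarrow> d \<otimes> k = k \<otimes> d"
  shows "commutator (c \<otimes> g) (d \<otimes> h) = commutator g h"
proof -
  have 1: "conjugate (c \<otimes> g) k = conjugate g k" if k: "k \<in> carrier G" for k
  proof -
    have "conjugate (c \<otimes> g) k = conjugate c (g \<otimes> k \<otimes> inv g)" using G k by (simp add: word_simps)
    also have "c \<otimes> (conjugate g k) = (conjugate g k) \<otimes> c" by (rule c) (use G k in simp)
    finally show ?thesis using G k by (simp add: word_simps)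
  qed
  have "commutator (c \<otimes> g) (d \<otimes> h) = g \<otimes> (conjugate (d \<otimes> h) (inv g))"
    using 1[of "d \<otimes> h"] G by (simp add: m_assoc)
  also have "conjugate (d \<otimes> h) (inv g) = conjugate h (inv g)"
  proof -
    have "conjugate (d \<otimes> h) (inv g) = conjugate d (h \<otimes> inv g \<otimes> inv h)" using G by (simp add: word_simps)
    also have "d \<otimes> (conjugate h (inv g)) = (conjugate h (inv g)) \<otimes> d" by (rule d) (use G in simp)
    finally show ?thesis using G by (simp add: word_simps)
  qed
  finally show ?thesis using G by (simp add: m_assoc)
qed

lemma (in group) card_subgroup_dvd:
  assumes "subgroup A G" "subgroup B G" "A \<subseteq> B" shows "card A dvd card B"
proof -
  interpret B: group "G\<lparr>carrier := B\<rparr>" using assms(2) by (rule subgroup_imp_group)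
  have "subgroup A (G\<lparr>carrier := B\<rparr>)" by (rule subgroup_incl[OF assms])
  then have "card (rcosets\<^bsub>G\<lparr>carrier := B\<rparr>\<^esub> A) * card A = card B"
    using B.lagrange[of A] by (simp add: order_def)
  note this[symmetric]
  then show ?thesis by (rule dvdI[OF trans[OF _ mult.commute]])
qed

lemma (in group) pow_card_subgroup:
  assumes "subgroup A G" "a \<in> A" shows "a [^] card A = \<one>"
proof -
  interpret A: group "G\<lparr>carrier := A\<rparr>" using assms(1) by (rule subgroup_imp_group)
  show ?thesis using A.pow_order_eq_1[of a] assms(2) by (simp add: order_def flip: nat_pow_consistent)
qed

lemma (in group) coprime_torsion:
  assumes "a \<in> carrier G" "a [^] (i::nat) = \<one>" "a [^] (j::nat) = \<one>" "coprime i j"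
  shows "a = \<one>"
proof -
  have "ord a dvd i" "ord a dvd j" using assms pow_eq_id[OF assms(1)] by auto
  then have "ord a = 1" using assms(4) by (metis coprime_common_divisor_nat nat_dvd_1_iff_1 One_nat_def)
  then show ?thesis using assms(1) ord_eq_1 by simp
qed

text \<open>In a finite group the inverse of an element is one of its powers.\<close>

lemma (in group) finite_subgroupI:
  assumes "finite (carrier G)" "H \<subseteq> carrier G" "H \<noteq> {}"
    and "\<And>a b. a \<in> H \<Longrightarrow> b \<in> H \<Longrightarrow> a \<otimes> b \<in> H"
  shows "subgroup H G"
proof (rule subgroupI)
  fix a assume a: "a \<in> H"
  then have aG: "a \<in> carrier G" using assms(2) by auto
  have pos: "order G > 0" using assms(1) order_gt_0_iff_finite by simp
  have pw: "a [^] Suc n \<in> H" for n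
  proof (induction n)
    case (Suc n)
    then show ?case using assms(4)[OF Suc a] by simp
  qed (use a aG in simp)
  obtain n where n: "order G = Suc n" using assms(1) order_gt_0_iff_finite gr0_implies_Suc by blast
  have "a [^] Suc (n + n) \<otimes> a = a [^] (Suc n + Suc n)" using aG by simp
  also have "\<dots> = a [^] Suc n \<otimes> a [^] Suc n" using aG by (simp only: nat_pow_mult)
  also have "\<dots> = \<one>" using pow_order_eq_1[OF aG] n by (simp del: nat_pow_Suc)
  finally have "inv a = a [^] Suc (n + n)" using aG by (intro inv_equality) auto
  then show "inv a \<in> H" using pw by simp
qed (use assms in auto)

lemma (in group) subgroup_times_powers:
  assumes fin: "finite (carrier G)" and R: "subgroup R G" and c: "c \<in> carrier G"
    and inv: "\<And>a. a \<in> R \<Longrightarrow> conjugate c a \<in> R"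
  shows "subgroup {g. \<exists>a \<in> R. \<exists>i::nat. g = a \<otimes> c [^] i} G" (is "subgroup ?K G")
proof (rule finite_subgroupI[OF fin])
  interpret R: subgroup R G by (rule R)
  show "?K \<subseteq> carrier G" using c by auto
  show "?K \<noteq> {}" using R.one_closed by blast
  fix g h assume "g \<in> ?K" "h \<in> ?K"
  then obtain a i a' j where g: "a \<in> R" "g = a \<otimes> c [^] (i::nat)" "a' \<in> R" "h = a' \<otimes> c [^] (j::nat)" by auto
  have "g \<otimes> h = (a \<otimes> conjugate (c [^] i) a') \<otimes> c [^] (i + j)"
    using g c by (simp add: word_simps flip: nat_pow_mult)
  moreover have "a \<otimes> conjugate (c [^] i) a' \<in> R"
    using g conjugate_pow_closed[OF c R.subset inv] by simp
  ultimately show "g \<otimes> h \<in> ?K" by blast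
qed

lemma (in group) conjugate_iso:
  assumes R: "subgroup R G" and g: "g \<in> carrier G"
  shows "subgroup (conjugate g ` R) G" "conjugate g \<in> iso (G\<lparr>carrier := R\<rparr>) (G\<lparr>carrier := conjugate g ` R\<rparr>)"
    "card (conjugate g ` R) = card R"
proof -
  interpret R: subgroup R G by (rule R)
  interpret f: group_hom G G "conjugate g"
    using g by unfold_locales (auto intro!: homI simp: word_simps)
  show "subgroup (conjugate g ` R) G" by (rule f.subgroup_img_is_subgroup[OF R])
  have inj: "inj_on (conjugate g) R" using g by (auto simp: inj_on_def)
  then show "card (conjugate g ` R) = card R" by (rule card_image)
  show "conjugate g \<in> iso (G\<lparr>carrier := R\<rparr>) (G\<lparr>carrier := conjugate g ` R\<rparr>)"
    using inj by (auto simp: iso_def hom_def bij_betw_def)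
qed

text \<open>Cauchy's theorem: there is a subgroup of order exactly \<open>r\<close>.\<close>

lemma (in group) element_of_prime_order:
  assumes "finite (carrier G)" "prime r" "r dvd order G"
  shows "\<exists>a \<in> carrier G. a \<noteq> \<one> \<and> a [^] r = \<one>"
proof -
  obtain k where "order G = r ^ 1 * k" using assms(3) by auto
  then obtain H where H: "subgroup H G" "card H = r ^ 1" using sylow_thm[OF assms(2) group_axioms] assms(1) by blast
  have "\<not> H \<subseteq> {\<one>}"
  proof
    assume "H \<subseteq> {\<one>}"
    then have "card H \<le> 1" using card_mono[of "{\<one>}" H] by simp
    then show False using H(2) prime_gt_1_nat[OF assms(2)] by simp
  qed
  then obtain a where "a \<in> H" "a \<noteq> \<one>" by blast
  then show ?thesis using pow_card_subgroup[OF H(1)] H subgroup.subset by fastforce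
qed

section \<open>Orbits and fixed points\<close>

text \<open>The fibres of \<open>f\<close> on \<open>B\<close> are left cosets of \<open>D\<close>. Orbit sizes, indices of subgroups and
  numbers of conjugates are all computed in this form.\<close>

lemma (in group) card_image_times_subgroup:
  assumes fin: "finite B" and B: "subgroup B G" and D: "D \<subseteq> B"
    and eq: "\<And>a c. a \<in> B \<Longrightarrow> c \<in> B \<Longrightarrow> f a = f c \<longleftrightarrow> inv a \<otimes> c \<in> D"
  shows "card B = card (f ` B) * card D"
proof -
  interpret B: subgroup B G by fact
  have fibre: "card {c \<in> B. f c = f a} = card D" if a: "a \<in> B" for a
  proof -
    have "c \<in> (\<lambda>d. a \<otimes> d) ` D" if "c \<in> B" "f c = f a" for c
      using that a eq[of a c] by (intro image_eqI[of _ _ "inv a \<otimes> c"]) (auto simp: word_simps)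
    moreover have "f (a \<otimes> d) = f a" if "d \<in> D" for d
      using that a D eq[of a "a \<otimes> d"] by (auto simp: word_simps subset_iff)
    ultimately have "{c \<in> B. f c = f a} = (\<lambda>d. a \<otimes> d) ` D" using a D by auto
    moreover have "inj_on (\<lambda>d. a \<otimes> d) D" using a D by (auto simp: inj_on_def subset_iff)
    ultimately show ?thesis by (simp add: card_image)
  qed
  have "card B = (\<Sum>y\<in>f ` B. card {c \<in> B. f c = y})"
    using sum.image_gen[OF fin, of "\<lambda>_. 1::nat" f] by simp
  also have "\<dots> = (\<Sum>y\<in>f ` B. card D)" using fibre by (intro sum.cong) auto
  finally show ?thesis by simp
qed

text \<open>The orbit of a point that is not fixed has size a power of \<open>p\<close> other than \<open>1\<close>, so it can be
  removed from \<open>X\<close> without changing either side modulo \<open>p\<close>.\<close>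

lemma p_group_fixed_points:
  fixes T (structure)
  assumes "group T" "card (carrier T) = p ^ k" "prime p"
    and "finite X"
    and "\<And>t x. t \<in> carrier T \<Longrightarrow> x \<in> X \<Longrightarrow> act t x \<in> X"
    and "\<And>x. x \<in> X \<Longrightarrow> act \<one> x = x"
    and "\<And>s t x. s \<in> carrier T \<Longrightarrow> t \<in> carrier T \<Longrightarrow> x \<in> X \<Longrightarrow> act (s \<otimes> t) x = act s (act t x)"
  shows "[card X = card {x \<in> X. \<forall>t \<in> carrier T. act t x = x}] (mod p)"
  using assms(4-)
proof (induction "card X" arbitrary: X rule: less_induct)
  case less
  interpret group T by fact
  define Fix where "Fix Y = {x \<in> Y. \<forall>t \<in> carrier T. act t x = x}" for Y
  have finT: "finite (carrier T)"
    using assms(2,3) by (metis card.infinite power_eq_0_iff prime_gt_0_nat less_irrefl)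
  show ?case
  proof (cases "Fix X = X")
    case True
    then show ?thesis by (simp add: Fix_def)
  next
    case False
    then obtain x where x: "x \<in> X" "x \<notin> Fix X" by (auto simp: Fix_def)
    define Orb where "Orb = (\<lambda>t. act t x) ` carrier T"
    define St where "St = {t \<in> carrier T. act t x = x}"
    have undo: "act (inv t) (act t y) = y" if "t \<in> carrier T" "y \<in> X" for t y
      using less.prems(4)[of "inv t" t y] less.prems(3)[of y] that by simp
    have OX: "Orb \<subseteq> X" using less.prems(2) x(1) by (auto simp: Orb_def)
    have Ocl: "act t y \<in> Orb" if "t \<in> carrier T" "y \<in> Orb" for t y
      using that less.prems(4) x(1) by (auto simp: Orb_def image_iff) (metis m_closed)
    have "card (carrier T) = card Orb * card St"
      unfolding Orb_def
    proof (rule card_image_times_subgroup[OF finT subgroup_self])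
      fix s t assume st: "s \<in> carrier T" "t \<in> carrier T"
      have "act s x = act t x \<longleftrightarrow> act (inv s) (act t x) = x"
        using undo[of s x] undo[of "inv s" "act t x"] st x(1) less.prems(2) by auto
      then show "act s x = act t x \<longleftrightarrow> inv s \<otimes> t \<in> St" using st x(1) less.prems(4) by (simp add: St_def)
    qed (auto simp: St_def)
    then have "card Orb dvd p ^ k" using assms(2) by simp
    moreover have "card Orb \<noteq> 1"
    proof
      assume "card Orb = 1"
      then obtain y where y: "Orb = {y}" by (auto simp: card_1_singleton_iff)
      have "x \<in> Orb" using less.prems(3)[OF x(1)] unfolding Orb_def by (metis image_iff one_closed)
      then have "\<forall>t\<in>carrier T. act t x = x" using y by (auto simp: Orb_def)
      then show False using x by (simp add: Fix_def)
    qed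
    ultimately have pO: "p dvd card Orb"
      by (metis assms(3) divides_primepow_nat dvd_power gr0I power_0)
    have finO: "finite Orb" using finT by (simp add: Orb_def)
    have xO: "x \<in> Orb" using less.prems(3)[OF x(1)] unfolding Orb_def by (metis image_iff one_closed)
    have sub: "card (X - Orb) < card X" using xO x(1) less.prems(1) by (metis Diff_iff Diff_subset psubsetI psubset_card_mono)
    have clos: "act t y \<in> X - Orb" if "t \<in> carrier T" "y \<in> X - Orb" for t y
    proof -
      have "act t y \<notin> Orb"
        using that Ocl[of "inv t" "act t y"] undo[of t y] by auto
      then show ?thesis using that less.prems(2) by auto
    qed
    have IH: "[card (X - Orb) = card (Fix (X - Orb))] (mod p)"
      unfolding Fix_def by (rule less.hyps[OF sub]) (use less.prems clos in auto)
    have "Fix (X - Orb) = Fix X"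
    proof -
      have "y \<notin> Orb" if "y \<in> Fix X" for y
      proof
        assume "y \<in> Orb"
        then obtain t where t: "t \<in> carrier T" "y = act t x" by (auto simp: Orb_def)
        then have "x = act (inv t) y" using undo x(1) by simp
        also have "\<dots> = y" using that t by (simp add: Fix_def)
        finally show False using x that by simp
      qed
      then show ?thesis by (auto simp: Fix_def)
    qed
    moreover have "card X = card (X - Orb) + card Orb"
      using card_Diff_subset[OF finO OX] card_mono[OF less.prems(1) OX] by simp
    ultimately have "[card X = card (Fix X) + 0] (mod p)"
      using cong_add[OF IH, of "card Orb" 0] pO by (simp add: cong_0_iff)
    then show ?thesis by (simp add: Fix_def)
  qed
qed

text \<open>The powers of \<open>\<phi>\<close> form an action of the cyclic group of order \<open>q ^ v\<close>.\<close>

lemma cyclic_fixed_points: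
  fixes \<phi> :: "'a \<Rightarrow> 'a"
  assumes q: "prime q" and X: "finite X" "\<And>x. x \<in> X \<Longrightarrow> \<phi> x \<in> X"
    and n: "n = q ^ v"
    and per: "\<And>x. x \<in> X \<Longrightarrow> (\<phi> ^^ n) x = x"
  shows "[card X = card {x \<in> X. \<phi> x = x}] (mod q)"
proof -
  let ?T = "integer_mod_group n"
  define act where "act = (\<lambda>(i::int) x. (\<phi> ^^ nat i) x)"
  have n0: "n > 0" using q n by (simp add: prime_gt_0_nat)
  then have carr: "carrier ?T = {0..<int n}" by (simp add: carrier_integer_mod_group)
  have it: "(\<phi> ^^ i) x \<in> X" if "x \<in> X" for x i
    using that X(2) by (induction i) auto
  have "[card X = card {x \<in> X. \<forall>t \<in> carrier ?T. act t x = x}] (mod q)"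
  proof (rule p_group_fixed_points[where k = v])
    show "card (carrier ?T) = q ^ v" by (simp add: carr flip: n)
    fix s t x assume s: "s \<in> carrier ?T" "t \<in> carrier ?T" and x: "x \<in> X"
    have "act (s \<otimes>\<^bsub>?T\<^esub> t) x = (\<phi> ^^ ((nat s + nat t) mod n)) x"
      using s by (simp add: act_def carr nat_mod_distrib nat_add_distrib)
    also have "\<dots> = (\<phi> ^^ (nat s + nat t)) x" using per[OF x] by (rule funpow_mod_eq)
    finally show "act (s \<otimes>\<^bsub>?T\<^esub> t) x = act s (act t x)" by (simp add: act_def funpow_add)
  qed (use q X it in \<open>auto simp: act_def\<close>)
  moreover have "{x \<in> X. \<forall>t \<in> carrier ?T. act t x = x} = {x \<in> X. \<phi> x = x}"
  proof -
    have "\<phi> x = x" if x: "x \<in> X" "\<forall>t \<in> carrier ?T. act t x = x" for x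
    \<comment> \<open>For \<open>n = 1\<close> the residue \<open>1\<close> is not in the carrier, but then \<open>\<phi>\<close> is the identity on \<open>X\<close>.\<close>
    proof (cases "n = 1")
      case True then show ?thesis using per[OF x(1)] by simp
    next
      case False
      then have "act 1 x = x" using n0 x(2) by (simp add: carr)
      then show ?thesis by (simp add: act_def)
    qed
    moreover have "act t x = x" if "\<phi> x = x" for t x
    proof -
      have "(\<phi> ^^ i) x = x" for i using that by (induction i) auto
      then show ?thesis by (simp add: act_def)
    qed
    ultimately show ?thesis by auto
  qed
  ultimately show ?thesis by simp
qed

section \<open>Construction of homomorphisms\<close>

text \<open>A total multiplicative relation between groups is functional as soon as it relates the unit
  to the unit only. This is how homomorphisms are defined through decompositions of group elements
  that are not unique.\<close>

lemma hom_from_relation: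
  assumes "group G" "group K"
    and tot: "\<And>g. g \<in> carrier G \<Longrightarrow> \<exists>h \<in> carrier K. R g h"
    and mult: "\<And>g g' h h'. \<lbrakk>g \<in> carrier G; g' \<in> carrier G; h \<in> carrier K; h' \<in> carrier K; R g h; R g' h'\<rbrakk>
      \<Longrightarrow> R (g \<otimes>\<^bsub>G\<^esub> g') (h \<otimes>\<^bsub>K\<^esub> h')"
    and triv: "\<And>h. h \<in> carrier K \<Longrightarrow> R \<one>\<^bsub>G\<^esub> h \<Longrightarrow> h = \<one>\<^bsub>K\<^esub>"
  shows "\<exists>f \<in> hom G K. \<forall>g \<in> carrier G. \<forall>h \<in> carrier K. R g h \<longleftrightarrow> f g = h"
proof -
  interpret G: group G by fact
  interpret K: group K by fact
  have uniq: "h = h'" if g: "g \<in> carrier G" and h: "h \<in> carrier K" "h' \<in> carrier K" "R g h" "R g h'" for g h h'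
  proof -
    obtain k where k: "k \<in> carrier K" "R (inv\<^bsub>G\<^esub> g) k" using tot[of "inv\<^bsub>G\<^esub> g"] g by auto
    have "h \<otimes>\<^bsub>K\<^esub> k = \<one>\<^bsub>K\<^esub>" "h' \<otimes>\<^bsub>K\<^esub> k = \<one>\<^bsub>K\<^esub>"
      using triv mult[OF g _ h(1) k(1) h(3) k(2)] mult[OF g _ h(2) k(1) h(4) k(2)] g h k by auto
    then show ?thesis using K.right_cancel h k(1) by metis
  qed
  define f where "f g = (SOME h. h \<in> carrier K \<and> R g h)" for g
  have f: "f g \<in> carrier K \<and> R g (f g)" if "g \<in> carrier G" for g
    unfolding f_def by (rule someI_ex) (use tot[OF that] in auto)
  have "f \<in> hom G K"
  proof (rule homI)
    fix g g' assume g: "g \<in> carrier G" "g' \<in> carrier G"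
    then show "f (g \<otimes>\<^bsub>G\<^esub> g') = f g \<otimes>\<^bsub>K\<^esub> f g'"
      using uniq[of "g \<otimes>\<^bsub>G\<^esub> g'"] f mult[of g g' "f g" "f g'"] by simp
  qed (use f in auto)
  then show ?thesis using uniq f by blast
qed

text \<open>The universal property of \<open>G = M\<langle>b\<rangle>\<close> modulo the normal subgroup \<open>M\<close>: a homomorphism killing
  \<open>M\<close> may send \<open>b\<close> to any \<open>c\<close> that satisfies the relations of \<open>b\<close> modulo \<open>M\<close>.\<close>

lemma hom_from_cyclic_extension:
  assumes "group G" "group K" and M: "subgroup M G"
    and conj: "\<And>g m. g \<in> carrier G \<Longrightarrow> m \<in> M \<Longrightarrow> g \<otimes>\<^bsub>G\<^esub> m \<otimes>\<^bsub>G\<^esub> inv\<^bsub>G\<^esub> g \<in> M"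
    and b: "b \<in> carrier G" and gen: "\<And>g. g \<in> carrier G \<Longrightarrow> \<exists>m \<in> M. \<exists>i::nat. g = m \<otimes>\<^bsub>G\<^esub> b [^]\<^bsub>G\<^esub> i"
    and c: "c \<in> carrier K" and rel: "\<And>i::nat. b [^]\<^bsub>G\<^esub> i \<in> M \<Longrightarrow> c [^]\<^bsub>K\<^esub> i = \<one>\<^bsub>K\<^esub>"
  shows "\<exists>f \<in> hom G K. (\<forall>m \<in> M. \<forall>i::nat. f (m \<otimes>\<^bsub>G\<^esub> b [^]\<^bsub>G\<^esub> i) = c [^]\<^bsub>K\<^esub> i)"
proof -
  interpret G: group G by fact
  interpret K: group K by fact
  interpret M: subgroup M G by fact
  define R where "R g h \<longleftrightarrow> (\<exists>m \<in> M. \<exists>i::nat. g = m \<otimes>\<^bsub>G\<^esub> b [^]\<^bsub>G\<^esub> i \<and> h = c [^]\<^bsub>K\<^esub> i)" for g h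
  have "\<exists>f \<in> hom G K. \<forall>g \<in> carrier G. \<forall>h \<in> carrier K. R g h \<longleftrightarrow> f g = h"
  proof (rule hom_from_relation[OF assms(1,2)])
    fix g assume "g \<in> carrier G"
    then show "\<exists>h\<in>carrier K. R g h" using gen[of g] c unfolding R_def by blast
  next
    fix g g' h h' assume "R g h" "R g' h'"
    then obtain m i m' j where m: "m \<in> M" "m' \<in> M" and g: "g = m \<otimes>\<^bsub>G\<^esub> b [^]\<^bsub>G\<^esub> (i::nat)" "h = c [^]\<^bsub>K\<^esub> i"
      "g' = m' \<otimes>\<^bsub>G\<^esub> b [^]\<^bsub>G\<^esub> (j::nat)" "h' = c [^]\<^bsub>K\<^esub> j" unfolding R_def by blast
    have "g \<otimes>\<^bsub>G\<^esub> g' = (m \<otimes>\<^bsub>G\<^esub> (b [^]\<^bsub>G\<^esub> i \<otimes>\<^bsub>G\<^esub> m' \<otimes>\<^bsub>G\<^esub> inv\<^bsub>G\<^esub> (b [^]\<^bsub>G\<^esub> i))) \<otimes>\<^bsub>G\<^esub> b [^]\<^bsub>G\<^esub> (i + j)"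
      using m b by (simp add: g G.word_simps flip: G.nat_pow_mult)
    moreover have "h \<otimes>\<^bsub>K\<^esub> h' = c [^]\<^bsub>K\<^esub> (i + j)" using c by (simp add: g K.nat_pow_mult)
    moreover have "m \<otimes>\<^bsub>G\<^esub> (b [^]\<^bsub>G\<^esub> i \<otimes>\<^bsub>G\<^esub> m' \<otimes>\<^bsub>G\<^esub> inv\<^bsub>G\<^esub> (b [^]\<^bsub>G\<^esub> i)) \<in> M"
      using m conj[OF _ m(2), of "b [^]\<^bsub>G\<^esub> i"] b by simp
    ultimately show "R (g \<otimes>\<^bsub>G\<^esub> g') (h \<otimes>\<^bsub>K\<^esub> h')" unfolding R_def by blast
  next
    fix h assume "R \<one>\<^bsub>G\<^esub> h"
    then obtain m i where m: "m \<in> M" "\<one>\<^bsub>G\<^esub> = m \<otimes>\<^bsub>G\<^esub> b [^]\<^bsub>G\<^esub> (i::nat)" "h = c [^]\<^bsub>K\<^esub> i"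
      unfolding R_def by blast
    have "inv\<^bsub>G\<^esub> m = inv\<^bsub>G\<^esub> m \<otimes>\<^bsub>G\<^esub> (m \<otimes>\<^bsub>G\<^esub> b [^]\<^bsub>G\<^esub> i)"
      using m(1) by (simp flip: m(2))
    also have "\<dots> = b [^]\<^bsub>G\<^esub> i" using m(1) b by (simp flip: G.m_assoc)
    finally have "b [^]\<^bsub>G\<^esub> i \<in> M" using M.m_inv_closed[OF m(1)] by simp
    then show "h = \<one>\<^bsub>K\<^esub>" using rel m(3) by simp
  qed
  then obtain f where f: "f \<in> hom G K" "\<And>g h. \<lbrakk>g \<in> carrier G; h \<in> carrier K\<rbrakk> \<Longrightarrow> R g h \<longleftrightarrow> f g = h" by blast
  have "f (m \<otimes>\<^bsub>G\<^esub> b [^]\<^bsub>G\<^esub> i) = c [^]\<^bsub>K\<^esub> i" if "m \<in> M" for m and i :: nat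
    using f(2)[of "m \<otimes>\<^bsub>G\<^esub> b [^]\<^bsub>G\<^esub> i" "c [^]\<^bsub>K\<^esub> i"] that b c unfolding R_def by auto
  then show ?thesis using f(1) by blast
qed

text \<open>Sylow's theorem on conjugacy: \<open>T\<close> permutes the left cosets of \<open>S\<close>, whose number is not
  divisible by \<open>p\<close>, hence it fixes one of them, \<open>g S\<close> say.\<close>

lemma (in group) p_subgroup_in_conjugate:
  assumes fin: "finite (carrier G)" and p: "prime p" and S: "subgroup S G" and T: "subgroup T G"
    and cT: "card T = p ^ k" and ind: "\<not> p dvd order G div card S"
  shows "\<exists>g \<in> carrier G. \<forall>t \<in> T. inv g \<otimes> t \<otimes> g \<in> S"
proof -
  interpret S: subgroup S G by fact
  interpret T: subgroup T G by fact
  define X where "X = (\<lambda>g. g <# S) ` carrier G"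
  have eq: "g <# S = h <# S \<longleftrightarrow> inv g \<otimes> h \<in> S" if gh: "g \<in> carrier G" "h \<in> carrier G" for g h
  proof
    assume "g <# S = h <# S"
    moreover have "h \<in> h <# S" using gh S.one_closed by (force simp: l_coset_def)
    ultimately obtain s where "s \<in> S" "h = g \<otimes> s" by (auto simp: l_coset_def)
    then show "inv g \<otimes> h \<in> S" using gh by (simp add: word_simps)
  next
    assume "inv g \<otimes> h \<in> S"
    then have "g \<otimes> (inv g \<otimes> h) \<in> g <# S" by (auto simp: l_coset_def)
    then have "h \<in> g <# S" using gh by (simp add: word_simps)
    then show "g <# S = h <# S" by (rule l_repr_independence[OF _ gh(1) S])
  qed
  have lS: "g <# S \<subseteq> carrier G" if "g \<in> carrier G" for g using that S.subset by (rule l_coset_subset_G[rotated])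
  have "card (carrier G) = card X * card S"
    unfolding X_def by (rule card_image_times_subgroup[OF fin subgroup_self S.subset eq])
  then have "card X = order G div card S"
    using S.finite_imp_card_positive[OF fin] by (simp add: order_def)
  then have nd: "\<not> p dvd card X" using ind by simp
  have "[card X = card {U \<in> X. \<forall>t \<in> carrier (G\<lparr>carrier := T\<rparr>). t <# U = U}] (mod p)"
  proof (rule p_group_fixed_points[where k = k])
    show "group (G\<lparr>carrier := T\<rparr>)" by (rule T.subgroup_is_group) (rule group_axioms)
    show "finite X" using fin by (simp add: X_def)
  next
    fix t U assume "t \<in> carrier (G\<lparr>carrier := T\<rparr>)" "U \<in> X"
    then show "t <# U \<in> X" using lcos_m_assoc[OF S.subset] by (auto simp: X_def)
  next
    fix U assume "U \<in> X" then show "\<one>\<^bsub>G\<lparr>carrier := T\<rparr>\<^esub> <# U = U"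
      using lS by (auto simp: X_def lcos_mult_one)
  next
    fix s t U assume "s \<in> carrier (G\<lparr>carrier := T\<rparr>)" "t \<in> carrier (G\<lparr>carrier := T\<rparr>)" "U \<in> X"
    then show "(s \<otimes>\<^bsub>G\<lparr>carrier := T\<rparr>\<^esub> t) <# U = s <# (t <# U)"
      using lS by (auto simp: X_def lcos_m_assoc)
  qed (use p cT in auto)
  then have "[card X = card {U \<in> X. \<forall>t \<in> T. t <# U = U}] (mod p)" by simp
  then have "card {U \<in> X. \<forall>t \<in> T. t <# U = U} \<noteq> 0"
    using nd by (metis cong_0_iff)
  then obtain U where U: "U \<in> X" "\<forall>t \<in> T. t <# U = U" by (metis (mono_tags, lifting) card.empty Collect_empty_eq)
  then obtain g where g: "g \<in> carrier G" "U = g <# S" by (auto simp: X_def)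
  have "inv g \<otimes> t \<otimes> g \<in> S" if t: "t \<in> T" for t
    using U(2) t g eq[of g "t \<otimes> g"] lcos_m_assoc[OF S.subset, of t g] by (auto simp: m_assoc)
  then show ?thesis using g by blast
qed

text \<open>A maximal subgroup \<open>M\<close> among the proper subgroups containing \<open>L\<close> is normal, as it contains
  all commutators, and has prime index \<open>r\<close>. No quotient group is formed: an element \<open>h\<close> outside
  \<open>M\<close> with \<open>h ^ r\<close> in \<open>M\<close> has order divisible by \<open>r\<close>, so some power \<open>c\<close> of \<open>h\<close> has order \<open>r\<close>, and
  \<open>M\<close> is the kernel of the endomorphism of \<open>G\<close> that sends \<open>h\<close> to \<open>c\<close>.\<close>

lemma (in group) hom_onto_prime_cyclic:
  assumes fin: "finite (carrier G)" and L: "subgroup L G" "L \<noteq> carrier G"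
    and comm: "\<And>a b. a \<in> carrier G \<Longrightarrow> b \<in> carrier G \<Longrightarrow> commutator a b \<in> L"
  shows "\<exists>f \<in> hom G G. \<exists>r. prime r \<and> (\<forall>a \<in> L. f a = \<one>) \<and> (\<exists>a \<in> carrier G. f a \<noteq> \<one>)
           \<and> (\<forall>a \<in> carrier G. f a [^] (r::nat) = \<one>)"
proof -
  define \<M> where "\<M> = {M. subgroup M G \<and> L \<subseteq> M \<and> M \<noteq> carrier G}"
  have "finite \<M>" by (rule finite_subset[of _ "Pow (carrier G)"]) (auto simp: \<M>_def fin dest: subgroup.subset)
  moreover have "L \<in> \<M>" using L by (simp add: \<M>_def)
  ultimately obtain M where M: "M \<in> \<M>" and max: "\<And>M'. M' \<in> \<M> \<Longrightarrow> M \<subseteq> M' \<Longrightarrow> M = M'"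
    using finite_has_maximal2 by meson
  then have sM: "subgroup M G" and LM: "L \<subseteq> M" and Mne: "M \<noteq> carrier G" by (auto simp: \<M>_def)
  interpret M: subgroup M G by (rule sM)
  have conjM: "conjugate g m \<in> M" if "g \<in> carrier G" "m \<in> M" for g m
  proof -
    have "(commutator g m) \<otimes> m \<in> M" using comm[of g m] that LM by auto
    then show ?thesis using that by (simp add: word_simps)
  qed
  obtain g where g: "g \<in> carrier G" "g \<notin> M" using Mne M.subset by auto
  define k where "k = (LEAST k::nat. k > 0 \<and> g [^] k \<in> M)"
  have ex: "order G > 0 \<and> g [^] order G \<in> M"
    using pow_order_eq_1[OF g(1)] fin by (simp add: order_gt_0_iff_finite)
  have k: "k > 0" "g [^] k \<in> M" using LeastI[of "\<lambda>k. k > 0 \<and> g [^] k \<in> M", OF ex] by (auto simp: k_def)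
  have kmin: "g [^] j \<notin> M" if "0 < j" "j < k" for j
    using not_less_Least[of j "\<lambda>k. k > 0 \<and> g [^] k \<in> M"] that by (auto simp: k_def)
  have "k \<noteq> 1" using k(2) g by auto
  then obtain r where r: "prime r" "r dvd k" using prime_factor_nat by blast
  \<comment> \<open>The order of \<open>g\<close> modulo \<open>M\<close> is \<open>k\<close>, so \<open>h\<close> has order \<open>r\<close> modulo \<open>M\<close>.\<close>
  define h where "h = g [^] (k div r)"
  have h: "h \<in> carrier G" using g by (simp add: h_def)
  have hr: "h [^] r \<in> M" using k r g by (simp add: h_def nat_pow_pow)
  have hM: "h \<notin> M" unfolding h_def
    using kmin[of "k div r"] k r prime_gt_1_nat[OF r(1)] by (auto elim!: dvdE)
  have hi: "r dvd i" if i: "h [^] i \<in> M" for i :: nat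
  proof (rule ccontr)
    assume "\<not> r dvd i"
    then have "coprime i r" using r(1) prime_imp_coprime coprime_commute by blast
    then obtain x where x: "[i * x = 1] (mod r)" using cong_solve_coprime_nat[of i r] by auto
    then have "i * x mod r = 1" using prime_gt_1_nat[OF r(1)] by (simp add: cong_def)
    then have e: "i * x = r * (i * x div r) + 1" using mult_div_mod_eq[of r "i * x"] by simp
    have pwM: "a [^] (n::nat) \<in> M" if "a \<in> M" for a n using that by (induction n) auto
    have "h [^] (i * x) \<in> M" using pwM[OF i, of x] h by (simp add: nat_pow_pow)
    moreover have "h [^] (i * x) = (h [^] r) [^] (i * x div r) \<otimes> h"
      by (subst e) (use h in \<open>simp add: nat_pow_pow\<close>)
    moreover have "(h [^] r) [^] (i * x div r) \<in> M" (is "?y \<in> M") using pwM[OF hr] by simp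
    ultimately have "inv ?y \<otimes> (?y \<otimes> h) \<in> M" by simp
    moreover have "inv ?y \<otimes> (?y \<otimes> h) = h" by (rule inv_mult_cancel) (use h in auto)
    ultimately show False using hM by simp
  qed
  have "r dvd ord h" using hi[of "ord h"] h by simp
  define c where "c = h [^] (ord h div r)"
  have ordpos: "ord h > 0" using h fin ord_ge_1 by force
  have ci: "c [^] i = \<one>" if "r dvd i" for i :: nat
  proof -
    have "ord h dvd ord h div r * i" using \<open>r dvd ord h\<close> that by (auto elim!: dvdE)
    then show ?thesis using h by (simp add: c_def nat_pow_pow pow_eq_id)
  qed
  have c: "c \<in> carrier G" using h by (simp add: c_def)
  have c1: "c \<noteq> \<one>"
  proof
    assume "c = \<one>"
    then have "ord h dvd ord h div r" using h by (simp add: c_def pow_eq_id)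
    then show False using \<open>r dvd ord h\<close> ordpos prime_gt_1_nat[OF r(1)]
      by (auto elim!: dvdE)
  qed
  define M' where "M' = {a. \<exists>m \<in> M. \<exists>i::nat. a = m \<otimes> h [^] i}"
  have "subgroup M' G" unfolding M'_def by (rule subgroup_times_powers[OF fin sM h conjM[OF h]])
  moreover have "m \<in> M'" if "m \<in> M" for m
    unfolding M'_def using that by (auto intro!: bexI[of _ m] exI[of _ "0::nat"])
  then have "M \<subseteq> M'" by auto
  moreover have "h \<in> M'" unfolding M'_def using h M.one_closed
    by (auto intro!: bexI[of _ \<one>] exI[of _ "1::nat"])
  ultimately have "M' = carrier G" using max[of M'] hM LM by (auto simp: \<M>_def)
  then have gen: "\<exists>m \<in> M. \<exists>i::nat. a = m \<otimes> h [^] i" if "a \<in> carrier G" for a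
    using that unfolding M'_def by blast
  obtain f where f: "f \<in> hom G G" "\<And>m i. m \<in> M \<Longrightarrow> f (m \<otimes> h [^] (i::nat)) = c [^] i"
    using hom_from_cyclic_extension[OF group_axioms group_axioms sM conjM h gen c ci[OF hi]] by blast
  have fL: "f a = \<one>" if "a \<in> L" for a using f(2)[of a 0] that LM by auto
  have "f h = c" using f(2)[of \<one> 1] h c by simp
  moreover have "f a [^] r = \<one>" if a: "a \<in> carrier G" for a
  proof -
    obtain m i where "m \<in> M" "a = m \<otimes> h [^] (i::nat)" using gen[OF a] by blast
    then have "f a [^] r = c [^] (i * r)" using f(2) c by (simp add: nat_pow_pow)
    then show ?thesis using ci by simp
  qed
  ultimately show ?thesis using f(1) r(1) fL h c1 by (intro bexI[of _ f] exI[of _ r]) auto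
qed

text \<open>The transfer \<open>V\<close> into the central subgroup \<open>Z\<close> acts on \<open>Z\<close> as raising to the power
  \<open>|G : Z|\<close>, which is invertible on \<open>Z\<close> because the index is prime to \<open>|Z|\<close>. So a power \<open>V ^ k\<close> of
  the transfer is a retraction of \<open>G\<close> onto \<open>Z\<close>, and \<open>c (V c) ^ (- k)\<close> is a homomorphism in \<open>c\<close>
  with kernel \<open>Z\<close>.\<close>

lemma (in group) central_coprime_complement_hom:
  assumes fin: "finite (carrier G)" and Z: "subgroup Z G"
    and cent: "\<And>z a. z \<in> Z \<Longrightarrow> a \<in> carrier G \<Longrightarrow> z \<otimes> a = a \<otimes> z"
    and cop: "coprime (card Z) (order G div card Z)"
  shows "\<exists>W \<in> hom G G. \<forall>c \<in> carrier G. W c = \<one> \<longleftrightarrow> c \<in> Z"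
proof -
  interpret Z: subgroup Z G by (rule Z)
  interpret Zg: comm_group "G\<lparr>carrier := Z\<rparr>"
    by (rule group.group_comm_groupI) (use Z.subgroup_is_group[OF group_axioms] cent in auto)
  let ?Z = "G\<lparr>carrier := Z\<rparr>"
  \<comment> \<open>Let \<open>\<rho>\<close> choose a representative of the coset of \<open>Z\<close> containing \<open>g\<close>.\<close>
  define \<rho> where "\<rho> g = (SOME h. h \<in> carrier G \<and> inv h \<otimes> g \<in> Z)" for g
  have rho: "\<rho> g \<in> carrier G" "inv (\<rho> g) \<otimes> g \<in> Z" if "g \<in> carrier G" for g
    using someI[of "\<lambda>h. h \<in> carrier G \<and> inv h \<otimes> g \<in> Z" g] that by (auto simp: \<rho>_def)
  have rho_eq: "\<rho> g = \<rho> h \<longleftrightarrow> inv g \<otimes> h \<in> Z" if gh: "g \<in> carrier G" "h \<in> carrier G" for g h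
  proof
    assume "\<rho> g = \<rho> h"
    then have "inv (inv (\<rho> g) \<otimes> g) \<otimes> (inv (\<rho> g) \<otimes> h) \<in> Z" using rho(2)[OF gh(1)] rho(2)[OF gh(2)] by simp
    then show "inv g \<otimes> h \<in> Z" using gh rho(1) by (simp add: word_simps)
  next
    assume z: "inv g \<otimes> h \<in> Z"
    have "inv k \<otimes> g \<in> Z \<longleftrightarrow> inv k \<otimes> h \<in> Z" if k: "k \<in> carrier G" for k
    proof
      assume "inv k \<otimes> g \<in> Z"
      then have "(inv k \<otimes> g) \<otimes> (inv g \<otimes> h) \<in> Z" using z by simp
      then show "inv k \<otimes> h \<in> Z" using gh k by (simp add: word_simps)
    next
      assume "inv k \<otimes> h \<in> Z"
      then have "(inv k \<otimes> h) \<otimes> inv (inv g \<otimes> h) \<in> Z" using z by simp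
      then show "inv k \<otimes> g \<in> Z" using gh k by (simp add: word_simps)
    qed
    then have "(\<lambda>k. k \<in> carrier G \<and> inv k \<otimes> g \<in> Z) = (\<lambda>k. k \<in> carrier G \<and> inv k \<otimes> h \<in> Z)" by auto
    then show "\<rho> g = \<rho> h" unfolding \<rho>_def by simp
  qed
  define T where "T = \<rho> ` carrier G"
  have T: "t \<in> carrier G" "\<rho> t = t" if tT: "t \<in> T" for t
  proof -
    obtain g where g: "g \<in> carrier G" "t = \<rho> g" using tT unfolding T_def by blast
    then show "t \<in> carrier G" using rho by simp
    show "\<rho> t = t" using g rho[OF g(1)] rho_eq[of "\<rho> g" g] by simp
  qed
  have finT: "finite T" using fin by (simp add: T_def)
  have "card (carrier G) = card T * card Z"
    unfolding T_def by (rule card_image_times_subgroup[OF fin subgroup_self Z.subset rho_eq])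
  then have cT: "card T = order G div card Z" using Z.finite_imp_card_positive[OF fin] by (simp add: order_def)
  \<comment> \<open>Multiplication by \<open>g\<close> permutes the transversal \<open>T\<close> up to the factors \<open>\<zeta> g t\<close> in \<open>Z\<close>.\<close>
  define \<zeta> where "\<zeta> g t = inv (\<rho> (g \<otimes> t)) \<otimes> (g \<otimes> t)" for g t
  have zeta: "\<zeta> g t \<in> Z" if "g \<in> carrier G" "t \<in> T" for g t using that T rho by (simp add: \<zeta>_def)
  define V where "V g = finprod ?Z (\<zeta> g) T" for g
  have VZ: "V g \<in> Z" if "g \<in> carrier G" for g
    using Zg.finprod_closed[of "\<zeta> g" T] zeta that by (auto simp: V_def)
  have Vhom: "V (g \<otimes> h) = V g \<otimes> V h" if gh: "g \<in> carrier G" "h \<in> carrier G" for g h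
  proof -
    let ?s = "\<lambda>t. \<rho> (h \<otimes> t)"
    have sT: "?s t \<in> T" if "t \<in> T" for t using T(1)[OF that] gh by (simp add: T_def)
    have z: "\<zeta> (g \<otimes> h) t = \<zeta> g (?s t) \<otimes> \<zeta> h t" if t: "t \<in> T" for t
    proof -
      have tG: "t \<in> carrier G" using T t by simp
      have sG: "?s t \<in> carrier G" using T sT t by simp
      have "inv (?s t) \<otimes> (h \<otimes> t) \<in> Z" using rho gh tG by simp
      then have "\<rho> (g \<otimes> ?s t) = \<rho> (g \<otimes> h \<otimes> t)"
        using rho_eq[of "g \<otimes> ?s t" "g \<otimes> h \<otimes> t"] gh tG sG by (simp add: word_simps)
      moreover have "\<rho> (g \<otimes> h \<otimes> t) \<in> carrier G" using rho gh tG by simp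
      ultimately show ?thesis using gh tG sG by (simp add: \<zeta>_def word_simps)
    qed
    have inj: "inj_on ?s T"
    proof (rule inj_onI)
      fix t t' assume t: "t \<in> T" "t' \<in> T" and "?s t = ?s t'"
      then have "\<rho> t = \<rho> t'" using rho_eq[of "h \<otimes> t" "h \<otimes> t'"] rho_eq[of t t'] T gh by (simp add: word_simps)
      then show "t = t'" using t T by simp
    qed
    have "?s ` T \<subseteq> T" using sT by auto
    then have im: "?s ` T = T" using inj finT by (simp add: endo_inj_surj)
    have "V (g \<otimes> h) = finprod ?Z (\<lambda>t. \<zeta> g (?s t) \<otimes> \<zeta> h t) T"
      unfolding V_def by (rule Zg.finprod_cong') (use z zeta gh sT in auto)
    also have "\<dots> = finprod ?Z (\<lambda>t. \<zeta> g (?s t)) T \<otimes> V h"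
      unfolding V_def using Zg.finprod_multf[of "\<lambda>t. \<zeta> g (?s t)" T "\<zeta> h"] zeta gh sT by auto
    also have "finprod ?Z (\<lambda>t. \<zeta> g (?s t)) T = finprod ?Z (\<zeta> g) (?s ` T)"
      by (rule Zg.finprod_reindex[symmetric]) (use inj im zeta gh in auto)
    also have "\<dots> = V g" using im by (simp add: V_def)
    finally show ?thesis .
  qed
  have Vz: "V z = z [^] card T" if z: "z \<in> Z" for z
  proof -
    have e: "\<zeta> z t = z" if t: "t \<in> T" for t
    proof -
      have tG: "t \<in> carrier G" using T t by simp
      have "\<rho> t = \<rho> (z \<otimes> t)" using rho_eq[of t "z \<otimes> t"] z tG cent[of z t] by (simp add: word_simps)
      then show ?thesis using T t tG z cent[of z t] by (simp add: \<zeta>_def word_simps)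
    qed
    have "V z = finprod ?Z (\<lambda>t. z) T" unfolding V_def by (rule Zg.finprod_cong') (use e z in auto)
    also have "\<dots> = z [^]\<^bsub>?Z\<^esub> card T" by (rule Zg.finprod_const) (use z in auto)
    also have "\<dots> = z [^] card T" by (rule nat_pow_consistent[symmetric])
    finally show ?thesis .
  qed
  have "coprime (card T) (card Z)" using cop cT by (simp add: coprime_commute)
  then obtain k where k: "[card T * k = 1] (mod card Z)" using cong_solve_coprime_nat by auto
  have pz: "z [^] m = z [^] n" if "z \<in> Z" "[m = n] (mod card Z)" for z and m n :: nat
  proof -
    have zG: "z \<in> carrier G" using that(1) by simp
    have zN: "z [^] card Z = \<one>"
      using Zg.pow_order_eq_1[of z] that(1) by (simp add: order_def flip: nat_pow_consistent)
    have red: "z [^] m = z [^] (m mod card Z)" for m :: nat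
    proof -
      have "z [^] m = z [^] (card Z * (m div card Z) + m mod card Z)" by simp
      also have "\<dots> = (z [^] card Z) [^] (m div card Z) \<otimes> z [^] (m mod card Z)"
        using zG by (simp only: nat_pow_mult[symmetric] nat_pow_pow nat_pow_closed)
      finally show ?thesis using zG by (simp add: zN)
    qed
    show ?thesis using red[of m] red[of n] that(2) by (simp add: cong_def)
  qed
  define W where "W c = c \<otimes> inv (V c) [^] k" for c
  have VG: "V c \<in> carrier G" if "c \<in> carrier G" for c using VZ that by auto
  have pwZ: "z [^] n \<in> Z" if "z \<in> Z" for z and n :: nat using that by (induction n) auto
  have "W \<in> hom G G"
  proof (rule homI)
    fix c d assume c: "c \<in> carrier G" "d \<in> carrier G"
    have "inv (V (c \<otimes> d)) [^] k = (inv (V c) \<otimes> inv (V d)) [^] k"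
      using c Vhom cent[of "inv (V c)" "inv (V d)"] VG VZ by (simp add: inv_mult_group)
    also have "\<dots> = inv (V c) [^] k \<otimes> inv (V d) [^] k"
      by (rule pow_mult_distrib) (use c VG cent[of "inv (V c)" "inv (V d)"] VZ in auto)
    finally have "W (c \<otimes> d) = c \<otimes> (d \<otimes> inv (V c) [^] k) \<otimes> inv (V d) [^] k"
      using c VG by (simp add: W_def m_assoc)
    also have "d \<otimes> inv (V c) [^] k = inv (V c) [^] k \<otimes> d"
      using cent[OF pwZ[of "inv (V c)" k] c(2)] VZ c by simp
    finally show "W (c \<otimes> d) = W c \<otimes> W d" using c VG by (simp add: W_def m_assoc)
  qed (use VG in \<open>auto simp: W_def\<close>)
  moreover have "W c = \<one> \<longleftrightarrow> c \<in> Z" if c: "c \<in> carrier G" for c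
  proof
    assume "W c = \<one>"
    then have "inv (inv (V c) [^] k) = c" using c VG by (intro inv_equality) (auto simp: W_def)
    moreover have "inv (inv (V c) [^] k) \<in> Z" using VZ[OF c] pwZ by simp
    ultimately show "c \<in> Z" by simp
  next
    assume z: "c \<in> Z"
    have "V c [^] k = c [^] (card T * k)" using z Vz by (simp add: nat_pow_pow)
    also have "\<dots> = c" using pz[OF z k] z by simp
    finally have "V c [^] k = c" .
    then show "W c = \<one>" using nat_pow_inv[OF VG[OF c], of k] c by (simp add: W_def)
  qed
  ultimately show ?thesis by blast
qed

section \<open>Nilpotent groups\<close>

lemma (in group) conj_pow:
  assumes "a \<in> carrier G" "c \<in> carrier G"
  shows "(conjugate a c) [^] (n::nat) = a \<otimes> c [^] n \<otimes> inv a"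
  by (induction n) (use assms in \<open>auto simp: word_simps\<close>)

lemma (in group) lower_central_subset: "lower_central G n \<subseteq> carrier G"
proof (induction n)
  case (Suc n)
  then show ?case unfolding lower_central.simps by (intro generate_incl) auto
qed simp

lemma (in group) commutator_in_lower_central:
  assumes "a \<in> lower_central G n" "h \<in> carrier G"
  shows "commutator a h \<in> lower_central G (Suc n)"
  unfolding lower_central.simps by (rule generate.incl) (use assms in auto)

lemma (in group_hom) lower_central_image:
  assumes "h ` carrier G = carrier H"
  shows "lower_central H n = h ` lower_central G n"
proof (induction n)
  case 0 then show ?case using assms by simp
next
  case (Suc n)
  let ?U = "\<Union>g \<in> lower_central G n. \<Union>k \<in> carrier G. {G.commutator g k}"
  have sub: "g \<in> carrier G" if "g \<in> lower_central G n" for g using G.lower_central_subset that by auto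
  have "h ` ?U = (\<Union>g \<in> lower_central G n. \<Union>k \<in> carrier G.
      {h g \<otimes>\<^bsub>H\<^esub> h k \<otimes>\<^bsub>H\<^esub> inv\<^bsub>H\<^esub> h g \<otimes>\<^bsub>H\<^esub> inv\<^bsub>H\<^esub> h k})"
    using sub by (auto simp: image_UN)
  also have "\<dots> = (\<Union>g \<in> lower_central H n. \<Union>k \<in> carrier H.
      {g \<otimes>\<^bsub>H\<^esub> k \<otimes>\<^bsub>H\<^esub> inv\<^bsub>H\<^esub> g \<otimes>\<^bsub>H\<^esub> inv\<^bsub>H\<^esub> k})"
    by (simp add: Suc flip: assms)
  finally have e: "h ` ?U = \<dots>" .
  have "?U \<subseteq> carrier G" using sub by auto
  then show ?case using generate_img[of ?U] by (simp only: e lower_central.simps)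
qed

lemma (in group_hom) nilpotent_image:
  assumes "h ` carrier G = carrier H" and "nilpotent_group G"
  shows "nilpotent_group H"
proof -
  obtain n where "lower_central G n = {\<one>}" using assms(2) by (auto simp: nilpotent_group_def)
  then have "lower_central H n = {\<one>\<^bsub>H\<^esub>}" using lower_central_image[OF assms(1), of n] by simp
  then show ?thesis unfolding nilpotent_group_def using H.group_axioms by blast
qed

text \<open>By induction \<open>N\<close> lies in every term of the lower central series.\<close>

lemma (in group) nilpotent_no_self_commuting_subset:
  assumes "nilpotent_group G" and N: "N \<subseteq> carrier G"
    and gen: "N \<subseteq> generate G {commutator a h | a h. a \<in> N \<and> h \<in> carrier G}"
  shows "N \<subseteq> {\<one>}"
proof -
  have "N \<subseteq> lower_central G n" for n
  proof (induction n)
    case (Suc n)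
    have "{commutator a h | a h. a \<in> N \<and> h \<in> carrier G}
        \<subseteq> (\<Union>g \<in> lower_central G n. \<Union>h \<in> carrier G. {commutator g h})"
      using Suc by blast
    then show ?case unfolding lower_central.simps using gen mono_generate by blast
  qed (use N in simp)
  then show ?thesis using assms(1) by (auto simp: nilpotent_group_def)
qed

text \<open>Groups of class at most \<open>2\<close>: the term of index \<open>2\<close> of the lower central series is generated
  by trivial commutators.\<close>

lemma (in group) nilpotent_if_commutators_central:
  assumes c: "\<And>a b g. a \<in> carrier G \<Longrightarrow> b \<in> carrier G \<Longrightarrow> g \<in> carrier G \<Longrightarrow>
    (commutator a b) \<otimes> g = g \<otimes> (commutator a b)"
  shows "nilpotent_group G"
proof -
  have cen: "z \<otimes> g = g \<otimes> z" if z: "z \<in> lower_central G 1" and g: "g \<in> carrier G" for z g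
  proof -
    let ?U = "(\<Union>g \<in> carrier G. \<Union>h \<in> carrier G. {commutator g h})"
    have U: "?U \<subseteq> carrier G" by auto
    have "z \<in> generate G ?U" using z by simp
    then show ?thesis
    proof (induction z rule: generate.induct)
      case one then show ?case using g by simp
    next
      case (incl h) then show ?case using c g by auto
    next
      case (inv h)
      then have h: "h \<in> carrier G" "h \<otimes> g = g \<otimes> h" using c[OF _ _ g] U by auto
      have "inv h \<otimes> g = inv h \<otimes> (g \<otimes> h) \<otimes> inv h" using h(1) g by (simp add: word_simps)
      also have "\<dots> = g \<otimes> inv h" using h(1) g by (simp add: word_simps flip: h(2))
      finally show ?case .
    next
      case (eng h1 h2)
      then have h: "h1 \<in> carrier G" "h2 \<in> carrier G" using generate_incl[OF U] by auto
      have "h1 \<otimes> h2 \<otimes> g = h1 \<otimes> (g \<otimes> h2)" using h g eng by (simp add: m_assoc)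
      also have "\<dots> = g \<otimes> (h1 \<otimes> h2)" using h g eng by (simp flip: m_assoc)
      finally show ?case .
    qed
  qed
  have "lower_central G (Suc 1) = generate G {\<one>}"
  proof -
    have "commutator g h = \<one>" if "g \<in> lower_central G 1" "h \<in> carrier G" for g h
    proof -
      have gG: "g \<in> carrier G" using lower_central_subset that by blast
      show ?thesis using cen[OF that] that gG by (simp add: word_simps)
    qed
    then have "(\<Union>g \<in> lower_central G 1. \<Union>h \<in> carrier G. {commutator g h})
      = (\<Union>g \<in> lower_central G 1. \<Union>h \<in> carrier G. {\<one>})" by simp
    moreover have "lower_central G 1 \<noteq> {}" by (auto intro: generate.one)
    ultimately show ?thesis by (simp only: lower_central.simps) auto
  qed
  also have "\<dots> = {\<one>}" by (rule generate_one)
  finally show ?thesis unfolding nilpotent_group_def using group_axioms by blast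
qed

lemma (in group) nilpotent_subgroupI:
  assumes L: "subgroup L G"
    and c: "\<And>g h k. g \<in> L \<Longrightarrow> h \<in> L \<Longrightarrow> k \<in> L \<Longrightarrow>
      (commutator g h) \<otimes> k = k \<otimes> (commutator g h)"
  shows "nilpotent_group (G\<lparr>carrier := L\<rparr>)"
proof -
  interpret LG: group "G\<lparr>carrier := L\<rparr>" by (rule subgroup_imp_group[OF L])
  show ?thesis by (rule LG.nilpotent_if_commutators_central) (use c L in \<open>auto simp: m_inv_consistent\<close>)
qed

text \<open>The commutators of \<open>A\<close> are commutators of \<open>A\<close> with the nilpotent group \<open>K\<close>.\<close>

lemma (in group) nilpotent_perfect_trivial:
  assumes K: "subgroup K G" "nilpotent_group (G\<lparr>carrier := K\<rparr>)" and A: "A \<subseteq> K"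
    and gen: "A \<subseteq> generate G {commutator a c | a c. a \<in> A \<and> c \<in> A}"
  shows "A \<subseteq> {\<one>}"
proof -
  interpret KG: group "G\<lparr>carrier := K\<rparr>" by (rule subgroup_imp_group[OF K(1)])
  interpret K: subgroup K G by (rule K(1))
  let ?X = "{commutator a c | a c. a \<in> A \<and> c \<in> A}"
  let ?Y = "{a \<otimes>\<^bsub>G\<lparr>carrier := K\<rparr>\<^esub> h \<otimes>\<^bsub>G\<lparr>carrier := K\<rparr>\<^esub> inv\<^bsub>G\<lparr>carrier := K\<rparr>\<^esub> a \<otimes>\<^bsub>G\<lparr>carrier := K\<rparr>\<^esub> inv\<^bsub>G\<lparr>carrier := K\<rparr>\<^esub> h
     | a h. a \<in> A \<and> h \<in> carrier (G\<lparr>carrier := K\<rparr>)}"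
  have XK: "?X \<subseteq> K" using A by (auto simp: subset_iff)
  have "?X \<subseteq> ?Y"
  proof
    fix z assume "z \<in> ?X"
    then obtain a c where "a \<in> A" "c \<in> A" "z = commutator a c" by blast
    then have "a \<in> A \<and> c \<in> carrier (G\<lparr>carrier := K\<rparr>)"
      "z = a \<otimes>\<^bsub>G\<lparr>carrier := K\<rparr>\<^esub> c \<otimes>\<^bsub>G\<lparr>carrier := K\<rparr>\<^esub> inv\<^bsub>G\<lparr>carrier := K\<rparr>\<^esub> a \<otimes>\<^bsub>G\<lparr>carrier := K\<rparr>\<^esub> inv\<^bsub>G\<lparr>carrier := K\<rparr>\<^esub> c"
      using A by (auto simp: m_inv_consistent[OF K(1)] subset_iff)
    then show "z \<in> ?Y" by blast
  qed
  then have "generate (G\<lparr>carrier := K\<rparr>) ?X \<subseteq> generate (G\<lparr>carrier := K\<rparr>) ?Y" by (rule KG.mono_generate)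
  moreover have "generate (G\<lparr>carrier := K\<rparr>) ?X = generate G ?X" by (rule generate_consistent[OF XK K(1)])
  ultimately have "A \<subseteq> generate (G\<lparr>carrier := K\<rparr>) ?Y" using gen by blast
  then show ?thesis using KG.nilpotent_no_self_commuting_subset[OF K(2), of A] A by simp
qed

text \<open>Since \<open>z\<close> commutes with \<open>c\<close>, the \<open>n\<close>-th power of \<open>a c a\<inverse> = z c\<close> is \<open>z ^ n\<close>; on the other
  hand it is the conjugate of \<open>c ^ n = \<one>\<close>.\<close>

lemma (in group) commute_if_commutator_commutes:
  assumes "a \<in> carrier G" "c \<in> carrier G" and z: "z = commutator a c"
    and "c [^] n = \<one>" "z \<otimes> c = c \<otimes> z" and tors: "z [^] (n::nat) = \<one> \<Longrightarrow> z = \<one>"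
  shows "a \<otimes> c = c \<otimes> a"
proof -
  have zG: "z \<in> carrier G" using assms by simp
  have "z [^] n = z [^] n \<otimes> c [^] n" using assms zG by simp
  also have "\<dots> = (z \<otimes> c) [^] n" by (rule pow_mult_distrib[symmetric]) (use assms zG in auto)
  also have "z \<otimes> c = conjugate a c" using assms(1,2) by (simp add: z word_simps)
  also have "(conjugate a c) [^] n = \<one>" using assms by (simp add: conj_pow)
  finally have "z = \<one>" by (rule tors)
  then have "z \<otimes> (c \<otimes> a) = c \<otimes> a" using assms by simp
  then show ?thesis using assms(1,2) by (simp add: z word_simps)
qed

text \<open>Elements of coprime order commute in a nilpotent group; coprimality enters as the absence of
  \<open>n\<close>-torsion in \<open>P\<close>. Going up the lower central series from its trivial term, the commutator of
  \<open>a\<close> and \<open>c\<close> lies one term further down than \<open>a\<close>, so it commutes with \<open>c\<close> by induction.\<close>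

lemma (in group) nilpotent_coprime_commute:
  assumes "nilpotent_group G" and P: "P \<subseteq> carrier G" and c: "c \<in> carrier G" "c [^] (n::nat) = \<one>"
    and inv: "\<And>a. a \<in> P \<Longrightarrow> commutator a c \<in> P"
    and tors: "\<And>a. a \<in> P \<Longrightarrow> a [^] n = \<one> \<Longrightarrow> a = \<one>"
    and a: "a \<in> P"
  shows "a \<otimes> c = c \<otimes> a"
proof -
  obtain N where N: "lower_central G N = {\<one>}" using assms(1) by (auto simp: nilpotent_group_def)
  have "\<forall>a \<in> P \<inter> lower_central G (N - i). a \<otimes> c = c \<otimes> a" if "i \<le> N" for i
    using that
  proof (induction i)
    case 0 then show ?case using N c by simp
  next
    case (Suc i)
    show ?case
    proof
      fix a assume a: "a \<in> P \<inter> lower_central G (N - Suc i)"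
      have "commutator a c \<in> lower_central G (Suc (N - Suc i))"
        by (rule commutator_in_lower_central) (use a c in auto)
      then have "commutator a c \<in> P \<inter> lower_central G (N - i)"
        using a inv Suc.prems by (simp add: Suc_diff_Suc)
      then have z: "(commutator a c) \<otimes> c = c \<otimes> (commutator a c)" "commutator a c \<in> P"
        using Suc by auto
      show "a \<otimes> c = c \<otimes> a"
        by (rule commute_if_commutator_commutes[OF _ c(1) refl c(2) z(1) tors[OF z(2)]]) (use a P in auto)
    qed
  qed
  from this[of N] show ?thesis using a P by auto
qed

lemma (in group) nilpotent_subgroup_coprime_commute:
  assumes K: "subgroup K G" "nilpotent_group (G\<lparr>carrier := K\<rparr>)" and P: "P \<subseteq> K" and c: "c \<in> K" "c [^] (n::nat) = \<one>"
    and inv: "\<And>a. a \<in> P \<Longrightarrow> commutator a c \<in> P"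
    and tors: "\<And>a. a \<in> P \<Longrightarrow> a [^] n = \<one> \<Longrightarrow> a = \<one>"
    and a: "a \<in> P"
  shows "a \<otimes> c = c \<otimes> a"
proof -
  let ?K = "G\<lparr>carrier := K\<rparr>"
  interpret KG: group ?K by (rule subgroup_imp_group[OF K(1)])
  have "a \<otimes>\<^bsub>?K\<^esub> c = c \<otimes>\<^bsub>?K\<^esub> a"
  proof (rule KG.nilpotent_coprime_commute[OF K(2), where P = P and n = n])
    show "KG.commutator r c \<in> P" if r: "r \<in> P" for r
      using inv[OF r] r P c(1) by (auto simp: m_inv_consistent[OF K(1)] subset_iff)
  qed (use P c tors a in \<open>auto simp flip: nat_pow_consistent\<close>)
  then show ?thesis by simp
qed

lemma nilpotent_group_iso:
  assumes "f \<in> iso G H" "group G" "group H" "nilpotent_group G"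
  shows "nilpotent_group H"
proof -
  interpret group_hom G H f using assms by (simp add: group_hom_def group_hom_axioms_def iso_def)
  show ?thesis by (rule nilpotent_image) (use assms in \<open>auto simp: iso_def bij_betw_def\<close>)
qed

lemma schmidt_group_params_iso:
  assumes f: "f \<in> iso S G" and "group S" "group G" and par: "schmidt_group_params S p q v"
  shows "schmidt_group_params G p q v"
proof -
  interpret S: group S by fact
  interpret G: group G by fact
  interpret f: group_hom S G f using f by unfold_locales (simp add: iso_def)
  have bij: "inj_on f (carrier S)" "f ` carrier S = carrier G" using f by (auto simp: iso_def bij_betw_def)
  have schS: "schmidt_group S" using par by (simp add: schmidt_group_params_def)
  have "schmidt_group G"
    unfolding schmidt_group_def
  proof (intro conjI allI impI)
    show "finite (carrier G)" using schS by (auto simp: schmidt_group_def simp flip: bij(2))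
    show "\<not> nilpotent_group G" 
      using schS nilpotent_group_iso[OF S.iso_set_sym[OF f] assms(3,2)] by (auto simp: schmidt_group_def)
    fix K assume K: "subgroup K G \<and> K \<noteq> carrier G"
    then interpret K: subgroup K G by simp
    define L where "L = {g \<in> carrier S. f g \<in> K}"
    have L: "subgroup L S" by (rule S.subgroupI) (use K.one_closed f.hom_one S.one_closed in \<open>auto simp: L_def\<close>)
    have fL: "f ` L = K" using bij(2) K.subset unfolding L_def by auto
    then have "L \<noteq> carrier S" using K bij(2) by auto
    then have "nilpotent_group (S\<lparr>carrier := L\<rparr>)" using schS L by (simp add: schmidt_group_def)
    moreover have "group_hom (S\<lparr>carrier := L\<rparr>) (G\<lparr>carrier := K\<rparr>) f"
      using S.subgroup_imp_group[OF L] G.subgroup_imp_group[of K] K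
      by (auto simp: group_hom_def group_hom_axioms_def hom_def L_def)
    ultimately show "nilpotent_group (G\<lparr>carrier := K\<rparr>)"
      using group_hom.nilpotent_image[of _ _ f] fL by fastforce
  qed (rule assms(3))
  moreover
  have D: "derived G (carrier G) = f ` derived S (carrier S)" using f.derived_img[of "carrier S"] bij(2) by simp
  have DS: "derived S (carrier S) \<subseteq> carrier S" by (rule S.derived_in_carrier) simp
  have "card (derived G (carrier G)) = card (derived S (carrier S))"
    unfolding D by (rule card_image) (use bij(1) DS in \<open>auto intro: inj_on_subset\<close>)
  moreover obtain b where b: "b \<in> carrier S" "card (generate S {b}) = q ^ v"
    and sd: "internal_semidirect S (derived S (carrier S)) (generate S {b})"
    using par by (auto simp: schmidt_group_params_def)
  have gS: "generate S {b} \<subseteq> carrier S" by (rule S.generate_incl) (use b in auto)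
  have gG: "generate G {f b} = f ` generate S {b}" using f.generate_img[of "{b}"] b by simp
  moreover have "card (generate G {f b}) = q ^ v"
    unfolding gG b(2)[symmetric] by (rule card_image) (use bij(1) gS in \<open>auto intro: inj_on_subset\<close>)
  moreover have "internal_semidirect G (derived G (carrier G)) (generate G {f b})"
    unfolding internal_semidirect_def
  proof (intro conjI)
    show "derived G (carrier G) \<lhd> G" by (rule G.derived_is_normal) (rule G.normal_self)
    show "subgroup (generate G {f b}) G" by (rule G.generate_is_subgroup) (use b in auto)
    have "f ` (derived S (carrier S)) \<inter> f ` (generate S {b}) = f ` (derived S (carrier S) \<inter> generate S {b})"
      using inj_on_image_Int[OF bij(1) DS gS] by simp
    then show "derived G (carrier G) \<inter> generate G {f b} = {\<one>\<^bsub>G\<^esub>}"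
      using sd unfolding D gG internal_semidirect_def by simp
    show "derived G (carrier G) <#>\<^bsub>G\<^esub> generate G {f b} = carrier G"
      unfolding D gG using set_mult_hom[OF f.homh DS gS] sd bij(2) by (simp add: internal_semidirect_def)
  qed
  ultimately show ?thesis using par b(1) unfolding schmidt_group_params_def by (auto intro!: bexI[of _ "f b"])
qed

section \<open>Irreducible actions on abelian p-groups\<close>

lemma (in cring) binomial_expansion:
  assumes x: "x \<in> carrier R" "y \<in> carrier R"
  shows "(x \<oplus> y) [^] (n::nat) = (\<Oplus>i\<in>{..n}. add_pow R (n choose i) (x [^] i \<otimes> y [^] (n - i)))"
proof (induction n)
  case 0 then show ?case using x by simp
next
  case (Suc n)
  let ?t = "\<lambda>i. add_pow R (n choose i) (x [^] i \<otimes> y [^] (n - i))"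
  let ?s = "\<lambda>i. add_pow R (n choose i) (x [^] i \<otimes> y [^] (Suc n - i))"
  let ?r = "\<lambda>i. add_pow R (Suc n choose i) (x [^] i \<otimes> y [^] (Suc n - i))"
  have tx: "?t i \<otimes> x = add_pow R (n choose i) (x [^] Suc i \<otimes> y [^] (Suc n - Suc i))" for i
  proof -
    have "?t i \<otimes> x = add_pow R (n choose i) (x [^] i \<otimes> y [^] (n - i) \<otimes> x)"
      by (rule add_pow_ldistr) (use x in auto)
    also have "x [^] i \<otimes> y [^] (n - i) \<otimes> x = x [^] Suc i \<otimes> y [^] (Suc n - Suc i)"
      using x by (simp add: m_ac)
    finally show ?thesis .
  qed
  have ty: "?t i \<otimes> y = ?s i" if "i \<le> n" for i
  proof -
    have "?t i \<otimes> y = add_pow R (n choose i) (x [^] i \<otimes> y [^] (n - i) \<otimes> y)"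
      by (rule add_pow_ldistr) (use x in auto)
    also have "x [^] i \<otimes> y [^] (n - i) \<otimes> y = x [^] i \<otimes> y [^] (Suc n - i)"
      using x that by (simp add: m_assoc Suc_diff_le)
    finally show ?thesis .
  qed
  have tx': "?r (Suc i) = ?t i \<otimes> x \<oplus> ?s (Suc i)" for i
    unfolding tx using x by (simp add: add.nat_pow_mult[symmetric] a_comm)
  have "(x \<oplus> y) [^] Suc n = (\<Oplus>i\<in>{..n}. ?t i) \<otimes> x \<oplus> (\<Oplus>i\<in>{..n}. ?t i) \<otimes> y"
    using x by (simp add: Suc r_distr)
  also have "(\<Oplus>i\<in>{..n}. ?t i) \<otimes> x = (\<Oplus>i\<in>{..n}. ?t i \<otimes> x)"
    by (rule finsum_ldistr) (use x in auto)
  also have "(\<Oplus>i\<in>{..n}. ?t i) \<otimes> y = (\<Oplus>i\<in>{..n}. ?t i \<otimes> y)"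
    by (rule finsum_ldistr) (use x in auto)
  also have "\<dots> = (\<Oplus>i\<in>{..n}. ?s i)" by (rule finsum_cong') (use x ty in auto)
  also have "\<dots> = (\<Oplus>i\<in>{..Suc n}. ?s i)" using x by (simp add: finsum_Suc Pi_def binomial_eq_0)
  also have "\<dots> = (\<Oplus>i\<in>{..n}. ?s (Suc i)) \<oplus> ?s 0" by (rule finsum_Suc2) (use x in auto)
  also have "(\<Oplus>i\<in>{..n}. ?t i \<otimes> x) \<oplus> ((\<Oplus>i\<in>{..n}. ?s (Suc i)) \<oplus> ?s 0)
      = (\<Oplus>i\<in>{..n}. ?t i \<otimes> x \<oplus> ?s (Suc i)) \<oplus> ?s 0"
    using x by (subst finsum_addf) (auto simp: a_assoc)
  also have "\<dots> = (\<Oplus>i\<in>{..n}. ?r (Suc i)) \<oplus> ?r 0"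
    using x by (simp only: tx') simp
  also have "\<dots> = (\<Oplus>i\<in>{..Suc n}. ?r i)" by (rule finsum_Suc2[symmetric]) (use x in auto)
  finally show ?case .
qed

text \<open>The prime \<open>p\<close> divides the inner binomial coefficients.\<close>

lemma (in cring) frobenius_additive:
  fixes p u :: nat
  assumes p: "prime p" and char: "\<And>a. a \<in> carrier R \<Longrightarrow> add_pow R p a = \<zero>"
    and x: "x \<in> carrier R" "y \<in> carrier R"
  shows "(x \<oplus> y) [^] (p ^ u) = x [^] (p ^ u) \<oplus> y [^] (p ^ u)"
proof (induction u)
  case 0 then show ?case using x by simp
next
  case (Suc u)
  have one: "(a \<oplus> b) [^] p = a [^] p \<oplus> b [^] p" if ab: "a \<in> carrier R" "b \<in> carrier R" for a b
  proof -
    obtain k where k: "p = Suc (Suc k)" using prime_gt_1_nat[OF p] less_imp_Suc_add[of 1 p] by auto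
    let ?t = "\<lambda>i. add_pow R (p choose i) (a [^] i \<otimes> b [^] (p - i))"
    have z: "?t (Suc i) = \<zero>" if "i \<le> k" for i
    proof -
      have "p dvd (p choose Suc i)" by (rule dvd_choose_prime) (use p k that in auto)
      then obtain m where "p choose Suc i = p * m" by (rule dvdE)
      then show ?thesis using ab add.nat_pow_pow[of "a [^] Suc i \<otimes> b [^] (p - Suc i)" m p]
        by (simp add: char mult.commute del: nat_pow_Suc)
    qed
    have "(\<Oplus>i\<in>{..k}. ?t (Suc i)) = \<zero>" by (rule add.finprod_one_eqI) (use z in auto)
    moreover have "(\<Oplus>i\<in>{..Suc k}. ?t i) = (\<Oplus>i\<in>{..k}. ?t (Suc i)) \<oplus> ?t 0"
      by (rule finsum_Suc2) (use ab in auto)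
    moreover have "(\<Oplus>i\<in>{..Suc (Suc k)}. ?t i) = ?t (Suc (Suc k)) \<oplus> (\<Oplus>i\<in>{..Suc k}. ?t i)"
      by (rule finsum_Suc) (use ab in auto)
    ultimately have "(\<Oplus>i\<in>{..p}. ?t i) = ?t p \<oplus> ?t 0" using ab k by simp
    then show ?thesis using binomial_expansion[OF ab, of p] ab by simp
  qed
  have "(x \<oplus> y) [^] (p ^ Suc u) = ((x \<oplus> y) [^] (p ^ u)) [^] p" using x by (simp add: nat_pow_pow mult.commute)
  also have "\<dots> = (x [^] (p ^ u)) [^] p \<oplus> (y [^] (p ^ u)) [^] p" using Suc x one by simp
  finally show ?case using x by (simp add: nat_pow_pow mult.commute)
qed

text \<open>For an abelian group \<open>A\<close>, written multiplicatively, this is the ring of endomorphisms of \<open>A\<close>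
  as a module over the polynomials in \<open>\<theta>\<close>; its addition is the pointwise product.\<close>

definition commuting_endomorphism_ring :: "('a, 'b) monoid_scheme \<Rightarrow> ('a \<Rightarrow> 'a) \<Rightarrow> ('a \<Rightarrow> 'a) ring" where
  "commuting_endomorphism_ring A \<theta> =
    \<lparr>carrier = {f \<in> hom A A \<inter> extensional (carrier A). \<forall>a \<in> carrier A. f (\<theta> a) = \<theta> (f a)},
     monoid.mult = compose (carrier A), one = (\<lambda>a \<in> carrier A. a),
     zero = (\<lambda>a \<in> carrier A. \<one>\<^bsub>A\<^esub>), add = (\<lambda>f g. \<lambda>a \<in> carrier A. f a \<otimes>\<^bsub>A\<^esub> g a)\<rparr>"

text \<open>For an irreducible endomorphism \<open>\<theta>\<close> of a finite abelian \<open>p\<close>-group, Schur's lemma makes the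
  ring of endomorphisms commuting with \<open>\<theta>\<close> a finite field with as many elements as the group. If
  some power of \<open>\<theta>\<close> equals \<open>\<theta>\<close>, counting roots of a polynomial bounds this number.\<close>

locale irreducible_action = comm_group A for A (structure) +
  fixes \<theta> :: "'a \<Rightarrow> 'a" and p k :: nat
  assumes theta: "\<theta> \<in> hom A A"
    and irreducible: "\<And>B. subgroup B A \<Longrightarrow> \<theta> ` B \<subseteq> B \<Longrightarrow> B = {\<one>} \<or> B = carrier A"
    and p: "prime p" and k: "k > 0" and card_A: "card (carrier A) = p ^ k"
begin

lemma fin: "finite (carrier A)"
  using card_A prime_gt_0_nat[OF p] by (metis card.infinite power_eq_0_iff less_irrefl)

lemma nontrivial_element:
  obtains c where "c \<in> carrier A" "c \<noteq> \<one>"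
proof -
  have "carrier A \<noteq> {\<one>}"
  proof
    assume "carrier A = {\<one>}"
    then have "p ^ k = 1" using card_A by simp
    then show False using k prime_gt_1_nat[OF p] by simp
  qed
  then show ?thesis using that by auto
qed

lemma theta_closed [simp]: "a \<in> carrier A \<Longrightarrow> \<theta> a \<in> carrier A"
  using theta by (auto simp: hom_def)

lemma theta_mult [simp]: "a \<in> carrier A \<Longrightarrow> b \<in> carrier A \<Longrightarrow> \<theta> (a \<otimes> b) = \<theta> a \<otimes> \<theta> b"
  using theta by (auto simp: hom_def)

lemma theta_one [simp]: "\<theta> \<one> = \<one>"
  using theta hom_one group_axioms by blast

lemma irreducible_submonoid:
  assumes "B \<subseteq> carrier A" "\<And>a b. a \<in> B \<Longrightarrow> b \<in> B \<Longrightarrow> a \<otimes> b \<in> B" "\<And>a. a \<in> B \<Longrightarrow> \<theta> a \<in> B"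
    and "c \<in> B" "c \<noteq> \<one>"
  shows "B = carrier A"
proof -
  have "subgroup B A" by (rule finite_subgroupI[OF fin]) (use assms in auto)
  then show ?thesis using irreducible[of B] assms by auto
qed

text \<open>The elements of order dividing \<open>p\<close> form an invariant subgroup, nontrivial by Cauchy's
  theorem.\<close>

lemma exponent_p:
  assumes "a \<in> carrier A" shows "a [^] p = \<one>"
proof -
  have "p dvd order A" using k card_A by (simp add: order_def)
  then obtain c where c: "c \<in> carrier A" "c \<noteq> \<one>" "c [^] p = \<one>" using element_of_prime_order[OF fin p] by blast
  define B where "B = {a \<in> carrier A. a [^] p = \<one>}"
  have thp: "\<theta> (a [^] n) = \<theta> a [^] n" if "a \<in> carrier A" for a and n :: nat
    using that by (induction n) auto
  have "B = carrier A"
  proof (rule irreducible_submonoid[where c = c])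
    show "\<theta> a \<in> B" if "a \<in> B" for a using that thp[of a p] by (simp add: B_def)
  qed (use c in \<open>auto simp: B_def nat_pow_distrib\<close>)
  then show ?thesis using assms by (auto simp: B_def)
qed

abbreviation R where "R \<equiv> commuting_endomorphism_ring A \<theta>"

lemma R_simps [simp]:
  "f \<in> carrier R \<longleftrightarrow> f \<in> hom A A \<and> f \<in> extensional (carrier A) \<and> (\<forall>a \<in> carrier A. f (\<theta> a) = \<theta> (f a))"
  "f \<otimes>\<^bsub>R\<^esub> g = compose (carrier A) f g" "\<one>\<^bsub>R\<^esub> = (\<lambda>a \<in> carrier A. a)"
  "\<zero>\<^bsub>R\<^esub> = (\<lambda>a \<in> carrier A. \<one>)" "f \<oplus>\<^bsub>R\<^esub> g = (\<lambda>a \<in> carrier A. f a \<otimes> g a)"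
  by (auto simp: commuting_endomorphism_ring_def)

lemma hom_simps [simp]:
  "f \<in> hom A A \<Longrightarrow> a \<in> carrier A \<Longrightarrow> f a \<in> carrier A"
  "f \<in> hom A A \<Longrightarrow> a \<in> carrier A \<Longrightarrow> b \<in> carrier A \<Longrightarrow> f (a \<otimes> b) = f a \<otimes> f b"
  "f \<in> hom A A \<Longrightarrow> f \<one> = \<one>"
    apply (auto simp: hom_def)[2]
  using hom_one group_axioms by blast

lemma ring_R: "ring R"
proof (rule ringI)
  show "abelian_group R"
  proof (rule abelian_groupI)
    fix f assume f: "f \<in> carrier R"
    show "\<exists>g\<in>carrier R. g \<oplus>\<^bsub>R\<^esub> f = \<zero>\<^bsub>R\<^esub>"
    proof (rule bexI[of _ "\<lambda>a \<in> carrier A. inv (f a)"])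
      have "\<theta> (inv a) = inv (\<theta> a)" if "a \<in> carrier A" for a
      proof -
        have "\<theta> (inv a) \<otimes> \<theta> a = \<one>" using that theta_mult[of "inv a" a] by (simp del: theta_mult)
        then show ?thesis using that by (metis inv_equality theta_closed inv_closed)
      qed
      then show "(\<lambda>a \<in> carrier A. inv (f a)) \<in> carrier R"
        using f by (auto intro!: homI simp: inv_mult m_comm)
      show "(\<lambda>a \<in> carrier A. inv (f a)) \<oplus>\<^bsub>R\<^esub> f = \<zero>\<^bsub>R\<^esub>" using f by (auto intro!: restrict_ext)
    qed
  qed (auto intro!: homI restrict_ext ext simp: m_ac extensional_def)
next
  show "monoid R"
    by (rule monoidI) (auto intro!: homI ext simp: compose_def extensional_def)
qed (auto intro!: ext simp: compose_def)

text \<open>The equalizer of \<open>f\<close> and \<open>g\<close> is an invariant subgroup.\<close>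

lemma equalizer:
  assumes "f \<in> carrier R" "g \<in> carrier R" "c \<in> carrier A" "c \<noteq> \<one>" "f c = g c"
  shows "f = g"
proof -
  have "{a \<in> carrier A. f a = g a} = carrier A"
    by (rule irreducible_submonoid[where c = c]) (use assms in auto)
  then show ?thesis using assms by (intro extensionalityI[of f "carrier A" g]) auto
qed

text \<open>The values at \<open>c\<close> of the elements of \<open>S\<close> form an invariant subgroup.\<close>

lemma evaluation_onto:
  assumes S: "S \<subseteq> carrier R" "restrict \<theta> (carrier A) \<in> S" "\<one>\<^bsub>R\<^esub> \<in> S"
    and add: "\<And>f g. f \<in> S \<Longrightarrow> g \<in> S \<Longrightarrow> f \<oplus>\<^bsub>R\<^esub> g \<in> S"
    and mult: "\<And>f g. f \<in> S \<Longrightarrow> g \<in> S \<Longrightarrow> f \<otimes>\<^bsub>R\<^esub> g \<in> S"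
    and c: "c \<in> carrier A" "c \<noteq> \<one>"
  shows "(\<lambda>f. f c) ` S = carrier A"
proof (rule irreducible_submonoid[where c = c])
  show "(\<lambda>f. f c) ` S \<subseteq> carrier A" using S(1) c by auto
  show "c \<in> (\<lambda>f. f c) ` S" using S(3) c by (intro image_eqI[of _ _ "\<one>\<^bsub>R\<^esub>"]) auto
  show "c \<noteq> \<one>" by fact
  show "\<theta> a \<in> (\<lambda>f. f c) ` S" if "a \<in> (\<lambda>f. f c) ` S" for a
  proof -
    obtain f where f: "f \<in> S" "a = f c" using \<open>a \<in> _\<close> by auto
    then have "\<theta> a = (restrict \<theta> (carrier A) \<otimes>\<^bsub>R\<^esub> f) c" using S(1) c by (auto simp: compose_def)
    then show ?thesis using mult[OF S(2) f(1)] by blast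
  qed
  show "a \<otimes> b \<in> (\<lambda>f. f c) ` S" if ab: "a \<in> (\<lambda>f. f c) ` S" "b \<in> (\<lambda>f. f c) ` S" for a b
  proof -
    obtain f where f: "f \<in> S" "a = f c" using ab(1) by auto
    obtain g where g: "g \<in> S" "b = g c" using ab(2) by auto
    have "a \<otimes> b = (f \<oplus>\<^bsub>R\<^esub> g) c" using c f g by simp
    then show ?thesis using add[OF f(1) g(1)] by blast
  qed
qed

text \<open>Evaluation at a point \<open>c \<noteq> \<one>\<close> is already onto on the subring \<open>S\<close>, and it is injective on the
  whole ring. So a property that is stable under the ring operations holds in the whole ring once
  it holds for \<open>\<theta>\<close>.\<close>

lemma subring_is_everything:
  assumes S: "S \<subseteq> carrier R" "restrict \<theta> (carrier A) \<in> S" "\<one>\<^bsub>R\<^esub> \<in> S"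
    and add: "\<And>f g. f \<in> S \<Longrightarrow> g \<in> S \<Longrightarrow> f \<oplus>\<^bsub>R\<^esub> g \<in> S"
    and mult: "\<And>f g. f \<in> S \<Longrightarrow> g \<in> S \<Longrightarrow> f \<otimes>\<^bsub>R\<^esub> g \<in> S"
  shows "S = carrier R"
proof -
  obtain c where c: "c \<in> carrier A" "c \<noteq> \<one>" by (rule nontrivial_element)
  have "(\<lambda>f. f c) ` S = carrier A" by (rule evaluation_onto) (use assms c in auto)
  moreover have "f \<in> S" if f: "f \<in> carrier R" "f c \<in> (\<lambda>f. f c) ` S" for f
  proof -
    obtain g where "g \<in> S" "f c = g c" using f(2) by auto
    then show ?thesis using equalizer[of f g c] f S(1) c by auto
  qed
  ultimately show ?thesis using S(1) c by fastforce
qed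

lemma theta_in_R: "restrict \<theta> (carrier A) \<in> carrier R"
  by (auto intro!: homI)

sublocale R: ring R by (rule ring_R)

text \<open>The centre is a subring containing \<open>\<theta>\<close>.\<close>

lemma commutative_R:
  assumes "f \<in> carrier R" "g \<in> carrier R" shows "f \<otimes>\<^bsub>R\<^esub> g = g \<otimes>\<^bsub>R\<^esub> f"
proof -
  define S where "S = {f \<in> carrier R. \<forall>g \<in> carrier R. f \<otimes>\<^bsub>R\<^esub> g = g \<otimes>\<^bsub>R\<^esub> f}"
  have "S = carrier R"
  proof (rule subring_is_everything)
    show "restrict \<theta> (carrier A) \<in> S"
      unfolding S_def using theta_in_R by (auto intro!: ext simp: compose_def)
    show "\<one>\<^bsub>R\<^esub> \<in> S" unfolding S_def using R.l_one R.r_one R.one_closed by auto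
    show "f \<oplus>\<^bsub>R\<^esub> g \<in> S" if "f \<in> S" "g \<in> S" for f g
      using that R.l_distr R.r_distr R.add.m_closed by (auto simp: S_def simp del: R_simps)
    show "f \<otimes>\<^bsub>R\<^esub> g \<in> S" if "f \<in> S" "g \<in> S" for f g
    proof -
      have fg: "f \<in> carrier R" "g \<in> carrier R" using that by (auto simp: S_def simp del: R_simps)
      have "f \<otimes>\<^bsub>R\<^esub> g \<otimes>\<^bsub>R\<^esub> h = h \<otimes>\<^bsub>R\<^esub> (f \<otimes>\<^bsub>R\<^esub> g)" if h: "h \<in> carrier R" for h
      proof -
        have "f \<otimes>\<^bsub>R\<^esub> g \<otimes>\<^bsub>R\<^esub> h = f \<otimes>\<^bsub>R\<^esub> (h \<otimes>\<^bsub>R\<^esub> g)"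
          using R.m_assoc[OF fg h] \<open>g \<in> S\<close> h by (simp add: S_def del: R_simps)
        also have "\<dots> = h \<otimes>\<^bsub>R\<^esub> f \<otimes>\<^bsub>R\<^esub> g"
          using R.m_assoc[OF fg(1) h fg(2)] \<open>f \<in> S\<close> h by (simp add: S_def del: R_simps)
        finally show ?thesis using R.m_assoc[OF h fg] by (simp del: R_simps)
      qed
      then show ?thesis using R.m_closed[OF fg] unfolding S_def by blast
    qed
  qed (auto simp: S_def)
  then show ?thesis using assms unfolding S_def by blast
qed

lemma domain_R: "domain R"
proof -
  have cr: "cring R" by unfold_locales (rule commutative_R)
  obtain c where c: "c \<in> carrier A" "c \<noteq> \<one>" by (rule nontrivial_element)
  show ?thesis
  proof (intro domain.intro domain_axioms.intro cr)
    show "\<one>\<^bsub>R\<^esub> \<noteq> \<zero>\<^bsub>R\<^esub>"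
    proof
      assume "\<one>\<^bsub>R\<^esub> = \<zero>\<^bsub>R\<^esub>"
      then have "\<one>\<^bsub>R\<^esub> c = \<zero>\<^bsub>R\<^esub> c" by (rule arg_cong)
      then show False using c by simp
    qed
    fix f g assume fg: "f \<otimes>\<^bsub>R\<^esub> g = \<zero>\<^bsub>R\<^esub>" "f \<in> carrier R" "g \<in> carrier R"
    have "f = \<zero>\<^bsub>R\<^esub>" if "g \<noteq> \<zero>\<^bsub>R\<^esub>"
    proof (rule equalizer[where c = "g c"])
      show "g c \<noteq> \<one>"
        using equalizer[OF fg(3) R.zero_closed c] that c(1) by auto
      have "(f \<otimes>\<^bsub>R\<^esub> g) c = \<zero>\<^bsub>R\<^esub> c" using fg(1) by (rule arg_cong)
      then show "f (g c) = \<zero>\<^bsub>R\<^esub> (g c)" using c fg by (simp add: compose_def)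
    qed (use fg c R.zero_closed in auto)
    then show "f = \<zero>\<^bsub>R\<^esub> \<or> g = \<zero>\<^bsub>R\<^esub>" by blast
  qed
qed

lemma R_pow: "f \<in> carrier R \<Longrightarrow> a \<in> carrier A \<Longrightarrow> (f [^]\<^bsub>R\<^esub> n) a = (f ^^ n) a"
proof (induction n arbitrary: a)
  case (Suc n)
  have "(f [^]\<^bsub>R\<^esub> Suc n) a = (f [^]\<^bsub>R\<^esub> n) (f a)" using Suc.prems by (simp add: compose_def)
  also have "\<dots> = (f ^^ Suc n) a" using Suc by (simp add: funpow_swap1)
  finally show ?case .
qed simp

lemma R_add_pow: "f \<in> carrier R \<Longrightarrow> a \<in> carrier A \<Longrightarrow> (add_pow R n f) a = f a [^] (n::nat)"
  by (induction n) auto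

text \<open>The elements \<open>f\<close> with \<open>f ^ (p ^ u) = f\<close> form a subring, by additivity of the Frobenius map,
  and \<open>\<theta>\<close> is one of them. So every element of the ring is zero or a root of unity of order
  dividing \<open>p ^ u - 1\<close>, and a domain has at most \<open>p ^ u - 1\<close> of these; evaluation at a point maps
  the ring onto \<open>A\<close>.\<close>

theorem card_le:
  assumes u: "u > 0" and per: "\<And>a. a \<in> carrier A \<Longrightarrow> (\<theta> ^^ (p ^ u)) a = \<theta> a"
  shows "card (carrier A) \<le> p ^ u"
proof -
  interpret R: domain R by (rule domain_R)
  obtain c where c: "c \<in> carrier A" "c \<noteq> \<one>" by (rule nontrivial_element)
  define N where "N = p ^ u"
  have N1: "N > 1" using u prime_gt_1_nat[OF p] unfolding N_def by (intro one_less_power) auto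
  have char: "add_pow R p f = \<zero>\<^bsub>R\<^esub>" if f: "f \<in> carrier R" for f
  proof (rule equalizer[where c = c])
    show "add_pow R p f \<in> carrier R" using f by (rule R.add.nat_pow_closed)
    show "add_pow R p f c = \<zero>\<^bsub>R\<^esub> c" using R_add_pow[OF f c(1), of p] exponent_p[of "f c"] f c by simp
  qed (use c R.zero_closed in auto)
  define S where "S = {f \<in> carrier R. f [^]\<^bsub>R\<^esub> N = f}"
  have "S = carrier R"
  proof (rule subring_is_everything)
    have it: "(\<theta> ^^ n) a \<in> carrier A" "(restrict \<theta> (carrier A) ^^ n) a = (\<theta> ^^ n) a"
      if "a \<in> carrier A" for a n
      using that by (induction n) auto
    have "restrict \<theta> (carrier A) [^]\<^bsub>R\<^esub> N = restrict \<theta> (carrier A)"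
    proof (rule equalizer[where c = c])
      show "(restrict \<theta> (carrier A) [^]\<^bsub>R\<^esub> N) c = restrict \<theta> (carrier A) c"
        using R_pow[OF theta_in_R c(1), of N] it(2)[OF c(1), of N] per[OF c(1)] c by (simp add: N_def)
    qed (use theta_in_R R.nat_pow_closed c in blast)+
    then show "restrict \<theta> (carrier A) \<in> S" using theta_in_R unfolding S_def by blast
    show "\<one>\<^bsub>R\<^esub> \<in> S" unfolding S_def using R.nat_pow_one R.one_closed by blast
    show "f \<oplus>\<^bsub>R\<^esub> g \<in> S" if "f \<in> S" "g \<in> S" for f g
      using that R.frobenius_additive[OF p char, of f g u] R.add.m_closed[of f g]
      unfolding S_def N_def by (simp del: R_simps)
    show "f \<otimes>\<^bsub>R\<^esub> g \<in> S" if "f \<in> S" "g \<in> S" for f g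
      using that R.nat_pow_distrib[of f g N] R.m_closed[of f g] unfolding S_def by (simp del: R_simps)
  qed (auto simp: S_def)
  have finR: "finite (carrier R)"
    by (rule finite_subset[OF _ finite_PiE[OF fin fin]]) (auto simp: PiE_def)
  have "carrier R \<subseteq> insert \<zero>\<^bsub>R\<^esub> {f \<in> carrier R. f [^]\<^bsub>R\<^esub> (N - 1) = \<one>\<^bsub>R\<^esub>}"
  proof
    fix f assume f: "f \<in> carrier R"
    then have "f [^]\<^bsub>R\<^esub> (Suc (N - 1)) = f" using \<open>S = carrier R\<close> N1 unfolding S_def by auto
    then have "f [^]\<^bsub>R\<^esub> (N - 1) \<otimes>\<^bsub>R\<^esub> f = \<one>\<^bsub>R\<^esub> \<otimes>\<^bsub>R\<^esub> f" using f R.l_one[OF f] by (simp del: R_simps)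
    then have "f = \<zero>\<^bsub>R\<^esub> \<or> f [^]\<^bsub>R\<^esub> (N - 1) = \<one>\<^bsub>R\<^esub>"
      using R.m_rcancel[of f "f [^]\<^bsub>R\<^esub> (N - 1)" "\<one>\<^bsub>R\<^esub>"] f R.nat_pow_closed R.one_closed by blast
    then show "f \<in> insert \<zero>\<^bsub>R\<^esub> {f \<in> carrier R. f [^]\<^bsub>R\<^esub> (N - 1) = \<one>\<^bsub>R\<^esub>}" using f by blast
  qed
  then have "card (carrier R) \<le> Suc (card {f \<in> carrier R. f [^]\<^bsub>R\<^esub> (N - 1) = \<one>\<^bsub>R\<^esub>})"
    using finR card_mono[of "insert \<zero>\<^bsub>R\<^esub> {f \<in> carrier R. f [^]\<^bsub>R\<^esub> (N - 1) = \<one>\<^bsub>R\<^esub>}" "carrier R"]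
    by (simp add: card_insert_if del: R_simps split: if_splits)
  also have "\<dots> \<le> N" using R.num_roots_le_deg[OF finR, of "N - 1"] N1 by (simp del: R_simps)
  finally have "card (carrier R) \<le> N" .
  moreover have "(\<lambda>f. f c) ` carrier R = carrier A"
    by (rule evaluation_onto[OF order_refl theta_in_R R.one_closed R.add.m_closed R.m_closed c])
  ultimately show ?thesis using card_image_le[OF finR, of "\<lambda>f. f c"] by (simp add: N_def del: R_simps)
qed

end

section \<open>Endomorphism monoids\<close>

text \<open>As the kernels form a chain, some \<open>h\<close> lies in none of the proper ones. Therefore no proper
  subgroup contains both \<open>h\<close> and all commutators: it would lie in a proper kernel, by the lemma
  \<open>hom_onto_prime_cyclic\<close>. Inner automorphisms commute, so commutators are central, and the centre
  together with \<open>h\<close> generates the whole group. Hence the group is abelian, and the same argument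
  applied to the powers of \<open>h\<close> shows that it is cyclic.\<close>

lemma (in group) cyclic_if_kernels_form_chain:
  assumes fin: "finite (carrier G)"
    and comm: "\<And>f g a. f \<in> hom G G \<Longrightarrow> g \<in> hom G G \<Longrightarrow> a \<in> carrier G \<Longrightarrow> f (g a) = g (f a)"
    and chain: "\<And>f g. f \<in> hom G G \<Longrightarrow> g \<in> hom G G \<Longrightarrow>
      kernel G G f \<subseteq> kernel G G g \<or> kernel G G g \<subseteq> kernel G G f"
  shows "\<exists>h \<in> carrier G. \<forall>a \<in> carrier G. \<exists>i::nat. a = h [^] i"
proof -
  define \<K> where "\<K> = {kernel G G f | f. f \<in> hom G G \<and> kernel G G f \<noteq> carrier G}"
  have "\<exists>h \<in> carrier G. \<forall>K \<in> \<K>. h \<notin> K"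
  proof (cases "\<K> = {}")
    case False
    have "finite \<K>" by (rule finite_subset[of _ "Pow (carrier G)"]) (auto simp: \<K>_def fin kernel_def)
    then obtain K where K: "K \<in> \<K>" "\<And>K'. K' \<in> \<K> \<Longrightarrow> K \<subseteq> K' \<Longrightarrow> K = K'"
      using finite_has_maximal[of \<K>] False by blast
    have "K' \<subseteq> K" if "K' \<in> \<K>" for K'
    proof -
      have "K \<subseteq> K' \<or> K' \<subseteq> K" using chain K(1) that unfolding \<K>_def by blast
      then show ?thesis using K(2)[OF that] by auto
    qed
    moreover obtain h where "h \<in> carrier G" "h \<notin> K" using K(1) by (auto simp: \<K>_def kernel_def)
    ultimately show ?thesis by blast
  qed auto
  then obtain h where h: "h \<in> carrier G" "\<And>K. K \<in> \<K> \<Longrightarrow> h \<notin> K" by auto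
  have everything: "L = carrier G"
    if L: "subgroup L G" "h \<in> L" "\<And>a b. a \<in> carrier G \<Longrightarrow> b \<in> carrier G \<Longrightarrow> commutator a b \<in> L" for L
  proof (rule ccontr)
    assume "L \<noteq> carrier G"
    then obtain f where f: "f \<in> hom G G" "\<forall>a\<in>L. f a = \<one>" "\<exists>a\<in>carrier G. f a \<noteq> \<one>"
      using hom_onto_prime_cyclic[OF fin L(1) _ L(3)] by blast
    then have "kernel G G f \<in> \<K>" unfolding \<K>_def kernel_def by blast
    then show False using h L(2) f(2) by (auto simp: kernel_def)
  qed
  have central: "(commutator a b) \<otimes> g = g \<otimes> (commutator a b)"
    if ab: "a \<in> carrier G" "b \<in> carrier G" "g \<in> carrier G" for a b g
  proof -
    have inner: "(\<lambda>c. conjugate a c) \<in> hom G G" if "a \<in> carrier G" for a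
      using that by (intro homI) (auto simp: word_simps)
    define c where "c = inv (b \<otimes> a) \<otimes> g \<otimes> (b \<otimes> a)"
    have "conjugate a (b \<otimes> c \<otimes> inv b) = conjugate b (a \<otimes> c \<otimes> inv a)"
      using comm[OF inner[OF ab(1)] inner[OF ab(2)], of c] ab by (simp add: c_def)
    then have "conjugate (a \<otimes> b \<otimes> inv a \<otimes> inv b) g = g"
      using ab by (simp add: c_def word_simps)
    then have "conjugate (a \<otimes> b \<otimes> inv a \<otimes> inv b) g \<otimes> (commutator a b)
       = g \<otimes> (commutator a b)" by simp
    then show ?thesis using ab by (simp add: word_simps)
  qed
  define Z where "Z = {z \<in> carrier G. \<forall>g \<in> carrier G. z \<otimes> g = g \<otimes> z}"
  have Zm: "c \<otimes> d \<in> Z" if "c \<in> Z" "d \<in> Z" for c d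
  proof -
    have cd: "c \<in> carrier G" "d \<in> carrier G" using that by (auto simp: Z_def)
    have "c \<otimes> d \<otimes> g = g \<otimes> (c \<otimes> d)" if g: "g \<in> carrier G" for g
      by (rule commute_mult[OF cd g]) (use \<open>c \<in> Z\<close> \<open>d \<in> Z\<close> g in \<open>unfold Z_def, blast+\<close>)
    then show ?thesis using cd unfolding Z_def by blast
  qed
  define L where "L = {a. \<exists>c \<in> Z. \<exists>i::nat. a = c \<otimes> h [^] i}"
  have prod: "(c \<otimes> h [^] i) \<otimes> (d \<otimes> h [^] j) = (c \<otimes> d) \<otimes> h [^] (i + j)"
    if "c \<in> Z" "d \<in> Z" for c d and i j :: nat
  proof -
    have cd: "c \<in> carrier G" "d \<in> carrier G" using that by (auto simp: Z_def)
    have "(c \<otimes> h [^] i) \<otimes> (d \<otimes> h [^] j) = c \<otimes> (h [^] i \<otimes> d) \<otimes> h [^] j" using cd h by (simp add: m_assoc)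
    also have "h [^] i \<otimes> d = d \<otimes> h [^] i" using that(2) h by (simp add: Z_def)
    finally show ?thesis using cd h by (simp add: m_assoc nat_pow_mult)
  qed
  have "L = carrier G"
  proof (rule everything)
    show "subgroup L G"
    proof (rule finite_subgroupI[OF fin])
      show "L \<subseteq> carrier G" using h by (auto simp: L_def Z_def)
      have "\<one> \<in> Z" by (simp add: Z_def)
      then show "L \<noteq> {}" by (auto simp: L_def)
      show "a \<otimes> b \<in> L" if "a \<in> L" "b \<in> L" for a b
        using that prod Zm unfolding L_def by blast
    qed
    show "h \<in> L" unfolding L_def using h
      by (auto intro!: bexI[of _ \<one>] exI[of _ "1::nat"] simp: Z_def)
    show "commutator a b \<in> L" if "a \<in> carrier G" "b \<in> carrier G" for a b
      unfolding L_def by (intro CollectI bexI[of _ "commutator a b"] exI[of _ "0::nat"])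
        (use that central in \<open>auto simp: Z_def\<close>)
  qed
  then have ab: "a \<otimes> b = b \<otimes> a" if aG: "a \<in> carrier G" and bG: "b \<in> carrier G" for a b
  proof -
    obtain c i where c: "c \<in> Z" "a = c \<otimes> h [^] (i::nat)" using \<open>L = carrier G\<close> aG unfolding L_def by blast
    obtain d j where d: "d \<in> Z" "b = d \<otimes> h [^] (j::nat)" using \<open>L = carrier G\<close> bG unfolding L_def by blast
    have cd: "c \<otimes> d = d \<otimes> c" using c(1) d(1) unfolding Z_def by blast
    have "a \<otimes> b = (c \<otimes> d) \<otimes> h [^] (i + j)" unfolding c(2) d(2) by (rule prod[OF c(1) d(1)])
    also have "\<dots> = (d \<otimes> c) \<otimes> h [^] (j + i)" by (simp only: cd add.commute)
    also have "\<dots> = b \<otimes> a" unfolding c(2) d(2) by (rule prod[OF d(1) c(1), symmetric])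
    finally show ?thesis .
  qed
  define P where "P = range (\<lambda>i::nat. h [^] i)"
  have "P = carrier G"
  proof (rule everything)
    show "subgroup P G"
      by (rule finite_subgroupI[OF fin]) (use h in \<open>auto simp: P_def nat_pow_mult\<close>)
    show "h \<in> P" unfolding P_def using h by (auto intro!: range_eqI[of _ _ "1::nat"])
    show "commutator a b \<in> P" if "a \<in> carrier G" "b \<in> carrier G" for a b
    proof -
      have "commutator a b = h [^] (0::nat)" using that ab[of a b] by (simp add: word_simps)
      then show ?thesis unfolding P_def by blast
    qed
  qed
  then show ?thesis using h(1) unfolding P_def by blast
qed

lemma End_simps [simp]:
  "f \<in> carrier (End_monoid G) \<longleftrightarrow> f \<in> hom G G \<and> f \<in> extensional (carrier G)"
  "f \<otimes>\<^bsub>End_monoid G\<^esub> g = compose (carrier G) g f"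
  "\<one>\<^bsub>End_monoid G\<^esub> = (\<lambda>a \<in> carrier G. a)"
  by (auto simp: End_monoid_def)

lemma compose_eq_iff:
  "h \<in> extensional A \<Longrightarrow> compose A g f = h \<longleftrightarrow> (\<forall>a \<in> A. g (f a) = h a)"
  by (auto simp: compose_def fun_eq_iff extensional_def)

lemma (in group) monoid_End: "monoid (End_monoid G)"
  by (rule monoidI) (auto intro!: homI ext simp: compose_def extensional_def hom_def Pi_def)

lemma End_pow: "z \<in> carrier (End_monoid G) \<Longrightarrow> a \<in> carrier G \<Longrightarrow> (z [^]\<^bsub>End_monoid G\<^esub> (n::nat)) a = (z ^^ n) a"
  by (induction n) (auto simp: compose_def)

text \<open>The residues modulo \<open>n\<close> under multiplication: the common shape of the endomorphism monoid of
  a cyclic group of order \<open>n\<close> and of \<open>K(x)\<close>.\<close>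

definition mult_mod :: "nat \<Rightarrow> nat monoid" where
  "mult_mod n = \<lparr>carrier = {..<n}, monoid.mult = (\<lambda>i j. (i * j) mod n), one = 1 mod n\<rparr>"

text \<open>Inverting isomorphisms between structures of which only closure under the product is known.\<close>

lemma iso_inverse:
  assumes f: "f \<in> iso A B" and cl: "\<And>a b. a \<in> carrier A \<Longrightarrow> b \<in> carrier A \<Longrightarrow> a \<otimes>\<^bsub>A\<^esub> b \<in> carrier A"
  shows "inv_into (carrier A) f \<in> iso B A"
proof -
  have b: "bij_betw f (carrier A) (carrier B)" using f by (simp add: iso_def)
  then have b': "bij_betw (inv_into (carrier A) f) (carrier B) (carrier A)" by (rule bij_betw_inv_into)
  have "inv_into (carrier A) f (f a \<otimes>\<^bsub>B\<^esub> f c) = a \<otimes>\<^bsub>A\<^esub> c" if "a \<in> carrier A" "c \<in> carrier A" for a c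
  proof -
    have "f a \<otimes>\<^bsub>B\<^esub> f c = f (a \<otimes>\<^bsub>A\<^esub> c)" using f that by (auto simp: iso_def hom_def)
    then show ?thesis using that cl b by (simp add: bij_betw_inv_into_left)
  qed
  then have "inv_into (carrier A) f (u \<otimes>\<^bsub>B\<^esub> w) = inv_into (carrier A) f u \<otimes>\<^bsub>A\<^esub> inv_into (carrier A) f w"
    if "u \<in> carrier B" "w \<in> carrier B" for u w
    using that b b' bij_betw_inv_into_right[OF b] bij_betwE[OF b'] by metis
  then show ?thesis using b' bij_betwE[OF b'] by (auto simp: iso_def hom_def)
qed

text \<open>An endomorphism of a cyclic group is multiplication by the image of the generator.\<close>

lemma End_integer_mod_group:
  assumes n: "n > 1"
  shows "(\<lambda>\<phi>. nat (\<phi> 1)) \<in> iso (End_monoid (integer_mod_group n)) (mult_mod n)"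
proof -
  let ?Z = "integer_mod_group n"
  have carr: "carrier ?Z = {0..<int n}" using n by (simp add: carrier_integer_mod_group)
  have val: "\<phi> i = (i * \<phi> 1) mod int n" "\<phi> 1 \<in> {0..<int n}"
    if phi: "\<phi> \<in> hom ?Z ?Z" and i: "i \<in> {0..<int n}" for \<phi> i
  proof -
    have "1 [^]\<^bsub>?Z\<^esub> nat i = i" using i by simp
    then have "\<phi> i = \<phi> (1 [^]\<^bsub>?Z\<^esub> nat i)" by simp
    also have "\<dots> = \<phi> 1 [^]\<^bsub>?Z\<^esub> nat i"
      by (rule hom_nat_pow[OF phi]) (use n carr in auto)
    finally show "\<phi> i = (i * \<phi> 1) mod int n" using i by simp
    show "\<phi> 1 \<in> {0..<int n}" using phi n carr by (auto simp: hom_def)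
  qed
  show ?thesis
    unfolding iso_def
  proof (intro CollectI conjI)
    show "(\<lambda>\<phi>. nat (\<phi> 1)) \<in> hom (End_monoid ?Z) (mult_mod n)"
    proof (rule homI)
      fix \<phi> \<psi> assume e: "\<phi> \<in> carrier (End_monoid ?Z)" "\<psi> \<in> carrier (End_monoid ?Z)"
      have p: "\<phi> 1 \<in> {0..<int n}" "\<psi> 1 \<in> {0..<int n}" using val(2)[of \<phi> 0] val(2)[of \<psi> 0] e n by auto
      have "(\<phi> \<otimes>\<^bsub>End_monoid ?Z\<^esub> \<psi>) 1 = \<psi> (\<phi> 1)" using n carr by (simp add: compose_def)
      also have "\<dots> = (\<phi> 1 * \<psi> 1) mod int n" using val(1)[OF _ p(1)] e by simp
      finally show "nat ((\<phi> \<otimes>\<^bsub>End_monoid ?Z\<^esub> \<psi>) 1) = nat (\<phi> 1) \<otimes>\<^bsub>mult_mod n\<^esub> nat (\<psi> 1)"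
        using p by (simp add: mult_mod_def nat_mod_distrib nat_mult_distrib)
    next
      fix \<phi> assume e: "\<phi> \<in> carrier (End_monoid ?Z)"
      then have "\<phi> 1 \<in> {0..<int n}" using val(2)[of \<phi> 0] n by auto
      then show "nat (\<phi> 1) \<in> carrier (mult_mod n)" using n by (simp add: mult_mod_def nat_less_iff)
    qed
    show "bij_betw (\<lambda>\<phi>. nat (\<phi> 1)) (carrier (End_monoid ?Z)) (carrier (mult_mod n))"
      unfolding bij_betw_def
    proof
      show "inj_on (\<lambda>\<phi>. nat (\<phi> 1)) (carrier (End_monoid ?Z))"
      proof (rule inj_onI)
        fix \<phi> \<psi> assume e: "\<phi> \<in> carrier (End_monoid ?Z)" "\<psi> \<in> carrier (End_monoid ?Z)" "nat (\<phi> 1) = nat (\<psi> 1)"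
        then have "\<phi> 1 = \<psi> 1" using val(2)[of \<phi> 0] val(2)[of \<psi> 0] n by auto
        show "\<phi> = \<psi>"
        proof (rule extensionalityI[of _ "carrier ?Z"])
          fix i assume "i \<in> carrier ?Z"
          then show "\<phi> i = \<psi> i" using val(1)[of \<phi> i] val(1)[of \<psi> i] e \<open>\<phi> 1 = \<psi> 1\<close> carr by simp
        qed (use e in auto)
      qed
      have "i \<in> (\<lambda>\<phi>. nat (\<phi> 1)) ` carrier (End_monoid ?Z)" if i: "i < n" for i
      proof (rule image_eqI)
        show "restrict (\<lambda>j. (j * int i) mod int n) (carrier ?Z) \<in> carrier (End_monoid ?Z)"
          using n by (auto intro!: homI simp: carr mod_simps distrib_right)
        show "i = nat (restrict (\<lambda>j. (j * int i) mod int n) (carrier ?Z) 1)" using n carr i by simp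
      qed
      moreover have "(\<lambda>\<phi>. nat (\<phi> 1)) ` carrier (End_monoid ?Z) \<subseteq> carrier (mult_mod n)"
      proof
        fix i assume "i \<in> (\<lambda>\<phi>. nat (\<phi> 1)) ` carrier (End_monoid ?Z)"
        then obtain \<phi> where e: "\<phi> \<in> carrier (End_monoid ?Z)" "i = nat (\<phi> 1)" by blast
        then have "\<phi> 1 \<in> {0..<int n}" using val(2)[of \<phi> 0] n by auto
        then show "i \<in> carrier (mult_mod n)" using n e by (simp add: mult_mod_def nat_less_iff)
      qed
      ultimately show "(\<lambda>\<phi>. nat (\<phi> 1)) ` carrier (End_monoid ?Z) = carrier (mult_mod n)"
        by (auto simp: mult_mod_def)
    qed
  qed
qed

text \<open>Up to units a residue modulo \<open>q ^ v\<close> is a power of \<open>q\<close>. Divisibility between endomorphisms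
  gives inclusion of their kernels, so this yields the chain of kernels for a group whose
  endomorphisms multiply like residues.\<close>

lemma mult_mod_prime_power_divisibility:
  fixes q n i j :: nat
  assumes q: "prime q" and n: "n = q ^ v" and ij: "i < n" "j < n"
  shows "\<exists>k < n. j = (i * k) mod n \<or> i = (j * k) mod n"
proof -
  have solve: "\<exists>k < n. j = (i * k) mod n" if g: "gcd i n dvd gcd j n" and j: "j < n" for i j :: nat
  proof -
    have "gcd i n dvd j" using g gcd_dvd1 dvd_trans by blast
    then obtain k where k: "[i * k = j] (mod n)" using cong_solve_dvd_nat by blast
    then have "j = (i * (k mod n)) mod n" using j by (simp add: cong_def mod_mult_right_eq)
    moreover have "k mod n < n" using j by simp
    ultimately show ?thesis by blast
  qed
  obtain s t where "gcd i n = q ^ s" "gcd j n = q ^ t"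
    using divides_primepow_nat[OF q] n by (metis gcd_dvd2)
  then have "gcd i n dvd gcd j n \<or> gcd j n dvd gcd i n" using le_imp_power_dvd nat_le_linear by metis
  then show ?thesis using solve ij by blast
qed

lemma K_set_iff: "z \<in> K_set G y \<longleftrightarrow>
    z \<in> carrier (End_monoid G) \<and> (\<forall>g \<in> carrier G. y (z g) = z g \<and> z (y g) = z g)"
  by (auto simp: K_set_def compose_eq_iff)

lemma H_set_iff: "z \<in> H_set G y \<longleftrightarrow>
    z \<in> carrier (End_monoid G) \<and> (\<forall>g \<in> carrier G. z (y g) = z g \<and> y (z g) = \<one>\<^bsub>G\<^esub>)"
  by (auto simp: H_set_def compose_eq_iff End_zero_def)

lemma idem_class_iff: "z \<in> idem_class G y \<longleftrightarrow>
    z \<in> carrier (End_monoid G) \<and> (\<forall>g \<in> carrier G. z (z g) = z g \<and> z (y g) = z g)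
    \<and> compose (carrier G) y z = y"
  by (auto simp: idem_class_def compose_eq_iff)

lemma I0_iff: "z \<in> I0 G \<longleftrightarrow>
    z \<in> carrier (End_monoid G) \<and> (\<forall>g \<in> carrier G. z (z g) = z g) \<and> z \<noteq> End_zero G
    \<and> z \<noteq> (\<lambda>g \<in> carrier G. g)"
  by (auto simp: I0_def compose_eq_iff)

lemma V_set_iff:
  assumes "y \<in> carrier (End_monoid G)"
  shows "z \<in> V_set G y \<longleftrightarrow> z \<in> auto G \<and> (\<forall>g \<in> carrier G. y (z g) = y g)"
  using assms by (auto simp: V_set_def compose_eq_iff)

lemma D_set_iff:
  assumes "y \<in> carrier (End_monoid G)"
  shows "z \<in> D_set G y \<longleftrightarrow> z \<in> V_set G y \<and> (\<forall>g \<in> carrier G. z (y g) = y g)"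
  using assms by (auto simp: D_set_def V_set_iff compose_eq_iff)

lemma auto_iff_inj:
  assumes "finite (carrier G)" "f \<in> carrier (End_monoid G)"
  shows "f \<in> auto G \<longleftrightarrow> inj_on f (carrier G)"
proof -
  have "f ` carrier G \<subseteq> carrier G" using assms(2) by (auto simp: hom_def)
  then have "inj_on f (carrier G) \<Longrightarrow> f ` carrier G = carrier G" using assms(1) by (simp add: endo_inj_surj)
  then show ?thesis using assms(2) by (auto simp: auto_def Bij_def bij_betw_def)
qed

lemma auto_imp_End: "f \<in> auto G \<Longrightarrow> f \<in> carrier (End_monoid G)"
  by (auto simp: auto_def Bij_def)

lemma hom_closedI: "f \<in> hom G H \<Longrightarrow> a \<in> carrier G \<Longrightarrow> f a \<in> carrier H"
  by (auto simp: hom_def)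

lemma hom_multD: "f \<in> hom G H \<Longrightarrow> a \<in> carrier G \<Longrightarrow> c \<in> carrier G \<Longrightarrow> f (a \<otimes>\<^bsub>G\<^esub> c) = f a \<otimes>\<^bsub>H\<^esub> f c"
  by (auto simp: hom_def)

text \<open>The product is opposite to the one of the automorphism group, so the group laws are verified
  directly.\<close>

lemma (in group) group_V_group:
  assumes y: "y \<in> carrier (End_monoid G)"
  shows "group (V_group G y)"
proof (rule groupI)
  have e: "f \<in> carrier (V_group G y) \<longleftrightarrow> f \<in> V_set G y" for f by (simp add: V_group_def)
  have m: "f \<otimes>\<^bsub>V_group G y\<^esub> g = compose (carrier G) g f" for f g by (simp add: V_group_def)
  have o: "\<one>\<^bsub>V_group G y\<^esub> = (\<lambda>a \<in> carrier G. a)" by (simp add: V_group_def)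
  have clos: "f a \<in> carrier G" if "f \<in> auto G" "a \<in> carrier G" for f a
    using that by (auto simp: auto_def hom_def)
  have comp: "compose (carrier G) g f \<in> auto G" if "f \<in> auto G" "g \<in> auto G" for f g
    using that by (auto simp: auto_def intro!: compose_Bij hom_compose)
  show "f \<otimes>\<^bsub>V_group G y\<^esub> g \<in> carrier (V_group G y)"
    if "f \<in> carrier (V_group G y)" "g \<in> carrier (V_group G y)" for f g
    using that y comp clos by (auto simp: e m V_set_iff compose_def)
  show "\<one>\<^bsub>V_group G y\<^esub> \<in> carrier (V_group G y)"
    using y by (auto simp: e o V_set_iff auto_def id_Bij intro!: homI)
  show "\<one>\<^bsub>V_group G y\<^esub> \<otimes>\<^bsub>V_group G y\<^esub> f = f" if "f \<in> carrier (V_group G y)" for f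
    using that y by (auto simp: e m o V_set_iff auto_def Bij_def compose_eq_iff)
  show "f \<otimes>\<^bsub>V_group G y\<^esub> g \<otimes>\<^bsub>V_group G y\<^esub> h = f \<otimes>\<^bsub>V_group G y\<^esub> (g \<otimes>\<^bsub>V_group G y\<^esub> h)"
    if "f \<in> carrier (V_group G y)" "g \<in> carrier (V_group G y)" "h \<in> carrier (V_group G y)" for f g h
    using that y clos by (auto simp: e m V_set_iff compose_def)
  fix f assume f: "f \<in> carrier (V_group G y)"
  then have fa: "f \<in> auto G" using y by (simp add: e V_set_iff)
  let ?g = "restrict (inv_into (carrier G) f) (carrier G)"
  have bij: "bij_betw f (carrier G) (carrier G)" using fa by (auto simp: auto_def Bij_def)
  have ga: "?g \<in> auto G"
  proof -
    have "f \<in> iso G G" using fa bij by (simp add: iso_def auto_def)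
    then have "inv_into (carrier G) f \<in> iso G G" by (rule iso_set_sym)
    moreover have "?g \<in> hom G G"
      using \<open>inv_into (carrier G) f \<in> iso G G\<close> by (auto intro!: homI simp: iso_def hom_multD hom_closedI)
    ultimately show ?thesis using bij by (auto simp: auto_def iso_def Bij_def bij_betw_restrict_eq intro: bij_betw_inv_into)
  qed
  have fg: "f (?g a) = a" "?g (f a) = a" if "a \<in> carrier G" for a
    using that bij clos[OF fa that] by (auto simp: bij_betw_inv_into_right bij_betw_inv_into_left)
  have "y (?g a) = y a" if a: "a \<in> carrier G" for a
  proof -
    have "y (f (?g a)) = y (?g a)" using f y clos[OF ga a] by (simp only: e V_set_iff[OF y])
    then show ?thesis using fg[OF a] by simp
  qed
  then have "?g \<in> V_set G y" using ga unfolding V_set_iff[OF y] by blast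
  moreover have "compose (carrier G) f ?g = (\<lambda>a \<in> carrier G. a)" using fg by (auto simp: compose_eq_iff)
  ultimately show "\<exists>g\<in>carrier (V_group G y). g \<otimes>\<^bsub>V_group G y\<^esub> f = \<one>\<^bsub>V_group G y\<^esub>"
    using e m o by metis
qed

section \<open>Idempotent endomorphisms with cyclic image\<close>

text \<open>Preceding an endomorphism of the image \<open>H\<close> of \<open>x\<close> by \<open>x\<close> gives an element of \<open>K(x)\<close>. The
  multiplication of residues is commutative and any two residues modulo \<open>q ^ v\<close> are comparable
  under divisibility, so the endomorphisms of \<open>H\<close> commute and their kernels form a chain;
  therefore \<open>H\<close> is cyclic. An element of \<open>K(x)\<close> is determined by its value at a generator, which
  may be any element of \<open>H\<close>; so \<open>|H| = |K(x)| = q ^ v\<close>.\<close>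

lemma (in group) cyclic_image_if_K_set_iso:
  assumes fin: "finite (carrier G)" and x: "x \<in> carrier (End_monoid G)"
    and idem: "\<And>g. g \<in> carrier G \<Longrightarrow> x (x g) = x g"
    and q: "prime q" and n: "n = q ^ v" and iso: "(End_monoid G)\<lparr>carrier := K_set G x\<rparr> \<cong> mult_mod n"
  shows "\<exists>b \<in> carrier G. x b = b \<and> (\<forall>g \<in> carrier G. \<exists>i::nat. x g = b [^] i) \<and> ord b = n"
proof -
  have xh: "x \<in> hom G G" using x by simp
  interpret x: group_hom G G x by unfold_locales (rule xh)
  define H where "H = x ` carrier G"
  have sH: "subgroup H G" unfolding H_def by (rule x.img_is_subgroup)
  interpret H: subgroup H G by (rule sH)
  let ?H = "G\<lparr>carrier := H\<rparr>"
  interpret HG: group ?H by (rule subgroup_imp_group[OF sH])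
  have xH: "x h = h" if "h \<in> H" for h using that idem by (auto simp: H_def)
  have inH: "x g \<in> H" if "g \<in> carrier G" for g using that by (simp add: H_def)
  obtain \<phi> where phi: "\<phi> \<in> iso ((End_monoid G)\<lparr>carrier := K_set G x\<rparr>) (mult_mod n)"
    using iso by (auto simp: is_iso_def)
  have bij: "bij_betw \<phi> (K_set G x) {..<n}" using phi by (simp add: iso_def mult_mod_def)
  have phi_mult: "\<phi> (compose (carrier G) g f) = (\<phi> f * \<phi> g) mod n" if "f \<in> K_set G x" "g \<in> K_set G x" for f g
    using phi that by (auto simp: iso_def hom_def mult_mod_def)
  have K_comp: "compose (carrier G) g f \<in> K_set G x" if "f \<in> K_set G x" "g \<in> K_set G x" for f g
    using that monoid.m_closed[OF monoid_End, of f g]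
    by (auto simp: K_set_iff compose_def hom_closedI)
  have phi_lt: "\<phi> f < n" if "f \<in> K_set G x" for f using bij that by (auto dest: bij_betwE)
  have phi_inj: "f = g" if "f \<in> K_set G x" "g \<in> K_set G x" "\<phi> f = \<phi> g" for f g
    using bij that by (auto simp: bij_betw_def dest: inj_onD)
  define ext where "ext f = (\<lambda>g \<in> carrier G. f (x g))" for f :: "'a \<Rightarrow> 'a"
  have ext_K: "ext f \<in> K_set G x" if f: "f \<in> hom ?H ?H" for f
  proof -
    have fH: "f h \<in> H" if "h \<in> H" for h using hom_closedI[OF f] that by simp
    have fm: "f (h \<otimes> k) = f h \<otimes> f k" if "h \<in> H" "k \<in> H" for h k using hom_multD[OF f] that by simp
    show ?thesis using fH fm inH xH by (auto simp: K_set_iff ext_def idem intro!: homI)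
  qed
  have ext_eq: "ext f h = f h" if "h \<in> H" for f h using that xH by (simp add: ext_def)
  have hH: "f h \<in> H" if "f \<in> hom ?H ?H" "h \<in> H" for f h using hom_closedI[OF that(1)] that(2) by simp
  have "\<exists>b \<in> carrier ?H. \<forall>h \<in> carrier ?H. \<exists>i::nat. h = b [^]\<^bsub>?H\<^esub> i"
  proof (rule HG.cyclic_if_kernels_form_chain)
    show "finite (carrier ?H)" using finite_subset[OF H.subset fin] by simp
    fix f g assume f: "f \<in> hom ?H ?H" and g: "g \<in> hom ?H ?H"
    have cval: "compose (carrier G) (ext f) (ext g) h = f (g h)" if "h \<in> H" for h
      using that g hH[OF g that] by (simp add: compose_def ext_eq)
    show "f (g a) = g (f a)" if a: "a \<in> carrier ?H" for a
    proof -
      have "\<phi> (compose (carrier G) (ext f) (ext g)) = \<phi> (compose (carrier G) (ext g) (ext f))"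
        using phi_mult[OF ext_K[OF g] ext_K[OF f]] phi_mult[OF ext_K[OF f] ext_K[OF g]] by (simp add: mult.commute)
      then have "compose (carrier G) (ext f) (ext g) = compose (carrier G) (ext g) (ext f)"
        using phi_inj K_comp ext_K f g by blast
      then show ?thesis using a f g hH[OF f, of a] hH[OF g, of a] by (simp add: compose_def ext_eq fun_eq_iff)
        (metis H.mem_carrier ext_eq)
    qed
    have sub: "kernel ?H ?H f \<subseteq> kernel ?H ?H g"
      if fg: "f \<in> hom ?H ?H" "g \<in> hom ?H ?H" and k: "k < n" "\<phi> (ext g) = (\<phi> (ext f) * k) mod n" for f g k
    proof
      fix a assume a: "a \<in> kernel ?H ?H f"
      have "k \<in> \<phi> ` K_set G x" using bij_betw_imp_surj_on[OF bij] k(1) by simp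
      then obtain z where z: "z \<in> K_set G x" "\<phi> z = k" by blast
      have "ext g = compose (carrier G) z (ext f)"
        by (rule phi_inj) (use phi_mult[OF ext_K[OF fg(1)] z(1)] k z K_comp ext_K fg in auto)
      then have "ext g a = z (ext f a)" using a by (simp add: kernel_def compose_def)
      then have "g a = z \<one>" using a by (simp add: kernel_def ext_eq)
      also have "z \<one> = \<one>" using z(1) hom_one[of z G G] group_axioms by (simp add: K_set_iff)
      finally show "a \<in> kernel ?H ?H g" using a by (simp add: kernel_def)
    qed
    show "kernel ?H ?H f \<subseteq> kernel ?H ?H g \<or> kernel ?H ?H g \<subseteq> kernel ?H ?H f"
      using mult_mod_prime_power_divisibility[OF q n phi_lt[OF ext_K[OF f]] phi_lt[OF ext_K[OF g]]]
        sub[OF f g] sub[OF g f] by blast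
  qed
  then obtain b where b: "b \<in> H" "\<And>h. h \<in> H \<Longrightarrow> \<exists>i::nat. h = b [^] i"
    by (auto simp flip: nat_pow_consistent)
  have bG: "b \<in> carrier G" using b by simp
  have pwH: "b [^] (i::nat) \<in> H" for i using b(1) by (induction i) auto
  have "bij_betw (\<lambda>z. z b) (K_set G x) H"
    unfolding bij_betw_def
  proof
    show "inj_on (\<lambda>z. z b) (K_set G x)"
    proof (rule inj_onI)
      fix y z assume yz: "y \<in> K_set G x" "z \<in> K_set G x" "y b = z b"
      show "y = z"
      proof (rule extensionalityI[of _ "carrier G"])
        fix g assume g: "g \<in> carrier G"
        obtain i where i: "x g = b [^] (i::nat)" using b(2)[OF inH[OF g]] by blast
        have "y g = y (x g)" "z g = z (x g)" using yz g by (auto simp: K_set_iff)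
        moreover have "y (x g) = y b [^] i" "z (x g) = z b [^] i"
          unfolding i using yz(1,2) hom_nat_pow[OF _ bG group_axioms group_axioms] unfolding K_set_iff End_simps
          by blast+
        ultimately show "y g = z g" using yz(3) by simp
      qed (use yz in \<open>auto simp: K_set_iff\<close>)
    qed
    have "z b \<in> H" if "z \<in> K_set G x" for z
    proof -
      have "x (z b) = z b" "z b \<in> carrier G" using that bG hom_closedI[of z G G b] by (auto simp: K_set_iff)
      then show ?thesis using inH[of "z b"] by simp
    qed
    moreover have "h \<in> (\<lambda>z. z b) ` K_set G x" if h: "h \<in> H" for h
    proof -
      obtain j where j: "h = b [^] (j::nat)" using b(2)[OF h] by blast
      have "(\<lambda>a. a [^] j) \<in> hom ?H ?H"
      proof (rule homI)
        fix a c assume a: "a \<in> carrier ?H" "c \<in> carrier ?H"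
        obtain i k where ik: "a = b [^] (i::nat)" "c = b [^] (k::nat)" using b(2) a by fastforce
        have "a \<otimes> c = c \<otimes> a" using bG by (simp add: ik nat_pow_mult add.commute)
        then have "(a \<otimes> c) [^] j = a [^] j \<otimes> c [^] j" by (rule pow_mult_distrib) (use a in auto)
        then show "(a \<otimes>\<^bsub>?H\<^esub> c) [^] j = a [^] j \<otimes>\<^bsub>?H\<^esub> c [^] j" by simp
      next
        fix a assume a: "a \<in> carrier ?H"
        then show "a [^] j \<in> carrier ?H" by (induction j) auto
      qed
      from ext_K[OF this] have "ext (\<lambda>a. a [^] j) \<in> K_set G x" .
      moreover have "ext (\<lambda>a. a [^] j) b = h" using ext_eq[OF b(1)] j by simp
      ultimately show ?thesis by blast
    qed
    ultimately show "(\<lambda>z. z b) ` K_set G x = H" by blast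
  qed
  then have "card H = card (K_set G x)" by (simp add: bij_betw_same_card)
  also have "\<dots> = n" using bij_betw_same_card[OF bij] by simp
  finally have cH: "card H = n" .
  have "generate G {b} = H" using generate_pow_on_finite_carrier[OF fin bG] b(2) pwH by auto
  then have "ord b = n" using generate_pow_card[OF bG] cH by simp
  then show ?thesis using bG xH[OF b(1)] b(2)[OF inH] by blast
qed

text \<open>Since \<open>x\<close> is idempotent with image \<open>\<langle>b\<rangle>\<close>, the group is the semidirect product of the kernel
  \<open>M\<close> of \<open>x\<close> and the cyclic group \<open>\<langle>b\<rangle>\<close> of order \<open>n = q ^ v\<close>. The subgroup \<open>C\<close> is the centralizer
  of \<open>b\<close> in \<open>M\<close>.\<close>

locale cyclic_retract = group G for G (structure) +
  fixes x :: "'a \<Rightarrow> 'a" and b :: 'a and q v :: nat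
  assumes fin: "finite (carrier G)"
    and x: "x \<in> carrier (End_monoid G)"
    and b [simp]: "b \<in> carrier G" and xb: "x b = b"
    and img: "\<And>g. g \<in> carrier G \<Longrightarrow> \<exists>i::nat. x g = b [^] i"
    and ord_b: "ord b = q ^ v" and q: "prime q" and v: "v \<ge> 1"
begin

definition n where "n = q ^ v"
definition M where "M = kernel G G x"
definition C where "C = {a \<in> M. a \<otimes> b = b \<otimes> a}"
definition cnj where "cnj a = conjugate a b"
definition inn where "inn m = (\<lambda>g \<in> carrier G. conjugate m g)"

lemma x_hom: "x \<in> hom G G" and x_ext: "x \<in> extensional (carrier G)" using x by auto

sublocale x: group_hom G G x by unfold_locales (rule x_hom)

lemma M_I: "m \<in> carrier G \<Longrightarrow> x m = \<one> \<Longrightarrow> m \<in> M"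
  and M_closed [simp]: "m \<in> M \<Longrightarrow> m \<in> carrier G"
  and x_M [simp]: "m \<in> M \<Longrightarrow> x m = \<one>"
  by (simp_all add: M_def kernel_def)

lemma M_sub: "M \<subseteq> carrier G" by auto

lemma subgroup_M: "subgroup M G" unfolding M_def by (rule x.subgroup_kernel)

sublocale M: subgroup M G by (rule subgroup_M)

lemma finM: "finite M" using finite_subset[OF M_sub fin] .

lemma conj_M: "g \<in> carrier G \<Longrightarrow> m \<in> M \<Longrightarrow> conjugate g m \<in> M"
  by (rule M_I) auto

lemma n1: "n > 1" unfolding n_def using v prime_gt_1_nat[OF q] by (intro one_less_power) auto

lemma ord_b': "ord b = n" using ord_b by (simp add: n_def)

lemma x_pow: "x (b [^] (i::nat)) = b [^] i" using x.hom_nat_pow[of b i] xb by simp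

lemma b_pow_n: "b [^] n = \<one>" using pow_ord_eq_1[of b] ord_b' by simp

lemma b_pow_one_iff: "b [^] (i::nat) = \<one> \<longleftrightarrow> n dvd i" using pow_eq_id[of b i] ord_b' by simp

lemma b_pow_eq_iff: "b [^] (i::nat) = b [^] (j::nat) \<longleftrightarrow> [i = j] (mod n)"
proof -
  have red: "b [^] i = b [^] (i mod n)" for i :: nat
  proof -
    have "b [^] i = b [^] (n * (i div n) + i mod n)" by simp
    also have "\<dots> = (b [^] n) [^] (i div n) \<otimes> b [^] (i mod n)"
      by (simp only: nat_pow_mult[symmetric] nat_pow_pow nat_pow_closed b)
    finally show ?thesis by (simp add: b_pow_n)
  qed
  have "i mod n = j mod n" if "b [^] (i mod n) = b [^] (j mod n)"
  proof -
    have "inj_on (\<lambda>i. b [^] i) {0..ord b - 1}" by (rule ord_inj) (rule b)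
    moreover have "i mod n \<le> n - 1" "j mod n \<le> n - 1"
      using n1 mod_less_divisor[of n i] mod_less_divisor[of n j] by linarith+
    ultimately show ?thesis using that by (auto simp: inj_on_def ord_b')
  qed
  then show ?thesis using red[of i] red[of j] by (auto simp: cong_def)
qed

lemma b_pow_M: "b [^] (i::nat) \<in> M \<longleftrightarrow> n dvd i"
proof
  assume "b [^] i \<in> M"
  then have "x (b [^] i) = \<one>" by (rule x_M)
  then show "n dvd i" unfolding x_pow b_pow_one_iff .
next
  assume "n dvd i"
  then have "x (b [^] i) = \<one>" unfolding x_pow b_pow_one_iff .
  then show "b [^] i \<in> M" by (intro M_I) simp_all
qed

lemma decomp: "g \<in> carrier G \<Longrightarrow> \<exists>m \<in> M. \<exists>i::nat. g = m \<otimes> b [^] i \<and> x g = b [^] i"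
proof -
  assume g: "g \<in> carrier G"
  then obtain i :: nat where i: "x g = b [^] i" using img by blast
  have "g \<otimes> inv (b [^] i) \<in> M" by (rule M_I) (use g i x_pow[of i] in auto)
  moreover have "g = (g \<otimes> inv (b [^] i)) \<otimes> b [^] i" using g by (simp add: word_simps)
  ultimately show ?thesis using i by blast
qed

lemma killing_M:
  assumes f: "f \<in> hom G G" "\<And>m. m \<in> M \<Longrightarrow> f m = \<one>" and g: "g \<in> carrier G"
  shows "f (x g) = f g"
proof -
  obtain m i where m: "m \<in> M" "g = m \<otimes> b [^] (i::nat)" "x g = b [^] i" using decomp[OF g] by blast
  then have "f g = f m \<otimes> f (b [^] i)" using f(1) by (simp add: hom_multD)
  then show ?thesis using f m by (simp add: hom_closedI)
qed

lemma End_eqI: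
  assumes f: "f \<in> carrier (End_monoid G)" "g \<in> carrier (End_monoid G)"
    and "\<And>m. m \<in> M \<Longrightarrow> f m = g m" "f b = g b"
  shows "f = g"
proof (rule extensionalityI[of _ "carrier G"])
  fix a assume "a \<in> carrier G"
  then obtain m i where m: "m \<in> M" "a = m \<otimes> b [^] (i::nat)" using decomp by blast
  have "f a = f m \<otimes> f b [^] i" "g a = g m \<otimes> g b [^] i"
    using f m hom_nat_pow[OF _ b group_axioms group_axioms, of f i] hom_multD[of f G G m "b [^] i"]
      hom_nat_pow[OF _ b group_axioms group_axioms, of g i] hom_multD[of g G G m "b [^] i"] by simp_all
  then show "f a = g a" using assms m by simp
qed (use f in auto)

lemma extend:
  assumes c: "c \<in> carrier G" "c [^] n = \<one>"
  shows "\<exists>f \<in> carrier (End_monoid G). (\<forall>m \<in> M. \<forall>i::nat. f (m \<otimes> b [^] i) = c [^] i)"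
proof -
  have "\<exists>f \<in> hom G G. (\<forall>m \<in> M. \<forall>i::nat. f (m \<otimes> b [^] i) = c [^] i)"
  proof (rule hom_from_cyclic_extension[OF group_axioms group_axioms subgroup_M])
    show "c [^] i = \<one>" if "b [^] i \<in> M" for i :: nat
    proof -
      have "n dvd i" using that unfolding b_pow_M .
      then obtain j where "i = n * j" by (rule dvdE)
      then have "c [^] i = (c [^] n) [^] j" using c(1) by (simp add: nat_pow_pow)
      then show ?thesis using c by simp
    qed
    show "\<exists>m \<in> M. \<exists>i::nat. g = m \<otimes> b [^] i" if "g \<in> carrier G" for g
      using decomp[OF that] by blast
  qed (use c conj_M in auto)
  then obtain f where f: "f \<in> hom G G" "\<forall>m \<in> M. \<forall>i::nat. f (m \<otimes> b [^] i) = c [^] i" by blast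
  then show ?thesis by (intro bexI[of _ "restrict f (carrier G)"]) (auto intro!: homI simp: hom_multD hom_closedI)
qed

lemma extendE:
  assumes c: "c \<in> carrier G" "c [^] n = \<one>"
  obtains f where "f \<in> carrier (End_monoid G)" "\<And>m. m \<in> M \<Longrightarrow> f m = \<one>" "f b = c"
proof -
  obtain f where f: "f \<in> carrier (End_monoid G)" "\<And>m i. m \<in> M \<Longrightarrow> f (m \<otimes> b [^] (i::nat)) = c [^] i"
    using extend[OF c] by blast
  show ?thesis
  proof (rule that[OF f(1)])
    show "f m = \<one>" if "m \<in> M" for m using f(2)[of m 0] \<open>m \<in> M\<close> by simp
    show "f b = c" using f(2)[of \<one> 1] c by simp
  qed
qed

text \<open>An element of order \<open>q\<close> in \<open>M\<close> is the image of \<open>b\<close> under an endomorphism that kills \<open>M\<close>;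
  this endomorphism is not zero and belongs to \<open>H(x)\<close>.\<close>

lemma coprime_kernel_if_H_set_trivial:
  assumes H: "H_set G x = {End_zero G}"
  shows "\<not> q dvd card M"
proof
  assume "q dvd card M"
  let ?M = "G\<lparr>carrier := M\<rparr>"
  interpret MG: group ?M by (rule subgroup_imp_group[OF subgroup_M])
  obtain a where a: "a \<in> M" "a \<noteq> \<one>" "a [^]\<^bsub>?M\<^esub> q = \<one>"
    using MG.element_of_prime_order[OF _ q] finM \<open>q dvd card M\<close> by (auto simp: order_def)
  have "a [^] q = \<one>" using a(3) by (simp flip: nat_pow_consistent)
  moreover obtain w where w: "n = q * w" using v unfolding n_def by (cases v) auto
  have "a [^] n = (a [^] q) [^] w" using a(1) by (simp add: w nat_pow_pow)
  ultimately have "a [^] n = \<one>" by simp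
  then obtain f where f: "f \<in> carrier (End_monoid G)" "\<And>m. m \<in> M \<Longrightarrow> f m = \<one>" "f b = a"
    using extendE[of a] a(1) by auto
  have fh: "f \<in> hom G G" using f by simp
  have "x (f g) = \<one>" if g: "g \<in> carrier G" for g
  proof -
    obtain i where i: "x g = b [^] (i::nat)" using img[OF g] by blast
    have "f g = f (x g)" using killing_M[OF fh f(2) g] by simp
    also have "\<dots> = a [^] i" unfolding i using hom_simps_self(4)[OF fh b] f(3) by simp
    finally have "x (f g) = x a [^] i" using x.hom_nat_pow[of a i] a(1) by simp
    then show ?thesis using a(1) by simp
  qed
  then have "f \<in> H_set G x" unfolding H_set_iff using killing_M[OF fh f(2)] f(1) by blast
  then have "f = End_zero G" using H by blast
  then show False using f(3) a(2) by (simp add: End_zero_def)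
qed

end

locale cyclic_split = cyclic_retract +
  assumes q_not_dvd_M: "\<not> q dvd card M"
begin

text \<open>The map taking \<open>m\<close> to \<open>w m b ^ (- j)\<close> permutes \<open>M\<close> and its \<open>n\<close>-th iterate is the identity.
  As \<open>q\<close> does not divide \<open>|M|\<close>, it has a fixed point; and \<open>w m b ^ (- j) = m\<close> says that \<open>w\<close> is the
  conjugate of \<open>b ^ j\<close> by \<open>m\<close>.\<close>

lemma conjugate_of_power:
  assumes w: "w \<in> carrier G" "w [^] n = \<one>" and xw: "x w = b [^] (j::nat)"
  shows "\<exists>m \<in> M. w = m \<otimes> b [^] j \<otimes> inv m"
proof -
  define c where "c = inv (b [^] j)"
  have c: "c \<in> carrier G" by (simp add: c_def)
  define \<phi> where "\<phi> m = w \<otimes> m \<otimes> c" for m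
  have it: "(\<phi> ^^ i) m = w [^] i \<otimes> m \<otimes> c [^] i" if "m \<in> M" for m i
  proof (induction i)
    case (Suc i)
    have "w \<otimes> w [^] i = w [^] i \<otimes> w" using w by (simp add: nat_pow_Suc2[symmetric])
    then have "w \<otimes> (w [^] i \<otimes> m \<otimes> c [^] i) \<otimes> c = (w [^] i \<otimes> w) \<otimes> m \<otimes> c [^] i \<otimes> c"
      using w c that by (simp flip: m_assoc)
    then show ?case using Suc w c that by (simp add: \<phi>_def m_assoc)
  qed (use that w c in simp)
  have "c [^] n = \<one>"
    by (simp add: c_def nat_pow_inv nat_pow_pow) (simp add: b_pow_one_iff)
  then have per: "(\<phi> ^^ n) m = m" if "m \<in> M" for m using it[OF that, of n] w that by simp
  have clos: "\<phi> m \<in> M" if "m \<in> M" for m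
    by (rule M_I) (use that w xw c x_pow[of j] in \<open>auto simp: \<phi>_def c_def\<close>)
  have "[card M = card {m \<in> M. \<phi> m = m}] (mod q)"
    by (rule cyclic_fixed_points[OF q finM clos n_def per])
  then have "card {m \<in> M. \<phi> m = m} \<noteq> 0" using q_not_dvd_M by (metis cong_0_iff)
  then obtain m where m: "m \<in> M" "\<phi> m = m" by (metis (mono_tags, lifting) card.empty Collect_empty_eq)
  have "w = \<phi> m \<otimes> b [^] j \<otimes> inv m" using m(1) w by (simp add: \<phi>_def c_def word_simps)
  then show ?thesis using m by auto
qed

lemma C_sub: "C \<subseteq> M" by (auto simp: C_def)

lemma C_closed: "c \<in> C \<Longrightarrow> c \<in> carrier G" and C_comm: "c \<in> C \<Longrightarrow> c \<otimes> b = b \<otimes> c"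
  by (auto simp: C_def)

lemma subgroup_C: "subgroup C G"
  by (rule finite_subgroupI[OF fin]) (auto simp: C_def intro: commute_mult exI[of _ \<one>])

lemma cnj_closed [simp]: "a \<in> carrier G \<Longrightarrow> cnj a \<in> carrier G" by (simp add: cnj_def)

lemma cnj_eq_iff:
  assumes "a \<in> carrier G" "c \<in> carrier G"
  shows "cnj a = cnj c \<longleftrightarrow> (inv c \<otimes> a) \<otimes> b = b \<otimes> (inv c \<otimes> a)"
proof -
  have "cnj a = cnj c \<longleftrightarrow> inv c \<otimes> (cnj a \<otimes> a) = inv c \<otimes> (cnj c \<otimes> a)"
    using assms by simp
  also have "inv c \<otimes> (cnj a \<otimes> a) = (inv c \<otimes> a) \<otimes> b" using assms by (simp add: cnj_def word_simps)
  also have "inv c \<otimes> (cnj c \<otimes> a) = b \<otimes> (inv c \<otimes> a)" using assms by (simp add: cnj_def word_simps)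
  finally show ?thesis .
qed

lemma card_conjugates:
  assumes B: "subgroup B G" "B \<subseteq> M"
  shows "card B = card (cnj ` B) * card (B \<inter> C)"
proof (rule card_image_times_subgroup[OF finite_subset[OF B(2) finM] B(1)])
  interpret B: subgroup B G by fact
  fix a c assume ac: "a \<in> B" "c \<in> B"
  then have "inv a \<otimes> c \<in> B" "inv a \<otimes> c \<in> M" using B(2) by auto
  moreover have "cnj a = cnj c \<longleftrightarrow> (inv a \<otimes> c) \<otimes> b = b \<otimes> (inv a \<otimes> c)"
    using cnj_eq_iff[of c a] ac by (simp only: B.mem_carrier eq_commute[of "cnj a"])
  ultimately show "cnj a = cnj c \<longleftrightarrow> inv a \<otimes> c \<in> B \<inter> C" unfolding C_def by blast
qed auto

lemma card_M: "card M = card (cnj ` M) * card C"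
  using card_conjugates[OF subgroup_M] C_sub by (simp add: Int_absorb1)

lemma inn_End: "m \<in> carrier G \<Longrightarrow> inn m \<in> carrier (End_monoid G)"
  by (auto simp: inn_def word_simps intro!: homI)

lemma inn_auto: "m \<in> carrier G \<Longrightarrow> inn m \<in> auto G"
proof -
  assume m: "m \<in> carrier G"
  have "inj_on (inn m) (carrier G)" using m by (auto simp: inn_def inj_on_def)
  then show ?thesis using auto_iff_inj[OF fin inn_End[OF m]] by simp
qed

lemma inn_V: "m \<in> M \<Longrightarrow> inn m \<in> V_set G x"
  unfolding V_set_iff[OF x] using inn_auto[of m] by (simp add: inn_def)

lemma D_iff: "d \<in> D_set G x \<longleftrightarrow> d \<in> V_set G x \<and> d b = b"
proof
  assume "d \<in> D_set G x" then show "d \<in> V_set G x \<and> d b = b"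
    using D_set_iff[OF x] xb b by metis
next
  assume d: "d \<in> V_set G x \<and> d b = b"
  then have "d \<in> hom G G" by (simp add: V_set_def auto_def)
  then have "d (b [^] i) = b [^] i" for i :: nat using d hom_nat_pow[of d G G b i] by (simp add: group_axioms)
  then have "d (x g) = x g" if "g \<in> carrier G" for g using img[OF that] by metis
  then show "d \<in> D_set G x" using d D_set_iff[OF x] by blast
qed

lemma V_props:
  assumes "f \<in> V_set G x"
  shows "f \<in> auto G" "f \<in> carrier (End_monoid G)" "f \<in> hom G G" "g \<in> carrier G \<Longrightarrow> f g \<in> carrier G"
    "g \<in> carrier G \<Longrightarrow> x (f g) = x g" "inj_on f (carrier G)"
proof -
  show a: "f \<in> auto G" using assms V_set_iff[OF x] by blast
  show e: "f \<in> carrier (End_monoid G)" by (rule auto_imp_End[OF a])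
  show h: "f \<in> hom G G" using a by (simp add: auto_def)
  show "g \<in> carrier G \<Longrightarrow> f g \<in> carrier G" using h by (rule hom_closedI)
  show "g \<in> carrier G \<Longrightarrow> x (f g) = x g" using assms V_set_iff[OF x] by blast
  show "inj_on f (carrier G)" using auto_iff_inj[OF fin e] a by blast
qed

sublocale V: group "V_group G x" by (rule group_V_group[OF x])

lemma V_simps [simp]:
  "f \<in> carrier (V_group G x) \<longleftrightarrow> f \<in> V_set G x"
  "f \<otimes>\<^bsub>V_group G x\<^esub> g = compose (carrier G) g f"
  "\<one>\<^bsub>V_group G x\<^esub> = (\<lambda>a \<in> carrier G. a)"
  by (simp_all add: V_group_def)

lemma V_carrier: "carrier (V_group G x) = V_set G x" by (simp add: V_group_def)

lemma finV: "finite (V_set G x)"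
proof (rule finite_subset[OF _ finite_PiE[OF fin, of "\<lambda>_. carrier G"]])
  show "V_set G x \<subseteq> carrier G \<rightarrow>\<^sub>E carrier G" using V_props(2,4) unfolding PiE_def by (auto simp del: V_simps)
qed (use fin in auto)

lemma V_pow: "f \<in> V_set G x \<Longrightarrow> a \<in> carrier G \<Longrightarrow> (f [^]\<^bsub>V_group G x\<^esub> (k::nat)) a = (f ^^ k) a"
  by (induction k) (auto simp: compose_def)

lemma subgroup_D: "subgroup (D_set G x) (V_group G x)"
proof (rule V.finite_subgroupI)
  show "D_set G x \<subseteq> carrier (V_group G x)" using D_iff V_carrier by auto
  have "\<one>\<^bsub>V_group G x\<^esub> \<in> D_set G x" using V.one_closed by (auto simp: D_iff)
  then show "D_set G x \<noteq> {}" by blast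
  show "f \<otimes>\<^bsub>V_group G x\<^esub> g \<in> D_set G x" if "f \<in> D_set G x" "g \<in> D_set G x" for f g
    using that V.m_closed[of f g] by (auto simp: D_iff compose_def)
qed (use finV V_carrier in auto)

lemma V_moves_b:
  assumes f: "f \<in> V_set G x"
  shows "f b \<in> cnj ` M"
proof -
  have "f b [^] n = f (b [^] n)" using hom_nat_pow[OF V_props(3)[OF f] b group_axioms group_axioms] by simp
  also have "\<dots> = \<one>" using b_pow_n hom_one[OF V_props(3)[OF f] group_axioms group_axioms] by simp
  finally have "f b [^] n = \<one>" .
  moreover have "x (f b) = b [^] (1::nat)" using V_props(5)[OF f b] xb by simp
  ultimately obtain m where "m \<in> M" "f b = m \<otimes> b [^] (1::nat) \<otimes> inv m"
    using conjugate_of_power[of "f b" 1] V_props(4)[OF f b] by blast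
  then show ?thesis by (auto simp: cnj_def)
qed

text \<open>The group \<open>V(x)\<close> acts on the conjugates of \<open>b\<close> under \<open>M\<close>. The action is transitive, as the
  inner automorphisms by \<open>M\<close> belong to \<open>V(x)\<close>, and the stabilizer of \<open>b\<close> is \<open>D(x)\<close>.\<close>

lemma card_V: "card (V_set G x) = card (cnj ` M) * card (D_set G x)"
proof -
  let ?V = "V_group G x"
  have val: "(f \<otimes>\<^bsub>?V\<^esub> g) b = g (f b)" for f g by (simp add: compose_def)
  have invV: "inv\<^bsub>?V\<^esub> f \<in> V_set G x" if "f \<in> V_set G x" for f using V.inv_closed[of f] that by simp
  \<comment> \<open>Products compose from left to right, so the left cosets of the stabilizer are the fibres of the
    evaluation of inverses.\<close>
  have "card (V_set G x) = card ((\<lambda>f. (inv\<^bsub>?V\<^esub> f) b) ` V_set G x) * card (D_set G x)"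
  proof (rule V.card_image_times_subgroup[OF finV])
    show "subgroup (V_set G x) ?V" using V.subgroup_self by (simp only: V_carrier)
    show "D_set G x \<subseteq> V_set G x" by (auto simp: D_iff)
    fix f g assume f: "f \<in> V_set G x" and g: "g \<in> V_set G x"
    have "inv\<^bsub>?V\<^esub> g \<otimes>\<^bsub>?V\<^esub> g = \<one>\<^bsub>?V\<^esub>" by (rule V.l_inv) (use g in simp)
    then have "g ((inv\<^bsub>?V\<^esub> g) b) = b" using val[of "inv\<^bsub>?V\<^esub> g" g] by simp
    then have "(inv\<^bsub>?V\<^esub> f) b = (inv\<^bsub>?V\<^esub> g) b \<longleftrightarrow> g ((inv\<^bsub>?V\<^esub> f) b) = b"
      using V_props(6)[OF g] V_props(4)[OF invV[OF f] b] V_props(4)[OF invV[OF g] b] by (metis inj_onD)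
    then show "(inv\<^bsub>?V\<^esub> f) b = (inv\<^bsub>?V\<^esub> g) b \<longleftrightarrow> inv\<^bsub>?V\<^esub> f \<otimes>\<^bsub>?V\<^esub> g \<in> D_set G x"
      using V.m_closed[of "inv\<^bsub>?V\<^esub> f" g] invV[OF f] g val[of "inv\<^bsub>?V\<^esub> f" g] by (simp add: D_iff)
  qed
  moreover have "(\<lambda>f. (inv\<^bsub>?V\<^esub> f) b) ` V_set G x = (\<lambda>f. f b) ` V_set G x"
  proof -
    have "(\<lambda>f. inv\<^bsub>?V\<^esub> f) ` V_set G x = V_set G x"
    proof (intro antisym subsetI)
      show "f \<in> (\<lambda>f. inv\<^bsub>?V\<^esub> f) ` V_set G x" if "f \<in> V_set G x" for f
        by (rule image_eqI[OF _ invV[OF that]]) (use V.inv_inv[of f] that in simp)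
    qed (use invV in blast)
    then have "(\<lambda>f. f b) ` (\<lambda>f. inv\<^bsub>?V\<^esub> f) ` V_set G x = (\<lambda>f. f b) ` V_set G x" by (rule arg_cong)
    then show ?thesis by (simp only: image_image)
  qed
  moreover have "(\<lambda>f. f b) ` V_set G x = cnj ` M"
  proof
    show "(\<lambda>f. f b) ` V_set G x \<subseteq> cnj ` M" using V_moves_b by auto
    show "cnj ` M \<subseteq> (\<lambda>f. f b) ` V_set G x"
    proof
      fix a assume "a \<in> cnj ` M"
      then obtain m where "m \<in> M" "a = inn m b" by (auto simp: cnj_def inn_def)
      then show "a \<in> (\<lambda>f. f b) ` V_set G x" using inn_V by blast
    qed
  qed
  ultimately show ?thesis by simp
qed

lemma b_ne_one: "b \<noteq> \<one>"
  using ord_b' n1 ord_eq_1[OF b] by auto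

lemma coprime_n_M: "coprime n (card M)"
  unfolding n_def using prime_imp_coprime[OF q q_not_dvd_M] by simp

lemma M_torsion: "a \<in> M \<Longrightarrow> a [^] n = \<one> \<Longrightarrow> a = \<one>"
  using coprime_torsion[of a n "card M"] pow_card_subgroup[OF subgroup_M] coprime_n_M by simp

lemma commutator_M: "a \<in> M \<Longrightarrow> commutator a b \<in> M"
  by (rule M_I) (auto simp: xb)

lemma commutes_if_commutator_commutes:
  assumes a: "a \<in> M" and z: "(commutator a b) \<otimes> b = b \<otimes> (commutator a b)"
  shows "a \<otimes> b = b \<otimes> a"
  by (rule commute_if_commutator_commutes[OF _ b refl b_pow_n z M_torsion[OF commutator_M[OF a]]]) (use a in auto)

text \<open>Conjugation by \<open>b\<close> permutes the conjugates of \<open>b\<close> under \<open>B\<close>, and its \<open>q\<close>-th iterate is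
  trivial as \<open>b ^ q\<close> centralizes \<open>M\<close>. Only \<open>b\<close> is fixed: if \<open>a b a\<inverse>\<close> commutes with \<open>b\<close>, then so
  does the commutator of \<open>a\<close> and \<open>b\<close>, and then so does \<open>a\<close>.\<close>

lemma card_conjugates_mod_q:
  assumes B: "subgroup B G" "B \<subseteq> M" and inv: "\<And>a. a \<in> B \<Longrightarrow> conjugate b a \<in> B"
    and bq: "\<And>m. m \<in> M \<Longrightarrow> b [^] q \<otimes> m = m \<otimes> b [^] q"
  shows "[card (cnj ` B) = 1] (mod q)"
proof -
  interpret B: subgroup B G by fact
  have BM: "a \<in> M" if "a \<in> B" for a using B(2) that by auto
  have phi_cnj: "conjugate b (cnj a) = cnj (conjugate b a)" if "a \<in> B" for a
    using that by (simp add: cnj_def word_simps)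
  have per: "(conjugate b ^^ q) u = u" if "u \<in> cnj ` B" for u
  proof -
    obtain a where a: "a \<in> B" "u = cnj a" using \<open>u \<in> cnj ` B\<close> by blast
    have bb: "b [^] q \<otimes> b = b \<otimes> b [^] q" by (rule commute_pow) simp_all
    have ab: "a \<otimes> b [^] q = b [^] q \<otimes> a" using bq[OF BM[OF a(1)]] by simp
    have "inv a \<otimes> b [^] q = b [^] q \<otimes> inv a" using commute_inv[of a "b [^] q"] ab a(1) by simp
    then have "cnj a \<otimes> b [^] q = b [^] q \<otimes> cnj a"
      unfolding cnj_def using a(1) ab bb by (intro commute_mult) (simp_all)
    then have "b [^] q \<otimes> u \<otimes> inv (b [^] q) = u \<otimes> b [^] q \<otimes> inv (b [^] q)" using a by simp
    then show ?thesis using conjugate_funpow[of b u q] a by (simp add: word_simps)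
  qed
  have "[card (cnj ` B) = card {u \<in> cnj ` B. conjugate b u = u}] (mod q)"
  proof (rule cyclic_fixed_points[OF q, where v = 1 and n = q])
    show "conjugate b u \<in> cnj ` B" if "u \<in> cnj ` B" for u using that phi_cnj inv by auto
  qed (use finite_subset[OF B.subset fin] per in auto)
  moreover have "{u \<in> cnj ` B. conjugate b u = u} = {b}"
  proof -
    have "cnj a = b" if a: "a \<in> B" "conjugate b (cnj a) = cnj a" for a
    proof -
      have aG: "a \<in> carrier G" using a(1) by simp
      have "b \<otimes> cnj a = conjugate b (cnj a) \<otimes> b" using aG by (simp add: word_simps)
      then have e: "b \<otimes> cnj a = cnj a \<otimes> b" by (simp only: a(2))
      have "(commutator a b) \<otimes> b = b \<otimes> (commutator a b)"
      proof -
        have "b \<otimes> (commutator a b) = (b \<otimes> cnj a) \<otimes> inv b" using aG by (simp add: cnj_def m_assoc)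
        also have "\<dots> = cnj a" using aG by (simp only: e) (simp add: word_simps)
        finally show ?thesis using aG by (simp add: cnj_def word_simps)
      qed
      then have "a \<otimes> b = b \<otimes> a" by (rule commutes_if_commutator_commutes[OF BM[OF a(1)]])
      then show ?thesis using aG by (simp add: cnj_def word_simps)
    qed
    moreover have "cnj \<one> = b" "conjugate b b = b" by (simp_all add: cnj_def word_simps)
    then have "b \<in> {u \<in> cnj ` B. conjugate b u = u}" using image_eqI[of b cnj \<one> B] B.one_closed by simp
    ultimately show ?thesis by blast
  qed
  ultimately show ?thesis by simp
qed

lemma cnj_eq_b: "a \<in> M \<Longrightarrow> cnj a = b \<longleftrightarrow> a \<in> C"
  using cnj_eq_iff[of a \<one>] by (simp add: cnj_def C_def)

text \<open>For \<open>e = |M| k\<close> with \<open>|M| j k\<close> congruent to \<open>1\<close> modulo \<open>n\<close>, the power \<open>w ^ e\<close> maps to \<open>b\<close>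
  under \<open>x\<close>, and its order divides \<open>n\<close> because \<open>w ^ n\<close> lies in \<open>M\<close>.\<close>

lemma power_conjugate_to_b:
  assumes w: "w \<in> carrier G" "x w = b [^] (j::nat)" "\<not> q dvd j"
  shows "\<exists>e::nat. \<exists>m \<in> M. w [^] e = cnj m"
proof -
  have "coprime (card M * j) n"
    using coprime_n_M prime_imp_coprime[OF q w(3)] unfolding n_def by (simp add: coprime_commute)
  then obtain k where k: "[card M * j * k = 1] (mod n)" using cong_solve_coprime_nat[of "card M * j" n] by auto
  define e where "e = card M * k"
  have "x (w [^] e) = (b [^] j) [^] e" using w x.hom_nat_pow by simp
  also have "\<dots> = b [^] (card M * j * k)" by (simp add: nat_pow_pow e_def mult_ac)
  also have "\<dots> = b [^] (1::nat)" using k unfolding b_pow_eq_iff .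
  finally have xw: "x (w [^] e) = b [^] (1::nat)" .
  have "w [^] n \<in> M"
  proof (rule M_I)
    have "x (w [^] n) = (b [^] j) [^] n" using w x.hom_nat_pow by simp
    also have "\<dots> = (b [^] n) [^] j" by (simp add: nat_pow_pow mult.commute)
    finally show "x (w [^] n) = \<one>" by (simp add: b_pow_n)
  qed (use w in simp)
  then have "(w [^] n) [^] card M = \<one>" by (rule pow_card_subgroup[OF subgroup_M])
  moreover have "(w [^] e) [^] n = ((w [^] n) [^] card M) [^] k"
    using w by (simp add: nat_pow_pow e_def mult_ac)
  ultimately have "(w [^] e) [^] n = \<one>" by simp
  then obtain m where "m \<in> M" "w [^] e = m \<otimes> b [^] (1::nat) \<otimes> inv m"
    using conjugate_of_power[OF _ _ xw] w by auto
  then show ?thesis by (auto simp: cnj_def)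
qed

lemma inn_pow:
  assumes m: "m \<in> carrier G" "g \<in> carrier G"
  shows "(inn m ^^ (k::nat)) g = conjugate (m [^] k) g"
  unfolding conjugate_funpow[OF m, symmetric]
proof (induction k)
  case (Suc k)
  have "(conjugate m ^^ k) g \<in> carrier G" using m by (simp add: conjugate_funpow)
  then show ?case using Suc by (simp add: inn_def)
qed simp

lemma multiplicity_V:
  assumes "prime p" "\<not> p dvd card (D_set G x)" "card (cnj ` M) = p ^ u"
  shows "multiplicity p (order (V_group G x)) = u"
proof -
  have "order (V_group G x) = p ^ u * card (D_set G x)" using card_V assms(3) by (simp add: order_def V_carrier)
  then show ?thesis using assms multiplicity_eqI[of p u "order (V_group G x)"] prime_gt_0_nat[OF assms(1)]
    by (simp add: power_Suc2 del: power_Suc)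
qed

text \<open>The order of \<open>d\<close> divides both \<open>p ^ k\<close> and \<open>|D(x)|\<close>.\<close>

lemma D_p_element_trivial:
  assumes p: "prime p" "\<not> p dvd card (D_set G x)" and d: "d \<in> D_set G x"
    and pk: "\<And>g. g \<in> carrier G \<Longrightarrow> (d ^^ (p ^ k)) g = g" and g: "g \<in> carrier G"
  shows "d g = g"
proof -
  let ?V = "V_group G x"
  interpret D: subgroup "D_set G x" ?V by (rule subgroup_D)
  interpret Dg: group "?V\<lparr>carrier := D_set G x\<rparr>" by (rule D.subgroup_is_group) (rule V.group_axioms)
  have dV: "d \<in> V_set G x" using d by (simp add: D_iff)
  have "d [^]\<^bsub>?V\<^esub> (p ^ k) = \<one>\<^bsub>?V\<^esub>"
  proof (rule extensionalityI[of _ "carrier G"])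
    show "d [^]\<^bsub>?V\<^esub> (p ^ k) \<in> extensional (carrier G)"
      using V_props(2)[of "d [^]\<^bsub>?V\<^esub> (p ^ k)"] V.nat_pow_closed[of d "p ^ k"] dV by simp
  qed (use V_pow[OF dV] pk in auto)
  then have "V.ord d dvd p ^ k" using V.pow_eq_id dV by auto
  moreover have "d [^]\<^bsub>?V\<^esub> card (D_set G x) = \<one>\<^bsub>?V\<^esub>"
    using Dg.pow_order_eq_1[of d] d by (simp add: order_def flip: V.nat_pow_consistent)
  then have "V.ord d dvd card (D_set G x)" using V.pow_eq_id dV by auto
  moreover have "coprime (p ^ k) (card (D_set G x))" using prime_imp_coprime[OF p] by simp
  ultimately have "V.ord d = 1" by (metis coprime_common_divisor_nat nat_dvd_1_iff_1 One_nat_def)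
  then have "d = \<one>\<^bsub>?V\<^esub>" using V.ord_eq_1[of d] dV by simp
  then show ?thesis using g by simp
qed

lemma inn_mult: "a \<in> carrier G \<Longrightarrow> c \<in> carrier G \<Longrightarrow> compose (carrier G) (inn a) (inn c) = inn (a \<otimes> c)"
  by (auto simp: inn_def compose_def word_simps intro!: restrict_ext)

lemma subgroup_inn: "subgroup (inn ` M) (V_group G x)"
proof (rule V.finite_subgroupI)
  show "inn ` M \<subseteq> carrier (V_group G x)" using inn_V V_carrier by auto
  show "f \<otimes>\<^bsub>V_group G x\<^esub> h \<in> inn ` M" if "f \<in> inn ` M" "h \<in> inn ` M" for f h
    using that inn_mult by auto
  show "inn ` M \<noteq> {}" using M.one_closed by blast
qed (use finV V_carrier in auto)

lemma inn_eq_iff: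
  assumes cen: "\<And>c g. c \<in> C \<Longrightarrow> g \<in> carrier G \<Longrightarrow> c \<otimes> g = g \<otimes> c"
    and ac: "a \<in> M" "c \<in> M"
  shows "inn a = inn c \<longleftrightarrow> inv a \<otimes> c \<in> C"
proof
  assume "inn a = inn c"
  then have "inn a b = inn c b" by simp
  then have "cnj c = cnj a" by (simp add: inn_def cnj_def)
  then have "(inv a \<otimes> c) \<otimes> b = b \<otimes> (inv a \<otimes> c)" using ac cnj_eq_iff[of c a] by simp
  then show "inv a \<otimes> c \<in> C" using ac by (simp add: C_def)
next
  assume z: "inv a \<otimes> c \<in> C"
  show "inn a = inn c"
  proof (rule extensionalityI[of _ "carrier G"])
    fix h assume h: "h \<in> carrier G"
    have "inn c h = a \<otimes> ((inv a \<otimes> c) \<otimes> h) \<otimes> inv (inv a \<otimes> c) \<otimes> inv a"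
      using ac h by (simp add: inn_def word_simps)
    also have "(inv a \<otimes> c) \<otimes> h = h \<otimes> (inv a \<otimes> c)" by (rule cen[OF z h])
    finally show "inn a h = inn c h" using ac h by (simp add: inn_def word_simps)
  qed (auto simp: inn_def)
qed

lemma card_inn:
  assumes cen: "\<And>c g. c \<in> C \<Longrightarrow> g \<in> carrier G \<Longrightarrow> c \<otimes> g = g \<otimes> c"
  shows "card M = card (inn ` M) * card C"
  by (rule card_image_times_subgroup[OF finM subgroup_M C_sub inn_eq_iff[OF cen]])

text \<open>The projection with kernel \<open>M\<close> onto the conjugate of \<open>\<langle>b\<rangle>\<close> by \<open>m\<close>.\<close>

definition proj where "proj m = (\<lambda>g \<in> carrier G. m \<otimes> x g \<otimes> inv m)"

lemma proj_simps:
  assumes m: "m \<in> M"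
  shows "proj m \<in> carrier (End_monoid G)" "a \<in> M \<Longrightarrow> proj m a = \<one>" "proj m b = cnj m"
    "g \<in> carrier G \<Longrightarrow> x (proj m g) = x g" "g \<in> carrier G \<Longrightarrow> proj m (proj m g) = proj m g"
    "g \<in> carrier G \<Longrightarrow> proj m (x g) = proj m g"
proof -
  have xx: "x (x g) = x g" if "g \<in> carrier G" for g using img[OF that] x_pow by auto
  show "proj m \<in> carrier (End_monoid G)" using m by (auto intro!: homI simp: proj_def word_simps)
  show "proj m a = \<one>" if "a \<in> M" using m that by (simp add: proj_def)
  show "proj m b = cnj m" by (simp add: proj_def cnj_def xb)
  show e: "x (proj m g) = x g" if "g \<in> carrier G" using m that by (simp add: proj_def xx)
  show "proj m (proj m g) = proj m g" if "g \<in> carrier G" using m that e by (simp add: proj_def)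
  show "proj m (x g) = proj m g" if "g \<in> carrier G" using m that by (simp add: proj_def xx)
qed

lemma proj_I0:
  assumes m: "m \<in> M" and M1: "M \<noteq> {\<one>}"
  shows "proj m \<in> I0 G"
proof -
  have "proj m \<noteq> End_zero G"
  proof
    assume "proj m = End_zero G"
    then have "x (proj m b) = x \<one>" by (simp add: End_zero_def)
    then show False using proj_simps(4)[OF m b] xb b_ne_one by simp
  qed
  moreover obtain a where a: "a \<in> M" "a \<noteq> \<one>" using M1 M.one_closed by auto
  then have "proj m \<noteq> (\<lambda>g \<in> carrier G. g)" using proj_simps(2)[OF m a(1)] by auto
  ultimately show ?thesis using proj_simps[OF m] by (simp add: I0_iff)
qed

lemma hom_at_b:
  assumes "f \<in> hom G G"
  shows "f b \<in> carrier G" "f b [^] n = \<one>"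
  using hom_simps_self[OF assms] b_pow_n by (auto simp flip: hom_simps_self(4)[OF assms])

lemma hom_at_b_conjugate:
  assumes f: "f \<in> hom G G"
  shows "\<exists>m \<in> M. \<exists>j::nat. f b = m \<otimes> b [^] j \<otimes> inv m \<and> x (f b) = b [^] j"
proof -
  obtain j :: nat where "x (f b) = b [^] j" using img[OF hom_at_b(1)[OF f]] by blast
  then show ?thesis using conjugate_of_power[OF hom_at_b[OF f]] by blast
qed

lemma eq_proj:
  assumes y: "y \<in> carrier (End_monoid G)" "\<And>m. m \<in> M \<Longrightarrow> y m = \<one>" "x (y b) = b"
  shows "\<exists>m \<in> M. y = proj m"
proof -
  have yh: "y \<in> hom G G" using y by simp
  obtain m and j :: nat where m: "m \<in> M" "y b = m \<otimes> b [^] j \<otimes> inv m" "x (y b) = b [^] j"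
    using hom_at_b_conjugate[OF yh] by blast
  then have m: "m \<in> M" "y b = m \<otimes> b \<otimes> inv m" using y(3) by auto
  have "y = proj m"
    by (rule End_eqI[OF y(1) proj_simps(1)[OF m(1)]]) (use y(2) m proj_simps[OF m(1)] in \<open>auto simp: cnj_def\<close>)
  then show ?thesis using m by blast
qed

lemma card_proj: "card (proj ` M) = card (cnj ` M)"
proof -
  have "(\<lambda>y. y b) ` proj ` M = cnj ` M" using proj_simps(3) by (auto simp: image_iff)
  moreover have "inj_on (\<lambda>y. y b) (proj ` M)"
    by (rule inj_onI) (auto intro!: End_eqI simp del: End_simps simp: proj_simps)
  ultimately show ?thesis by (metis card_image)
qed

text \<open>Here \<open>z\<close> kills \<open>M\<close> when it is unchanged by applying the projection first, and the image of
  \<open>z\<close> lies in the image of the projection when it is unchanged by applying the projection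
  afterwards.\<close>

lemma K_proj_iff:
  assumes m: "m \<in> M"
  shows "z \<in> K_set G (proj m) \<longleftrightarrow> z \<in> carrier (End_monoid G) \<and> (\<forall>a \<in> M. z a = \<one>)
     \<and> (\<exists>j::nat. z b = m \<otimes> b [^] j \<otimes> inv m)"
proof
  assume z: "z \<in> K_set G (proj m)"
  then have zE: "z \<in> carrier (End_monoid G)" and zp: "\<And>g. g \<in> carrier G \<Longrightarrow> proj m (z g) = z g"
    "\<And>g. g \<in> carrier G \<Longrightarrow> z (proj m g) = z g" by (auto simp: K_set_iff simp del: End_simps)
  have zh: "z \<in> hom G G" using zE by simp
  have "z a = \<one>" if a: "a \<in> M" for a
    using zp(2)[of a] proj_simps(2)[OF m a] a hom_simps_self(1)[OF zh] by simp
  moreover obtain j :: nat where "x (z b) = b [^] j" using img[OF hom_closedI[OF zh b]] by blast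
  then have "z b = m \<otimes> b [^] j \<otimes> inv m" using zp(1)[OF b] hom_closedI[OF zh b] by (simp add: proj_def)
  ultimately show "z \<in> carrier (End_monoid G) \<and> (\<forall>a \<in> M. z a = \<one>)
     \<and> (\<exists>j::nat. z b = m \<otimes> b [^] j \<otimes> inv m)" using zE by blast
next
  assume z: "z \<in> carrier (End_monoid G) \<and> (\<forall>a \<in> M. z a = \<one>) \<and> (\<exists>j::nat. z b = m \<otimes> b [^] j \<otimes> inv m)"
  then obtain j :: nat where j: "z b = m \<otimes> b [^] j \<otimes> inv m" by blast
  have zh: "z \<in> hom G G" and zE: "z \<in> carrier (End_monoid G)" and za: "\<And>a. a \<in> M \<Longrightarrow> z a = \<one>" using z by auto
  have E: "compose (carrier G) f g \<in> carrier (End_monoid G)"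
    if "f \<in> carrier (End_monoid G)" "g \<in> carrier (End_monoid G)" for f g
    using monoid.m_closed[OF monoid_End that(2,1)] by simp
  note pE = proj_simps(1)[OF m] and ph = proj_simps(1)[OF m, simplified, THEN conjunct1]
  have "compose (carrier G) (proj m) z = z"
  proof (rule End_eqI[OF E[OF pE zE] zE])
    show "compose (carrier G) (proj m) z a = z a" if "a \<in> M" for a
      using that za hom_simps_self(1)[OF ph] by (simp add: compose_def)
    have "x (z b) = b [^] j" using j m x_pow by simp
    then show "compose (carrier G) (proj m) z b = z b" using hom_closedI[OF zh b] by (simp add: compose_def proj_def j)
  qed
  moreover have "compose (carrier G) z (proj m) = z"
  proof (rule End_eqI[OF E[OF zE pE] zE])
    show "compose (carrier G) z (proj m) a = z a" if "a \<in> M" for a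
      using that za proj_simps(2)[OF m that] hom_simps_self(1)[OF zh] by (simp add: compose_def)
    have "z (cnj m) = z m \<otimes> z b \<otimes> z (inv m)" using zh m by (simp add: cnj_def hom_multD[OF zh])
    also have "\<dots> = z b" using za m hom_closedI[OF zh b] by simp
    finally show "compose (carrier G) z (proj m) b = z b" by (simp add: compose_def proj_simps(3)[OF m])
  qed
  ultimately show "z \<in> K_set G (proj m)" using zE by (simp add: K_set_iff compose_eq_iff)
qed

lemma x_eq_proj: "x = proj \<one>"
  by (rule extensionalityI[of _ "carrier G"]) (auto simp: proj_def x_ext)

text \<open>An element of \<open>K(x)\<close> is determined by the exponent \<open>j\<close> modulo \<open>n\<close> for which it sends \<open>b\<close> to
  \<open>b ^ j\<close>, and composition multiplies exponents.\<close>

lemma K_x_iso: "(End_monoid G)\<lparr>carrier := K_set G x\<rparr> \<cong> mult_mod n"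
proof -
  have K: "z \<in> K_set G x \<longleftrightarrow> z \<in> carrier (End_monoid G) \<and> (\<forall>a \<in> M. z a = \<one>) \<and> (\<exists>j::nat. z b = b [^] j)" for z
    using K_proj_iff[OF M.one_closed, of z] by (simp flip: x_eq_proj)
  define lg where "lg z = (THE i. i < n \<and> z b = b [^] i)" for z :: "'a \<Rightarrow> 'a"
  have lgI: "lg z = j mod n" if "z b = b [^] j" for z j
    unfolding lg_def
  proof (rule the_equality)
    show "j mod n < n \<and> z b = b [^] (j mod n)" using n1 that b_pow_eq_iff[of j "j mod n"] by (simp add: cong_def)
    show "i = j mod n" if "i < n \<and> z b = b [^] i" for i
      using that \<open>z b = b [^] j\<close> b_pow_eq_iff[of i j] by (simp add: cong_def)
  qed
  have "lg \<in> iso ((End_monoid G)\<lparr>carrier := K_set G x\<rparr>) (mult_mod n)"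
    unfolding iso_def
  proof (intro CollectI conjI homI)
    fix z assume "z \<in> carrier ((End_monoid G)\<lparr>carrier := K_set G x\<rparr>)"
    then obtain j :: nat where "z b = b [^] j" using K by auto
    then show "lg z \<in> carrier (mult_mod n)" using lgI n1 by (simp add: mult_mod_def)
  next
    fix y z assume "y \<in> carrier ((End_monoid G)\<lparr>carrier := K_set G x\<rparr>)" "z \<in> carrier ((End_monoid G)\<lparr>carrier := K_set G x\<rparr>)"
    then have yz: "y \<in> K_set G x" "z \<in> K_set G x" by simp_all
    obtain i :: nat where i: "y b = b [^] i" using yz(1) K by blast
    obtain j :: nat where j: "z b = b [^] j" using yz(2) K by blast
    have "z (b [^] i) = (b [^] j) [^] i"
      using hom_nat_pow[OF _ b group_axioms group_axioms, of z i] yz K j by simp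
    then have "compose (carrier G) z y b = b [^] (i * j)" using i by (simp add: compose_def nat_pow_pow mult.commute)
    then have "lg (compose (carrier G) z y) = (i * j) mod n" by (rule lgI)
    then show "lg (y \<otimes>\<^bsub>(End_monoid G)\<lparr>carrier := K_set G x\<rparr>\<^esub> z) = lg y \<otimes>\<^bsub>mult_mod n\<^esub> lg z"
      using lgI[of y, OF i] lgI[of z, OF j] by (simp add: mult_mod_def mod_mult_eq)
  next
    show "bij_betw lg (carrier ((End_monoid G)\<lparr>carrier := K_set G x\<rparr>)) (carrier (mult_mod n))"
      unfolding bij_betw_def
    proof
      show "inj_on lg (carrier ((End_monoid G)\<lparr>carrier := K_set G x\<rparr>))"
      proof (rule inj_onI)
        fix y z assume "y \<in> carrier ((End_monoid G)\<lparr>carrier := K_set G x\<rparr>)"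
          "z \<in> carrier ((End_monoid G)\<lparr>carrier := K_set G x\<rparr>)" and e: "lg y = lg z"
        then have yz: "y \<in> K_set G x" "z \<in> K_set G x" by simp_all
        obtain i :: nat where i: "y b = b [^] i" using yz(1) K by blast
        obtain j :: nat where j: "z b = b [^] j" using yz(2) K by blast
        have "[i = j] (mod n)" using e lgI[of y, OF i] lgI[of z, OF j] by (simp add: cong_def)
        then have "y b = z b" unfolding i j b_pow_eq_iff .
        then show "y = z" using End_eqI[of y z] yz K by auto
      qed
      have "i \<in> lg ` K_set G x" if i: "i < n" for i
      proof -
        have "(b [^] i) [^] n = (b [^] n) [^] i" by (simp add: nat_pow_pow mult.commute)
        then have "(b [^] i) [^] n = \<one>" by (simp add: b_pow_n)
        then obtain f where f: "f \<in> carrier (End_monoid G)" "\<And>m. m \<in> M \<Longrightarrow> f m = \<one>" "f b = b [^] i"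
          using extendE[of "b [^] i"] by auto
        then have "f \<in> K_set G x" using K by blast
        moreover have "lg f = i" using lgI[of f, OF f(3)] i by simp
        ultimately show ?thesis by blast
      qed
      moreover have "lg z < n" if z: "z \<in> K_set G x" for z
      proof -
        obtain j :: nat where "z b = b [^] j" using z K by blast
        then show ?thesis using lgI n1 by simp
      qed
      ultimately show "lg ` carrier ((End_monoid G)\<lparr>carrier := K_set G x\<rparr>) = carrier (mult_mod n)"
        by (auto simp: mult_mod_def)
    qed
  qed
  then show ?thesis by (rule is_isoI)
qed

lemma idem_class_eq: "idem_class G x = proj ` M"
proof
  show "idem_class G x \<subseteq> proj ` M"
  proof
    fix z assume "z \<in> idem_class G x"
    then have z: "z \<in> carrier (End_monoid G)" "\<And>g. g \<in> carrier G \<Longrightarrow> z (x g) = z g"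
      and xz: "compose (carrier G) x z = x" by (auto simp: idem_class_iff simp del: End_simps)
    have xz': "x (z g) = x g" if "g \<in> carrier G" for g using xz that by (metis compose_eq)
    have "z m = \<one>" if "m \<in> M" for m
      using z(2)[of m] that hom_one[of z G G] z(1) group_axioms by simp
    then show "z \<in> proj ` M" using eq_proj[OF z(1)] xz'[OF b] xb by auto
  qed
  have "compose (carrier G) x (proj m) = x" if m: "m \<in> M" for m
    using proj_simps(4)[OF m] x_ext by (simp add: compose_eq_iff)
  then show "proj ` M \<subseteq> idem_class G x" using proj_simps by (auto simp: idem_class_iff simp del: End_simps)
qed

lemma killing_pow:
  assumes z: "z \<in> carrier (End_monoid G)" "\<And>m. m \<in> M \<Longrightarrow> z m = \<one>" and xz: "x (z b) = b [^] (j::nat)"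
  shows "x ((z ^^ i) b) = b [^] (j ^ i)" "(z ^^ i) b \<in> carrier G"
proof (induction i)
  have zh: "z \<in> hom G G" using z by simp
  case (Suc i)
  have "(z ^^ Suc i) b = z (x ((z ^^ i) b))" using killing_M[OF zh z(2) Suc(2)] by simp
  also have "\<dots> = z b [^] (j ^ i)" using hom_simps_self(4)[OF zh b] Suc(1) by simp
  finally have e: "(z ^^ Suc i) b = z b [^] (j ^ i)" .
  have zb: "z b \<in> carrier G" by (rule hom_closedI[OF zh b])
  show "(z ^^ Suc i) b \<in> carrier G" unfolding e using zb by simp
  show "x ((z ^^ Suc i) b) = b [^] (j ^ Suc i)"
    unfolding e using zb x.hom_nat_pow[OF zb, of "j ^ i"] xz by (simp add: nat_pow_pow)
qed (use xb in auto)

text \<open>Iterating \<open>z\<close> multiplies the exponent of \<open>b\<close> modulo \<open>M\<close>. If \<open>q\<close> divides \<open>j\<close>, then \<open>j ^ v\<close> is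
  a multiple of \<open>n\<close>, so the \<open>v\<close>-th iterate sends \<open>b\<close> into \<open>M\<close>; the value has order dividing \<open>n\<close>,
  so it is trivial.\<close>

lemma killing_pow_zero_iff:
  assumes z: "z \<in> carrier (End_monoid G)" "\<And>m. m \<in> M \<Longrightarrow> z m = \<one>" and xz: "x (z b) = b [^] (j::nat)"
  shows "z [^]\<^bsub>End_monoid G\<^esub> v = End_zero G \<longleftrightarrow> q dvd j"
proof -
  interpret E: monoid "End_monoid G" by (rule monoid_End)
  have zh: "z \<in> hom G G" using z by simp
  have zvE: "z [^]\<^bsub>End_monoid G\<^esub> v \<in> carrier (End_monoid G)" using z(1) by (rule E.nat_pow_closed)
  have z0E: "End_zero G \<in> carrier (End_monoid G)" by (auto simp: End_zero_def intro!: homI)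
  have zv: "(z [^]\<^bsub>End_monoid G\<^esub> v) g = (z ^^ v) g" if "g \<in> carrier G" for g using End_pow[OF z(1) that] .
  show ?thesis
  proof
    assume "z [^]\<^bsub>End_monoid G\<^esub> v = End_zero G"
    then have "(z ^^ v) b = \<one>" using zv[OF b] by (simp add: End_zero_def)
    then have "b [^] (j ^ v) = \<one>" using killing_pow(1)[OF z xz, of v] by simp
    then have "n dvd j ^ v" unfolding b_pow_one_iff .
    moreover have "q dvd n" unfolding n_def using v by (intro dvd_power) auto
    ultimately have "q dvd j ^ v" using dvd_trans by blast
    then show "q dvd j" using q prime_dvd_power by blast
  next
    assume "q dvd j"
    then have nj: "n dvd j ^ v" unfolding n_def by (rule dvd_power_same)
    obtain v' where v': "v = Suc v'" using v by (cases v) auto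
    show "z [^]\<^bsub>End_monoid G\<^esub> v = End_zero G"
    proof (rule End_eqI[OF zvE z0E])
      fix m assume m: "m \<in> M"
      have "(z ^^ i) \<one> = \<one>" for i using hom_simps_self(1)[OF zh] by (induction i) auto
      moreover have "(z ^^ Suc v') m = (z ^^ v') (z m)" by (simp only: funpow_Suc_right comp_def)
      ultimately show "(z [^]\<^bsub>End_monoid G\<^esub> v) m = End_zero G m"
        using m z(2)[OF m] zv[of m] by (simp only: v' End_zero_def restrict_apply M_closed if_True)
    next
      have zvn: "(z ^^ v) b [^] n = \<one>"
      proof -
        have "(z ^^ i) b [^] n = \<one>" for i
        proof (induction i)
          case (Suc i)
          have "(z ^^ Suc i) b [^] n = z ((z ^^ i) b [^] n)"
            using hom_nat_pow[OF zh killing_pow(2)[OF z xz, of i] group_axioms group_axioms] by simp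
          then show ?case using Suc hom_simps_self(1)[OF zh] by simp
        qed (simp add: b_pow_n)
        then show ?thesis .
      qed
      have "x ((z ^^ v) b) = \<one>" using killing_pow(1)[OF z xz, of v] nj by (simp add: b_pow_one_iff)
      moreover have "(z ^^ v) b \<in> carrier G" using killing_pow(2)[OF z xz] by blast
      ultimately have "(z ^^ v) b \<in> M" using M_I by blast
      then have "(z ^^ v) b = \<one>" using M_torsion[of "(z ^^ v) b"] zvn by blast
      then show "(z [^]\<^bsub>End_monoid G\<^esub> v) b = End_zero G b" by (simp add: zv End_zero_def del: E.nat_pow_Suc)
    qed
  qed
qed

end

section \<open>From the endomorphism monoid to the group\<close>

text \<open>The conditions on the endomorphism monoid, translated to the semidirect product: \<open>kill\<close>
  expresses that the endomorphisms other than automorphisms lie in the sets \<open>K(y)\<close>, \<open>card_cnj\<close>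
  gives the number of idempotents, and \<open>bq\<close> comes from the description of the endomorphisms whose
  \<open>v\<close>-th power is zero.\<close>

locale schmidt_criterion = cyclic_split +
  fixes p u :: nat
  assumes p: "prime p"
    and order_u: "\<And>k. [p ^ k = 1] (mod q) \<Longrightarrow> u dvd k"
    and M_nontrivial: "M \<noteq> {\<one>}"
    and kill: "\<And>f m. f \<in> hom G G \<Longrightarrow> f b = \<one> \<Longrightarrow> m \<in> M \<Longrightarrow> f m = \<one>"
    and card_cnj: "card (cnj ` M) = p ^ u"
    and bq: "\<And>m. m \<in> M \<Longrightarrow> b [^] q \<otimes> m = m \<otimes> b [^] q"
    and D_prime: "\<not> p dvd card (D_set G x)"
    and sylow_V: "\<And>P. sylow_subgroup p P (V_group G x) \<Longrightarrow> elementary_abelian p ((V_group G x)\<lparr>carrier := P\<rparr>)"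
begin

text \<open>Conjugation by \<open>c\<close> fixes \<open>b\<close>, so it belongs to \<open>D(x)\<close>, and it has order a power of \<open>p\<close>.\<close>

lemma C_p_element_central:
  assumes c: "c \<in> C" "c [^] (p ^ k) = \<one>" and g: "g \<in> carrier G"
  shows "c \<otimes> g = g \<otimes> c"
proof -
  have cM: "c \<in> M" "c \<otimes> b = b \<otimes> c" using c by (auto simp: C_def)
  have cG: "c \<in> carrier G" using cM by simp
  have "inn c b = b" using cG by (simp add: inn_def cM(2)) (simp add: word_simps)
  then have "inn c \<in> D_set G x" using inn_V[OF cM(1)] by (simp add: D_iff)
  then have "inn c g = g"
    by (rule D_p_element_trivial[OF p D_prime _ _ g, where k = k]) (simp add: inn_pow cG c)
  then have "conjugate c g \<otimes> c = g \<otimes> c" using g by (simp add: inn_def)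
  then show ?thesis using g cG by (simp add: word_simps)
qed

text \<open>The Frattini argument: for a Sylow \<open>p\<close>-subgroup \<open>S\<close> of \<open>M\<close>, the conjugate of \<open>S\<close> by \<open>b\<close> is
  also conjugate to \<open>S\<close> under some \<open>m\<close> in \<open>M\<close>, so \<open>w = m\<inverse> b\<close> normalizes \<open>S\<close>. A power of \<open>w\<close> is a
  conjugate of \<open>b\<close> under \<open>M\<close>, and conjugating \<open>S\<close> back accordingly gives a Sylow subgroup
  normalized by \<open>b\<close>.\<close>

lemma invariant_sylow_subgroup:
  "\<exists>S a r. subgroup S G \<and> S \<subseteq> M \<and> card S = p ^ a \<and> card M = p ^ a * r \<and> \<not> p dvd r
     \<and> (\<forall>s \<in> S. conjugate b s \<in> S)"
proof -
  let ?M = "G\<lparr>carrier := M\<rparr>"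
  interpret MG: group ?M by (rule subgroup_imp_group[OF subgroup_M])
  have M0: "card M \<noteq> 0" using M.finite_imp_card_positive[OF fin] by simp
  define a where "a = multiplicity p (card M)"
  have nu: "\<not> is_unit p" using p not_prime_unit by blast
  obtain r where r: "card M = p ^ a * r" "\<not> p dvd r"
    unfolding a_def by (rule multiplicity_decompose'[OF M0 nu])
  have "order ?M = p ^ a * r" using r by (simp add: order_def)
  then obtain S where S: "subgroup S ?M" "card S = p ^ a"
    using sylow_thm[OF p MG.group_axioms, of a r] finM by auto
  have SG: "subgroup S G" using incl_subgroup[OF subgroup_M S(1)] .
  have SM: "S \<subseteq> M" using subgroup.subset[OF S(1)] by simp
  interpret S: subgroup S G by (rule SG)
  define T where "T = conjugate b ` S"
  have TM: "T \<subseteq> M" unfolding T_def using conj_M[OF b] SM by blast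
  have "subgroup T G" unfolding T_def by (rule conjugate_iso(1)[OF SG b])
  then have T: "subgroup T ?M" using subgroup_incl[OF _ subgroup_M TM] by blast
  have cT: "card T = p ^ a" unfolding T_def using conjugate_iso(3)[OF SG b] S(2) by simp
  have "order ?M div card S = r" using r S(2) prime_gt_0_nat[OF p] by (simp add: order_def)
  then obtain m where m: "m \<in> M" "\<forall>t \<in> T. inv\<^bsub>?M\<^esub> m \<otimes> t \<otimes> m \<in> S"
    using MG.p_subgroup_in_conjugate[OF _ p S(1) T cT] finM r(2) by auto
  define w where "w = inv m \<otimes> b"
  have wG: "w \<in> carrier G" using m by (simp add: w_def)
  have wS: "conjugate w s \<in> S" if "s \<in> S" for s
  proof -
    have "inv m \<otimes> (conjugate b s) \<otimes> m \<in> S" using m that by (auto simp: T_def m_inv_consistent[OF subgroup_M])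
    moreover have "conjugate w s = inv m \<otimes> (conjugate b s) \<otimes> m" using m that by (simp add: w_def word_simps)
    ultimately show ?thesis by simp
  qed
  have "x w = b [^] (1::nat)" using m by (simp add: w_def xb)
  moreover have "\<not> q dvd 1" using prime_gt_1_nat[OF q] by simp
  ultimately obtain e m' where e: "m' \<in> M" "w [^] (e::nat) = cnj m'" using power_conjugate_to_b[OF wG] by blast
  have pwS: "conjugate (w [^] (i::nat)) s \<in> S" if "s \<in> S" for s i
    by (rule conjugate_pow_closed[OF wG S.subset wS that])
  have mG: "inv m' \<in> carrier G" using e(1) by simp
  define S' where "S' = conjugate (inv m') ` S"
  have S'M: "S' \<subseteq> M" unfolding S'_def using conj_M[OF mG] SM by blast
  have "conjugate b s \<in> S'" if "s \<in> S'" for s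
  proof -
    obtain t where t: "t \<in> S" "s = conjugate (inv m') t" using \<open>s \<in> S'\<close> unfolding S'_def by blast
    have "conjugate (cnj m') t \<in> S" using pwS[OF t(1), of e] by (simp only: e(2))
    moreover have "conjugate b s = conjugate (inv m') (conjugate (cnj m') t)"
      using t e(1) by (simp add: cnj_def word_simps)
    ultimately show ?thesis unfolding S'_def by blast
  qed
  moreover have "subgroup S' G" "card S' = p ^ a"
    unfolding S'_def using conjugate_iso(1,3)[OF SG mG] S(2) by simp_all
  ultimately show ?thesis using S'M r by blast
qed

text \<open>The commutator subgroup \<open>[M, b]\<close>.\<close>

definition N where "N = generate G ((\<lambda>m. cnj m \<otimes> inv b) ` M)"

lemma N_gen_sub: "(\<lambda>m. cnj m \<otimes> inv b) ` M \<subseteq> M"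
proof -
  have "cnj m \<otimes> inv b \<in> M" if "m \<in> M" for m using commutator_M[OF that] by (simp add: cnj_def)
  then show ?thesis by blast
qed

lemma subgroup_N: "subgroup N G"
  unfolding N_def by (rule generate_is_subgroup) (use N_gen_sub M_sub in blast)

sublocale N: subgroup N G by (rule subgroup_N)

lemma N_sub_M: "N \<subseteq> M" unfolding N_def by (rule generate_subgroup_incl[OF N_gen_sub subgroup_M])

lemma commutator_N: "m \<in> M \<Longrightarrow> cnj m \<otimes> inv b \<in> N"
  unfolding N_def by (rule generate.incl) blast

lemma N_conj_closed_if:
  assumes g: "g \<in> carrier G" and gen: "\<And>m. m \<in> M \<Longrightarrow> conjugate g (cnj m \<otimes> inv b) \<in> N" and y: "y \<in> N"
  shows "conjugate g y \<in> N"
  using y unfolding N_def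
proof (induction y rule: generate.induct)
  case one then show ?case using g N.one_closed by (simp flip: N_def)
next
  case (incl h) then show ?case using gen by (auto simp flip: N_def)
next
  case (inv h)
  then obtain m where m: "m \<in> M" "h = cnj m \<otimes> inv b" by blast
  have "inv (conjugate g h) \<in> N" using gen m by (auto intro: N.m_inv_closed)
  moreover have "inv (conjugate g h) = conjugate g (inv h)" using g m by (simp add: word_simps)
  ultimately show ?case by (simp flip: N_def)
next
  case (eng h1 h2)
  then have h: "h1 \<in> carrier G" "h2 \<in> carrier G" using N.mem_carrier by (simp_all add: N_def)
  have "(conjugate g h1) \<otimes> (conjugate g h2) \<in> N" using eng N.m_closed unfolding N_def by blast
  moreover have "(conjugate g h1) \<otimes> (conjugate g h2) = conjugate g (h1 \<otimes> h2)" using g h by (simp add: word_simps)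
  ultimately show ?case by (simp flip: N_def)
qed

text \<open>Writing \<open>[a, b]\<close> for \<open>a b a\<inverse> b\<inverse>\<close>, the identities behind the proof are
  \<open>m [a, b] m\<inverse> = [m a, b] [m, b]\<inverse>\<close> and \<open>b [a, b] b\<inverse> = [b a b\<inverse>, b]\<close>.\<close>

lemma N_normal:
  assumes g: "g \<in> carrier G" and y: "y \<in> N" shows "conjugate g y \<in> N"
proof -
  have by_M: "conjugate m y \<in> N" if m: "m \<in> M" and y: "y \<in> N" for m y
  proof (rule N_conj_closed_if[OF _ _ y])
    fix a assume a: "a \<in> M"
    have "(cnj (m \<otimes> a) \<otimes> inv b) \<otimes> inv (cnj m \<otimes> inv b) \<in> N" using a m commutator_N by simp
    moreover have "(cnj (m \<otimes> a) \<otimes> inv b) \<otimes> inv (cnj m \<otimes> inv b) = conjugate m (cnj a \<otimes> inv b)"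
      using a m by (simp add: cnj_def word_simps)
    ultimately show "conjugate m (cnj a \<otimes> inv b) \<in> N" by simp
  qed (use m in simp)
  have by_b: "conjugate b y \<in> N" if y: "y \<in> N" for y
  proof (rule N_conj_closed_if[OF _ _ y])
    fix a assume a: "a \<in> M"
    have "cnj (conjugate b a) \<otimes> inv b \<in> N" by (rule commutator_N[OF conj_M[OF b a]])
    moreover have "cnj (conjugate b a) \<otimes> inv b = conjugate b (cnj a \<otimes> inv b)"
      using a by (simp add: cnj_def word_simps)
    ultimately show "conjugate b (cnj a \<otimes> inv b) \<in> N" by simp
  qed simp
  have by_pow: "conjugate (b [^] (i::nat)) y \<in> N" if y: "y \<in> N" for y i
    by (rule conjugate_pow_closed[OF b N.subset by_b y])
  obtain m i where m: "m \<in> M" "g = m \<otimes> b [^] (i::nat)" using decomp[OF g] by blast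
  have "conjugate m (b [^] i \<otimes> y \<otimes> inv (b [^] i)) \<in> N" by (rule by_M[OF m(1) by_pow[OF y]])
  moreover have "conjugate m (b [^] i \<otimes> y \<otimes> inv (b [^] i)) = conjugate g y" using m y by (simp add: word_simps)
  ultimately show ?thesis by simp
qed

text \<open>Conjugation by \<open>b\<close> permutes the coset \<open>N m\<close>, whose size is prime to \<open>q\<close>. A fixed point is an
  element of \<open>C\<close> in this coset.\<close>

lemma M_eq_NC:
  assumes m: "m \<in> M" shows "\<exists>y \<in> N. \<exists>c \<in> C. m = y \<otimes> c"
proof -
  define X where "X = (\<lambda>y. y \<otimes> m) ` N"
  have XM: "X \<subseteq> M" using N_sub_M m by (auto simp: X_def)
  have "[card X = card {g \<in> X. conjugate b g = g}] (mod q)"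
  proof (rule cyclic_fixed_points[OF q _ _ n_def])
    show "finite X" using finite_subset[OF XM finM] .
    show "(conjugate b ^^ n) g = g" if "g \<in> X" for g using conjugate_funpow[of b g n] that XM M_sub b_pow_n by auto
    show "conjugate b g \<in> X" if gX: "g \<in> X" for g
    proof -
      obtain y where y: "y \<in> N" "g = y \<otimes> m" using gX by (auto simp: X_def)
      have "(conjugate b y) \<otimes> inv (cnj m \<otimes> inv b) \<in> N"
        using N_normal[OF b y(1)] commutator_N[OF m] by simp
      moreover have "conjugate b g = ((conjugate b y) \<otimes> inv (cnj m \<otimes> inv b)) \<otimes> m"
        using y m by (simp add: cnj_def word_simps)
      ultimately show ?thesis unfolding X_def by blast
    qed
  qed
  moreover have "card X = card N" unfolding X_def using m by (intro card_image) (auto simp: inj_on_def)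
  moreover have "\<not> q dvd card N" using card_subgroup_dvd[OF subgroup_N subgroup_M N_sub_M] q_not_dvd_M dvd_trans by blast
  ultimately have "card {g \<in> X. conjugate b g = g} \<noteq> 0" by (metis cong_0_iff)
  then obtain g where g: "g \<in> X" "conjugate b g = g" by (metis (mono_tags, lifting) card.empty Collect_empty_eq)
  have gM: "g \<in> M" using g XM by blast
  have "conjugate b g \<otimes> b = b \<otimes> g" using gM by (simp add: word_simps)
  then have "g \<in> C" using gM by (simp add: C_def g(2))
  obtain y where y: "y \<in> N" "g = y \<otimes> m" using g by (auto simp: X_def)
  have "m = inv y \<otimes> g" using y m by (simp add: word_simps)
  then show ?thesis using y(1) \<open>g \<in> C\<close> by blast
qed

text \<open>As \<open>N\<close> is normal, \<open>M = N C\<close>, and \<open>C\<close> commutes with \<open>b\<close>, every homomorphism on \<open>C\<close> that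
  vanishes on \<open>N \<inter> C\<close> extends to \<open>G\<close> by killing \<open>N\<close> and \<open>b\<close>.\<close>

lemma extend_from_C:
  assumes W: "W \<in> hom (G\<lparr>carrier := C\<rparr>) (G\<lparr>carrier := C\<rparr>)" and WN: "\<And>c. c \<in> C \<Longrightarrow> c \<in> N \<Longrightarrow> W c = \<one>"
  shows "\<exists>E \<in> hom G G. E b = \<one> \<and> (\<forall>c \<in> C. E c = W c)"
proof -
  interpret C: subgroup C G by (rule subgroup_C)
  have WC: "W c \<in> C" if "c \<in> C" for c using hom_closedI[OF W] that by simp
  have Wm: "W (c \<otimes> d) = W c \<otimes> W d" if "c \<in> C" "d \<in> C" for c d using hom_multD[OF W] that by simp
  define R where "R g h \<longleftrightarrow> (\<exists>y \<in> N. \<exists>c \<in> C. \<exists>i::nat. g = y \<otimes> c \<otimes> b [^] i \<and> h = W c)" for g h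
  have "\<exists>f \<in> hom G G. \<forall>g \<in> carrier G. \<forall>h \<in> carrier G. R g h \<longleftrightarrow> f g = h"
  proof (rule hom_from_relation[OF group_axioms group_axioms])
    fix g assume g: "g \<in> carrier G"
    obtain m i where m: "m \<in> M" "g = m \<otimes> b [^] (i::nat)" using decomp[OF g] by blast
    obtain y c where y: "y \<in> N" "c \<in> C" "m = y \<otimes> c" using M_eq_NC[OF m(1)] by blast
    have "R g (W c)" unfolding R_def using y m by blast
    then show "\<exists>h\<in>carrier G. R g h" using WC[OF y(2)] C_closed by blast
  next
    fix g g' h h' assume "R g h" "R g' h'"
    then obtain y c i y' c' j where y: "y \<in> N" "c \<in> C" "g = y \<otimes> c \<otimes> b [^] (i::nat)" "h = W c"
      "y' \<in> N" "c' \<in> C" "g' = y' \<otimes> c' \<otimes> b [^] (j::nat)" "h' = W c'" unfolding R_def by blast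
    define k where "k = c \<otimes> b [^] i"
    have kG: "k \<in> carrier G" using y by (simp add: k_def C_closed)
    have e: "b [^] i \<otimes> c' = c' \<otimes> b [^] i"
      by (rule commute_pow) (use y C_comm[OF y(6)] C_closed in auto)
    have yG: "y \<in> carrier G" "y' \<in> carrier G" "c \<in> carrier G" "c' \<in> carrier G" using y by (simp_all add: C_closed)
    have "g \<otimes> g' = (y \<otimes> (conjugate k y')) \<otimes> (k \<otimes> c') \<otimes> b [^] j"
      using kG yG by (simp add: y word_simps k_def)
    also have "k \<otimes> c' = c \<otimes> (b [^] i \<otimes> c')" using yG by (simp add: k_def m_assoc)
    also have "\<dots> = (c \<otimes> c') \<otimes> b [^] i" using yG by (simp add: e m_assoc)
    finally have "g \<otimes> g' = (y \<otimes> (conjugate k y')) \<otimes> (c \<otimes> c') \<otimes> b [^] (i + j)"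
      using yG kG by (simp add: m_assoc nat_pow_mult)
    moreover have "y \<otimes> (conjugate k y') \<in> N" using y N_normal[OF kG y(5)] by simp
    moreover have "c \<otimes> c' \<in> C" using y by simp
    moreover have "h \<otimes> h' = W (c \<otimes> c')" using y Wm by simp
    ultimately show "R (g \<otimes> g') (h \<otimes> h')" unfolding R_def by blast
  next
    fix h assume "R \<one> h"
    then obtain y c i where y: "y \<in> N" "c \<in> C" "\<one> = y \<otimes> c \<otimes> b [^] (i::nat)" "h = W c" unfolding R_def by blast
    have yM: "y \<in> M" "c \<in> M" using y N_sub_M C_sub by auto
    have "x (y \<otimes> c \<otimes> b [^] i) = b [^] i" using yM x_pow[of i] by simp
    then have "b [^] i = \<one>" by (simp flip: y(3))
    then have "y \<otimes> c = y \<otimes> c \<otimes> b [^] i" using yM by simp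
    also have "\<dots> = \<one>" by (rule y(3)[symmetric])
    finally have "y \<otimes> c = \<one>" .
    then have "inv c = y" by (rule inv_equality) (use yM in simp_all)
    then have "inv (inv c) \<in> N" using y(1) N.m_inv_closed by metis
    then have "c \<in> N" using yM by simp
    then show "h = \<one>" using WN y by simp
  qed
  then obtain E where E: "E \<in> hom G G" "\<And>g h. g \<in> carrier G \<Longrightarrow> h \<in> carrier G \<Longrightarrow> R g h \<longleftrightarrow> E g = h" by blast
  have "W \<one> = \<one>" using WN C.one_closed N.one_closed by simp
  then have "R b \<one>" unfolding R_def
    using N.one_closed C.one_closed by (intro bexI[of _ \<one>] exI[of _ "1::nat"]) auto
  then have "E b = \<one>" using E(2) by simp
  moreover have "E c = W c" if c: "c \<in> C" for c
  proof -
    have "R c (W c)" unfolding R_def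
      using N.one_closed c C_closed by (intro bexI[of _ \<one>] bexI[of _ c] exI[of _ "0::nat"]) auto
    then show ?thesis using E(2) c WC C_closed by simp
  qed
  ultimately show ?thesis using E(1) by blast
qed

text \<open>Let \<open>S\<close> be a Sylow \<open>p\<close>-subgroup of \<open>M\<close> normalized by \<open>b\<close> and \<open>Z = S \<inter> C\<close>. As
  \<open>|M : C| = p ^ u\<close> and \<open>Z\<close> is a \<open>p\<close>-subgroup of \<open>C\<close>, comparing orders shows that \<open>S\<close> moves \<open>b\<close> to
  all its conjugates under \<open>M\<close>, that \<open>N \<subseteq> S\<close>, and that \<open>Z\<close> is a Sylow subgroup of \<open>C\<close>. It is
  central, so there is an endomorphism \<open>W\<close> of \<open>C\<close> with kernel \<open>Z\<close>. Extended to \<open>G\<close> it kills \<open>b\<close>,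
  so it kills \<open>M\<close>; hence \<open>C = Z\<close>.\<close>

lemma M_p_group: "(\<exists>s. card M = p ^ s) \<and> (\<forall>c \<in> C. \<forall>g \<in> carrier G. c \<otimes> g = g \<otimes> c)"
proof -
  obtain S a r where S: "subgroup S G" "S \<subseteq> M" "card S = p ^ a" "card M = p ^ a * r" "\<not> p dvd r"
    "\<And>s. s \<in> S \<Longrightarrow> conjugate b s \<in> S" using invariant_sylow_subgroup by blast
  interpret S: subgroup S G by (rule S(1))
  interpret C: subgroup C G by (rule subgroup_C)
  define Z where "Z = S \<inter> C"
  have sZ: "subgroup Z G" unfolding Z_def by (rule subgroups_Inter_pair[OF S(1) subgroup_C])
  have cS: "p ^ a = card (cnj ` S) * card Z" using card_conjugates[OF S(1,2)] S(3) by (simp add: Z_def)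
  then obtain t where t: "card Z = p ^ t" using divides_primepow_nat[OF p] by (metis dvd_triv_right)
  obtain w where w: "card (cnj ` S) = p ^ w" using cS divides_primepow_nat[OF p] by (metis dvd_triv_left)
  have p1: "p > 1" using prime_gt_1_nat[OF p] .
  have wt: "w + t = a" using cS w t p1 by (simp flip: power_add)
  have sub: "cnj ` S \<subseteq> cnj ` M" using S(2) by blast
  have MC: "p ^ a * r = p ^ u * card C" using card_M card_cnj S(4) by simp
  \<comment> \<open>The inequalities \<open>u + t \<le> a\<close> and \<open>w \<le> u\<close>, together with \<open>w + t = a\<close>, give \<open>w = u\<close>.\<close>
  have "p ^ t dvd card C" using card_subgroup_dvd[OF sZ subgroup_C] t by (simp add: Z_def)
  then have "p ^ (u + t) dvd p ^ a * r" unfolding MC power_add by simp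
  moreover have "coprime (p ^ (u + t)) r" using prime_imp_coprime[OF p S(5)] by simp
  ultimately have "p ^ (u + t) dvd p ^ a" by (simp add: coprime_dvd_mult_left_iff)
  then have "u + t \<le> a" using p1 by (simp add: power_dvd_imp_le)
  moreover have "p ^ w \<le> p ^ u" using card_mono[OF _ sub] finM card_cnj w by simp
  then have "w \<le> u" using p1 by simp
  ultimately have wu: "w = u" using wt by simp
  have cnjS: "cnj ` S = cnj ` M" by (rule card_subset_eq) (use finM sub card_cnj w wu in auto)
  have "p ^ u * (p ^ t * r) = p ^ u * card C" using MC wt wu by (simp flip: power_add mult.assoc)
  then have cardC: "card C = p ^ t * r" using p1 by simp
  have Zc: "z \<otimes> g = g \<otimes> z" if "z \<in> Z" "g \<in> carrier G" for z g
    by (rule C_p_element_central[where k = t]) (use that pow_card_subgroup[OF sZ] t in \<open>auto simp: Z_def\<close>)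
  have NS: "N \<subseteq> S" unfolding N_def
  proof (rule generate_subgroup_incl[OF _ S(1)])
    have "cnj m \<otimes> inv b \<in> S" if "m \<in> M" for m
    proof -
      obtain s where s: "s \<in> S" "cnj m = cnj s" using cnjS \<open>m \<in> M\<close> by blast
      have "s \<otimes> (conjugate b (inv s)) \<in> S" using s S(6)[of "inv s"] by simp
      then show ?thesis using s by (simp add: cnj_def m_assoc)
    qed
    then show "(\<lambda>m. cnj m \<otimes> inv b) ` M \<subseteq> S" by blast
  qed
  let ?C = "G\<lparr>carrier := C\<rparr>"
  interpret CG: group ?C by (rule subgroup_imp_group[OF subgroup_C])
  have "\<exists>W\<in>hom ?C ?C. \<forall>c\<in>carrier ?C. W c = \<one>\<^bsub>?C\<^esub> \<longleftrightarrow> c \<in> Z"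
  proof (rule CG.central_coprime_complement_hom)
    show "finite (carrier ?C)" using finite_subset[OF C.subset fin] by simp
    show "subgroup Z ?C" by (rule subgroup_incl[OF sZ subgroup_C]) (simp add: Z_def)
    show "z \<otimes>\<^bsub>?C\<^esub> g = g \<otimes>\<^bsub>?C\<^esub> z" if "z \<in> Z" "g \<in> carrier ?C" for z g using Zc that by simp
    have "order ?C div card Z = r" using cardC t p1 by (simp add: order_def)
    then show "coprime (card Z) (order ?C div card Z)" using prime_imp_coprime[OF p S(5)] t by simp
  qed
  then obtain W where W: "W \<in> hom ?C ?C" "\<And>c. c \<in> C \<Longrightarrow> W c = \<one> \<longleftrightarrow> c \<in> Z" by auto
  have "W \<one> = \<one>" using W(2)[of \<one>] subgroup.one_closed[OF sZ] by simp
  then obtain E where E: "E \<in> hom G G" "E b = \<one>" "\<And>c. c \<in> C \<Longrightarrow> E c = W c"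
    using extend_from_C[OF W(1)] W(2) NS unfolding Z_def by blast
  have "c \<in> Z" if c: "c \<in> C" for c
  proof -
    have "E c = W c" by (rule E(3)[OF c])
    moreover have "E c = \<one>" by (rule kill[OF E(1,2)]) (use c C_sub in blast)
    ultimately show ?thesis using W(2)[OF c] by simp
  qed
  then have CZ: "C = Z" by (auto simp: Z_def)
  then have "p ^ t = p ^ t * r" using cardC t by simp
  then have "r = 1" using p1 by simp
  then show ?thesis using S(4) CZ Zc by auto
qed

lemma C_central: "c \<in> C \<Longrightarrow> g \<in> carrier G \<Longrightarrow> c \<otimes> g = g \<otimes> c"
  using M_p_group by blast

text \<open>Otherwise a nontrivial endomorphism of \<open>G\<close> kills the subgroup, in particular \<open>b\<close>; but then
  it kills \<open>M\<close> and thus everything.\<close>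

lemma no_proper_subgroup_with_b_and_commutators:
  assumes L: "subgroup L G" "L \<noteq> carrier G" "b \<in> L"
    and comm: "\<And>a c. a \<in> carrier G \<Longrightarrow> c \<in> carrier G \<Longrightarrow> commutator a c \<in> L"
  shows False
proof -
  obtain f where f: "f \<in> hom G G" "\<forall>a\<in>L. f a = \<one>" "\<exists>a\<in>carrier G. f a \<noteq> \<one>"
    using hom_onto_prime_cyclic[OF fin L(1,2) comm] by blast
  then obtain g where g: "g \<in> carrier G" "f g \<noteq> \<one>" by blast
  obtain m i where m: "m \<in> M" "g = m \<otimes> b [^] (i::nat)" using decomp[OF g(1)] by blast
  have fb: "f b = \<one>" using f L by blast
  have "f g = f m \<otimes> f (b [^] i)" using m hom_multD[OF f(1)] by simp
  also have "f (b [^] i) = \<one>" using hom_simps_self(4)[OF f(1) b] fb by simp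
  also have "f m = \<one>" by (rule kill[OF f(1) fb m(1)])
  finally show False using g by simp
qed

text \<open>The subgroup \<open>L = N\<langle>b\<rangle>\<close> contains all commutators, because \<open>G = C L\<close> with \<open>C\<close> central; so it
  is the whole group.\<close>

lemma N_eq_M: "N = M"
proof -
  define L where "L = {g. \<exists>y \<in> N. \<exists>i::nat. g = y \<otimes> b [^] i}"
  have LG: "L \<subseteq> carrier G" by (auto simp: L_def)
  have sL: "subgroup L G" unfolding L_def by (rule subgroup_times_powers[OF fin subgroup_N b N_normal[OF b]])
  interpret L: subgroup L G by (rule sL)
  have bL: "b \<in> L" unfolding L_def using N.one_closed by (intro CollectI bexI[of _ \<one>] exI[of _ "1::nat"]) auto
  have NL: "y \<in> L" if "y \<in> N" for y
    unfolding L_def using that by (intro CollectI bexI[of _ y] exI[of _ "0::nat"]) auto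
  have dec: "\<exists>l \<in> L. \<exists>c \<in> C. g = c \<otimes> l" if g: "g \<in> carrier G" for g
  proof -
    obtain m i where m: "m \<in> M" "g = m \<otimes> b [^] (i::nat)" using decomp[OF g] by blast
    obtain y c where y: "y \<in> N" "c \<in> C" "m = y \<otimes> c" using M_eq_NC[OF m(1)] by blast
    have "y \<otimes> c = c \<otimes> y" using C_central[OF y(2), of y] y(1) by simp
    then have "g = c \<otimes> (y \<otimes> b [^] i)" using m y C_closed by (simp add: m_assoc)
    moreover have "y \<otimes> b [^] i \<in> L" using y unfolding L_def by blast
    ultimately show ?thesis using y(2) by blast
  qed
  have "L = carrier G"
  proof (rule ccontr)
    assume "L \<noteq> carrier G"
    then show False
    proof (rule no_proper_subgroup_with_b_and_commutators[OF sL _ bL])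
      fix g h assume g: "g \<in> carrier G" "h \<in> carrier G"
      obtain l c where l: "l \<in> L" "c \<in> C" "g = c \<otimes> l" using dec[OF g(1)] by blast
      obtain k d where k: "k \<in> L" "d \<in> C" "h = d \<otimes> k" using dec[OF g(2)] by blast
      have G: "l \<in> carrier G" "c \<in> carrier G" "k \<in> carrier G" "d \<in> carrier G" using l k C_closed by auto
      have "commutator g h = commutator l k"
        unfolding l(3) k(3) by (rule commutator_mult_central) (use G C_central l(2) k(2) in auto)
      then show "commutator g h \<in> L" using l(1) k(1) by simp
    qed
  qed
  have "m \<in> N" if m: "m \<in> M" for m
  proof -
    have "m \<in> L" using m \<open>L = carrier G\<close> by simp
    then obtain y i where y: "y \<in> N" "m = y \<otimes> b [^] (i::nat)" unfolding L_def by blast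
    have yM: "y \<in> M" using y(1) N_sub_M by blast
    have "x m = b [^] i" using y yM x_pow[of i] by simp
    then have "b [^] i = \<one>" using m by simp
    then show ?thesis using y by simp
  qed
  then show ?thesis using N_sub_M by blast
qed

text \<open>The inner automorphisms by \<open>M\<close> form a group of order \<open>|M : C| = p ^ u\<close>, a Sylow \<open>p\<close>-subgroup
  of \<open>V(x)\<close>. So they commute.\<close>

lemma M_commutators_central:
  assumes a: "a \<in> M" "c \<in> M" and g: "g \<in> carrier G"
  shows "(commutator a c) \<otimes> g = g \<otimes> (commutator a c)"
proof -
  let ?V = "V_group G x"
  define J where "J = inn ` M"
  have "card M = card J * card C" unfolding J_def by (rule card_inn[OF C_central])
  moreover have C0: "card C > 0" using subgroup.finite_imp_card_positive[OF subgroup_C fin] .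
  ultimately have cJ: "card J = p ^ u" using card_M card_cnj by simp
  have sJ: "subgroup J ?V" unfolding J_def by (rule subgroup_inn)
  have "sylow_subgroup p J ?V"
    using sJ cJ multiplicity_V[OF p D_prime card_cnj] by (simp add: sylow_subgroup_def)
  then have "comm_group (?V\<lparr>carrier := J\<rparr>)" using sylow_V by (simp add: elementary_abelian_def)
  then have "inn a \<otimes>\<^bsub>?V\<lparr>carrier := J\<rparr>\<^esub> inn c = inn c \<otimes>\<^bsub>?V\<lparr>carrier := J\<rparr>\<^esub> inn a"
    by (intro comm_monoid.m_comm[OF comm_group.axioms(1)]) (use a in \<open>auto simp: J_def\<close>)
  then have e: "inn (a \<otimes> c) = inn (c \<otimes> a)" using a inn_mult by simp
  define h where "h = inv (c \<otimes> a) \<otimes> g \<otimes> (c \<otimes> a)"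
  have hG: "h \<in> carrier G" using a g by (simp add: h_def)
  have "inn (a \<otimes> c) h = inn (c \<otimes> a) h" by (simp only: e)
  also have "inn (c \<otimes> a) h = g" using a g by (simp add: inn_def h_def word_simps)
  finally have "inn (a \<otimes> c) h \<otimes> (commutator a c) = g \<otimes> (commutator a c)" by simp
  moreover have "inn (a \<otimes> c) h \<otimes> (commutator a c) = (commutator a c) \<otimes> g"
    using a g by (simp add: inn_def h_def word_simps)
  ultimately show ?thesis by simp
qed

text \<open>The subgroup \<open>B\<close> moves \<open>b\<close> to \<open>p ^ k\<close> conjugates, where \<open>p ^ k\<close> is congruent to \<open>1\<close> modulo
  \<open>q\<close>. So \<open>u\<close> divides \<open>k\<close>, while \<open>k \<le> u\<close>.\<close>

lemma invariant_subgroup_dichotomy: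
  assumes B: "subgroup B G" "B \<subseteq> M" and inv: "\<And>a. a \<in> B \<Longrightarrow> conjugate b a \<in> B"
  shows "B \<subseteq> C \<or> cnj ` B = cnj ` M"
proof -
  interpret B: subgroup B G by fact
  have p1: "p > 1" using prime_gt_1_nat[OF p] .
  obtain s where s: "card M = p ^ s" using M_p_group by blast
  have "card (cnj ` B) dvd card B" using card_conjugates[OF B] by simp
  also have "card B dvd p ^ s" using card_subgroup_dvd[OF B(1) subgroup_M B(2)] s by simp
  finally obtain k where k: "card (cnj ` B) = p ^ k" using divides_primepow_nat[OF p] by blast
  have "u dvd k" using card_conjugates_mod_q[OF B inv bq] k by (intro order_u) simp
  have sub: "cnj ` B \<subseteq> cnj ` M" using B(2) by blast
  have b_in: "b \<in> cnj ` B" using image_eqI[of b cnj \<one> B] B.one_closed by (simp add: cnj_def)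
  show ?thesis
  proof (cases "k = 0")
    case True
    then obtain c where "cnj ` B = {c}" using k by (auto simp: card_1_singleton_iff)
    then have "cnj ` B = {b}" using b_in by auto
    then have "cnj a = b" if "a \<in> B" for a using that by auto
    then show ?thesis using cnj_eq_b B(2) by blast
  next
    case False
    then have "u \<le> k" using \<open>u dvd k\<close> by (simp add: dvd_imp_le)
    then have "card (cnj ` M) \<le> card (cnj ` B)" using k card_cnj p1 by simp
    then show ?thesis using card_seteq[OF _ sub] finM by simp
  qed
qed

lemma derived_eq_M: "derived G (carrier G) = M"
proof
  show "derived G (carrier G) \<subseteq> M"
    unfolding derived_def
  proof (rule generate_subgroup_incl[OF _ subgroup_M])
    have "commutator g h \<in> M" if g: "g \<in> carrier G" "h \<in> carrier G" for g h
    proof (rule M_I)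
      obtain i :: nat where i: "x g = b [^] i" using img[OF g(1)] by blast
      obtain j :: nat where j: "x h = b [^] j" using img[OF g(2)] by blast
      have "b [^] i \<otimes> b [^] j = b [^] j \<otimes> b [^] i" by (simp add: nat_pow_mult add.commute)
      then have "b [^] i \<otimes> b [^] j \<otimes> inv (b [^] i) \<otimes> inv (b [^] j) = b [^] j \<otimes> b [^] i \<otimes> inv (b [^] i) \<otimes> inv (b [^] j)"
        by (simp only:)
      also have "\<dots> = \<one>" by (simp add: word_simps)
      finally show "x (commutator g h) = \<one>" using g i j by simp
    qed (use g in simp)
    then show "derived_set G (carrier G) \<subseteq> M" by blast
  qed
  have "(\<lambda>m. cnj m \<otimes> inv b) ` M \<subseteq> derived_set G (carrier G)" unfolding cnj_def using M_sub b by blast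
  then have "N \<subseteq> derived G (carrier G)" unfolding N_def derived_def by (rule mono_generate)
  then show "M \<subseteq> derived G (carrier G)" by (simp add: N_eq_M)
qed

text \<open>The nontrivial subgroup \<open>M = [M, b]\<close> survives in every term of the lower central series.\<close>

lemma not_nilpotent: "\<not> nilpotent_group G"
proof
  assume nil: "nilpotent_group G"
  have "M \<subseteq> {\<one>}"
  proof (rule nilpotent_no_self_commuting_subset[OF nil M_sub])
    have "(\<lambda>m. cnj m \<otimes> inv b) ` M \<subseteq> {commutator a h | a h. a \<in> M \<and> h \<in> carrier G}"
      unfolding cnj_def using b by blast
    then have "N \<subseteq> generate G {commutator a h | a h. a \<in> M \<and> h \<in> carrier G}"
      unfolding N_def by (rule mono_generate)
    then show "M \<subseteq> generate G {commutator a h | a h. a \<in> M \<and> h \<in> carrier G}" by (simp add: N_eq_M)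
  qed
  then show False using M_nontrivial M.one_closed by auto
qed

text \<open>If \<open>L \<inter> M\<close> moved \<open>b\<close> to all of its conjugates, then \<open>L\<close> would contain all commutators with
  \<open>b\<close>, hence \<open>[M, b] = M\<close>. So \<open>L \<inter> M \<subseteq> C\<close> and \<open>L\<close> is abelian.\<close>

lemma subgroup_containing_b_nilpotent:
  assumes L: "subgroup L G" "L \<noteq> carrier G" "b \<in> L"
  shows "nilpotent_group (G\<lparr>carrier := L\<rparr>)"
proof -
  interpret L: subgroup L G by (rule L(1))
  define B where "B = L \<inter> M"
  have sB: "subgroup B G" unfolding B_def by (rule subgroups_Inter_pair[OF L(1) subgroup_M])
  have bL: "b [^] (i::nat) \<in> L" for i using L(3) by (induction i) auto
  have "conjugate b a \<in> B" if "a \<in> B" for a using that L(3) conj_M[OF b, of a] by (simp add: B_def)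
  then have dich: "B \<subseteq> C \<or> cnj ` B = cnj ` M" using invariant_subgroup_dichotomy[OF sB] by (auto simp: B_def)
  have "cnj ` B \<noteq> cnj ` M"
  proof
    assume e: "cnj ` B = cnj ` M"
    have "cnj m \<otimes> inv b \<in> L" if m: "m \<in> M" for m
    proof -
      obtain a where "a \<in> B" "cnj m = cnj a" using e m by blast
      then show ?thesis using L(3) by (simp add: B_def cnj_def)
    qed
    then have "(\<lambda>m. cnj m \<otimes> inv b) ` M \<subseteq> L" by blast
    then have "N \<subseteq> L" unfolding N_def by (rule generate_subgroup_incl[OF _ L(1)])
    then have MsubL: "M \<subseteq> L" by (simp add: N_eq_M)
    have "g \<in> L" if g: "g \<in> carrier G" for g
    proof -
      obtain m i where m: "m \<in> M" "g = m \<otimes> b [^] (i::nat)" using decomp[OF g] by blast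
      then show ?thesis using MsubL bL by auto
    qed
    then show False using L(2) L.subset by blast
  qed
  then have BC: "B \<subseteq> C" using dich by blast
  have dec: "\<exists>c \<in> C. \<exists>i::nat. g = c \<otimes> b [^] i" if g: "g \<in> L" for g
  proof -
    obtain m i where m: "m \<in> M" "g = m \<otimes> b [^] (i::nat)" using decomp[of g] g by auto
    have "g \<otimes> inv (b [^] i) \<in> L" using g bL by simp
    moreover have "g \<otimes> inv (b [^] i) = m" using m by (simp add: word_simps)
    ultimately have "m \<in> B" using m(1) by (simp add: B_def)
    then show ?thesis using BC m by blast
  qed
  show ?thesis
  proof (rule nilpotent_subgroupI[OF L(1)])
    fix g h k assume g: "g \<in> L" "h \<in> L" "k \<in> L"
    obtain c i where c: "c \<in> C" "g = c \<otimes> b [^] (i::nat)" using dec[OF g(1)] by blast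
    obtain d j where d: "d \<in> C" "h = d \<otimes> b [^] (j::nat)" using dec[OF g(2)] by blast
    have "commutator g h = b [^] i \<otimes> b [^] j \<otimes> inv (b [^] i) \<otimes> inv (b [^] j)"
      unfolding c(2) d(2) by (rule commutator_mult_central) (use C_central c d C_closed in auto)
    also have "b [^] i \<otimes> b [^] j = b [^] j \<otimes> b [^] i" by (simp add: nat_pow_mult add.commute)
    also have "b [^] j \<otimes> b [^] i \<otimes> inv (b [^] i) \<otimes> inv (b [^] j) = \<one>" by (simp add: word_simps)
    finally have e: "commutator g h = \<one>" .
    show "(commutator g h) \<otimes> k = k \<otimes> (commutator g h)"
      unfolding e using g(3) by simp
  qed
qed

text \<open>If the image of \<open>L\<close> under \<open>x\<close> is not contained in \<open>\<langle>b ^ q\<rangle>\<close>, then \<open>L\<close> contains a conjugate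
  of \<open>b\<close>, and one may assume that it contains \<open>b\<close>. Otherwise \<open>L\<close> lies in \<open>\<langle>b ^ q\<rangle> M\<close>, where
  \<open>b ^ q\<close> and the commutators of \<open>M\<close> are central.\<close>

lemma proper_subgroup_nilpotent:
  assumes L: "subgroup L G" "L \<noteq> carrier G"
  shows "nilpotent_group (G\<lparr>carrier := L\<rparr>)"
proof -
  interpret L: subgroup L G by (rule L(1))
  show ?thesis
  proof (cases "\<exists>g \<in> L. \<exists>j::nat. x g = b [^] j \<and> \<not> q dvd j")
    case True
    then obtain g and j :: nat where g: "g \<in> L" "x g = b [^] j" "\<not> q dvd j" by blast
    then obtain e m where m: "m \<in> M" "g [^] (e::nat) = cnj m" using power_conjugate_to_b[of g j] by auto
    have "g [^] e \<in> L" using g(1) by (induction e) auto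
    then have cL: "cnj m \<in> L" by (simp add: m)
    have mG: "inv m \<in> carrier G" using m by simp
    define K where "K = conjugate (inv m) ` L"
    have sK: "subgroup K G" unfolding K_def by (rule conjugate_iso(1)[OF L(1) mG])
    have "K \<noteq> carrier G"
    proof
      assume "K = carrier G"
      then have "card L = card (carrier G)" using conjugate_iso(3)[OF L(1) mG] by (simp add: K_def)
      then show False using card_subset_eq[OF fin L.subset] L(2) by blast
    qed
    moreover have "conjugate (inv m) (cnj m) = b" using m by (simp add: cnj_def word_simps)
    then have "b \<in> K" unfolding K_def using cL by (metis imageI)
    ultimately have nK: "nilpotent_group (G\<lparr>carrier := K\<rparr>)" by (intro subgroup_containing_b_nilpotent[OF sK])
    have "conjugate (inv m) \<in> iso (G\<lparr>carrier := L\<rparr>) (G\<lparr>carrier := K\<rparr>)"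
      unfolding K_def by (rule conjugate_iso(2)[OF L(1) mG])
    then show ?thesis
      using nilpotent_group_iso[OF group.iso_set_sym[OF subgroup_imp_group[OF L(1)]]
          subgroup_imp_group[OF sK] subgroup_imp_group[OF L(1)] nK] by blast
  next
    case False
    have bqc: "b [^] (q * t) \<otimes> g = g \<otimes> b [^] (q * t)" if g: "g \<in> carrier G" for g and t :: nat
    proof -
      obtain m i where m: "m \<in> M" "g = m \<otimes> b [^] (i::nat)" using decomp[OF g] by blast
      have 1: "m \<otimes> b [^] q = b [^] q \<otimes> m" using bq[OF m(1)] by simp
      have "b [^] i \<otimes> b [^] q = b [^] q \<otimes> b [^] i" by (simp add: nat_pow_mult add.commute)
      then have "(m \<otimes> b [^] i) \<otimes> b [^] q = b [^] q \<otimes> (m \<otimes> b [^] i)"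
        by (intro commute_mult) (use m 1 in auto)
      then have "b [^] q \<otimes> g = g \<otimes> b [^] q" unfolding m(2) by (rule sym)
      then have "(b [^] q) [^] t \<otimes> g = g \<otimes> (b [^] q) [^] t" by (rule commute_pow[OF nat_pow_closed[OF b] g])
      then show ?thesis by (simp add: nat_pow_pow)
    qed
    have dec: "\<exists>m \<in> M. \<exists>t::nat. g = b [^] (q * t) \<otimes> m" if g: "g \<in> L" for g
    proof -
      obtain m i where m: "m \<in> M" "g = m \<otimes> b [^] (i::nat)" "x g = b [^] i" using decomp[of g] g by auto
      have "q dvd i" using False g m(3) by blast
      then obtain t where "i = q * t" by (rule dvdE)
      then have "g = b [^] (q * t) \<otimes> m" using bqc[of m t] m by simp
      then show ?thesis using m(1) by blast
    qed
    show ?thesis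
    proof (rule nilpotent_subgroupI[OF L(1)])
      fix g h k assume g: "g \<in> L" "h \<in> L" "k \<in> L"
      obtain a i where a: "a \<in> M" "g = b [^] (q * i) \<otimes> a" using dec[OF g(1)] by blast
      obtain c j where c: "c \<in> M" "h = b [^] (q * j) \<otimes> c" using dec[OF g(2)] by blast
      have e: "commutator g h = commutator a c"
        unfolding a(2) c(2) by (rule commutator_mult_central) (use bqc a(1) c(1) in auto)
      show "(commutator g h) \<otimes> k = k \<otimes> (commutator g h)"
        unfolding e by (rule M_commutators_central) (use a c g in auto)
    qed
  qed
qed

lemma schmidt: "schmidt_group_params G p q v"
proof -
  have ne: "p \<noteq> q"
  proof
    assume "p = q"
    obtain s where s: "card M = p ^ s" using M_p_group by blast
    have "s = 0"
    proof (rule ccontr)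
      assume "s \<noteq> 0"
      then have "q dvd card M" unfolding s \<open>p = q\<close> by simp
      then show False using q_not_dvd_M by blast
    qed
    then have "card M = 1" using s by simp
    then obtain c where "M = {c}" by (auto simp: card_1_singleton_iff)
    then show False using M_nontrivial M.one_closed by (metis singletonD)
  qed
  have gen: "generate G {b} = {b [^] (i::nat) | i. i \<in> UNIV}"
    using generate_pow_on_finite_carrier[OF fin b] by simp
  have "M <#> generate G {b} = carrier G"
  proof
    show "M <#> generate G {b} \<subseteq> carrier G" by (auto simp: set_mult_def gen)
    show "carrier G \<subseteq> M <#> generate G {b}"
    proof
      fix g assume "g \<in> carrier G"
      then obtain m i where "m \<in> M" "g = m \<otimes> b [^] (i::nat)" using decomp by blast
      then show "g \<in> M <#> generate G {b}" unfolding set_mult_def gen by blast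
    qed
  qed
  moreover have "M \<inter> generate G {b} = {\<one>}"
  proof -
    have "b [^] i = \<one>" if "b [^] (i::nat) \<in> M" for i using x_M[OF that] x_pow[of i] by simp
    then have "M \<inter> generate G {b} \<subseteq> {\<one>}" by (auto simp: gen)
    moreover have "\<one> \<in> generate G {b}" by (rule generate.one)
    ultimately show ?thesis using M.one_closed by blast
  qed
  moreover have "M \<lhd> G" unfolding M_def by (rule x.normal_kernel)
  moreover have "subgroup (generate G {b}) G" by (rule generate_is_subgroup) simp
  ultimately have "internal_semidirect G M (generate G {b})" by (simp add: internal_semidirect_def)
  moreover have "card (generate G {b}) = q ^ v" using generate_pow_card[OF b] ord_b by simp
  moreover have "schmidt_group G"
    unfolding schmidt_group_def using group_axioms fin not_nilpotent proper_subgroup_nilpotent by blast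
  moreover have "\<exists>s. card M = p ^ s" using M_p_group by blast
  ultimately show ?thesis unfolding schmidt_group_params_def derived_eq_M using p q v ne b by blast
qed

end

section \<open>Endomorphisms of Schmidt groups\<close>

text \<open>A Schmidt group with \<open>G' = M\<close>. The assumptions on \<open>u\<close> say that it is the order of \<open>p\<close> modulo
  \<open>q\<close>.\<close>

locale schmidt_split = cyclic_split +
  fixes p u s :: nat
  assumes p: "prime p" and p_ne_q: "p \<noteq> q"
    and u: "u > 0" and order_u: "\<And>k. [p ^ k = 1] (mod q) \<Longrightarrow> u dvd k" and pu: "[p ^ u = 1] (mod q)"
    and not_nilpotent: "\<not> nilpotent_group G"
    and proper_nilpotent: "\<And>H. subgroup H G \<Longrightarrow> H \<noteq> carrier G \<Longrightarrow> nilpotent_group (G\<lparr>carrier := H\<rparr>)"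
    and card_M_p: "card M = p ^ s"
    and derived_M: "derived G (carrier G) = M"
begin

text \<open>The subgroup \<open>R\<langle>c\<rangle>\<close> is proper, hence nilpotent, and \<open>R\<close> has order prime to that of \<open>c\<close>.\<close>

lemma invariant_subgroup_commutes:
  assumes R: "subgroup R G" "R \<subseteq> M" and c: "c = b [^] (t::nat)"
    and inv: "\<And>a. a \<in> R \<Longrightarrow> conjugate c a \<in> R"
    and proper: "\<exists>g \<in> carrier G. \<forall>r \<in> R. \<forall>i::nat. g \<noteq> r \<otimes> c [^] i" and a: "a \<in> R"
  shows "a \<otimes> c = c \<otimes> a"
proof -
  interpret R: subgroup R G by (rule R(1))
  have cG: "c \<in> carrier G" by (simp add: c)
  define K where "K = {g. \<exists>r \<in> R. \<exists>i::nat. g = r \<otimes> c [^] i}"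
  have sK: "subgroup K G" unfolding K_def by (rule subgroup_times_powers[OF fin R(1) cG inv])
  have "K \<noteq> carrier G" using proper unfolding K_def by blast
  then have nil: "nilpotent_group (G\<lparr>carrier := K\<rparr>)" by (rule proper_nilpotent[OF sK])
  have RK: "r \<in> K" if "r \<in> R" for r
    unfolding K_def using that by (intro CollectI bexI[of _ r] exI[of _ "0::nat"]) auto
  have cK: "c \<in> K" unfolding K_def
    using cG R.one_closed by (intro CollectI bexI[of _ \<one>] exI[of _ "1::nat"]) auto
  have "c [^] n = (b [^] n) [^] t" by (simp add: c nat_pow_pow mult.commute)
  then have cn: "c [^] n = \<one>" by (simp add: b_pow_n)
  show ?thesis
  proof (rule nilpotent_subgroup_coprime_commute[OF sK nil _ cK cn _ _ a])
    show "R \<subseteq> K" using RK by blast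
    show "r = \<one>" if "r \<in> R" "r [^] n = \<one>" for r using M_torsion[of r] that R(2) by blast
    show "commutator r c \<in> R" if r: "r \<in> R" for r
    proof -
      have "r \<otimes> conjugate c (inv r) \<in> R" using r inv[of "inv r"] by simp
      then show ?thesis using r cG by (simp add: m_assoc)
    qed
  qed
qed

lemma proper_invariant_in_C:
  assumes R: "subgroup R G" "R \<subseteq> M" "R \<noteq> M" and inv: "\<And>a. a \<in> R \<Longrightarrow> conjugate b a \<in> R"
  shows "R \<subseteq> C"
proof
  interpret R: subgroup R G by (rule R(1))
  fix a assume a: "a \<in> R"
  obtain m where m: "m \<in> M" "m \<notin> R" using R by blast
  have "m \<noteq> r \<otimes> b [^] (i::nat)" if r: "r \<in> R" for r i
  proof
    assume e: "m = r \<otimes> b [^] i"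
    have rM: "r \<in> M" using r R(2) by blast
    have "x m = b [^] i" using e rM x_pow[of i] by simp
    then have "b [^] i = \<one>" using m by simp
    then show False using e r m rM by simp
  qed
  then have "a \<otimes> b = b \<otimes> a"
    by (intro invariant_subgroup_commutes[OF R(1,2), where t = 1]) (use inv a m in \<open>auto intro!: bexI[of _ m]\<close>)
  then show "a \<in> C" using a R(2) by (auto simp: C_def)
qed

text \<open>The subgroup \<open>M\<langle>b ^ q\<rangle>\<close> is proper.\<close>

lemma bq:
  assumes "m \<in> M" shows "b [^] q \<otimes> m = m \<otimes> b [^] q"
proof -
  have "b \<noteq> r \<otimes> (b [^] q) [^] (i::nat)" if r: "r \<in> M" for r i
  proof
    assume e: "b = r \<otimes> (b [^] q) [^] i"
    have "x b = b [^] (q * i)" using r x_pow[of "q * i"] by (subst e) (simp add: nat_pow_pow)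
    then have "b [^] (1::nat) = b [^] (q * i)" by (simp add: xb)
    then have "[1 = q * i] (mod n)" unfolding b_pow_eq_iff .
    then have "[1 = q * i] (mod q)" by (rule cong_dvd_modulus_nat) (use v in \<open>simp add: n_def\<close>)
    then have "q dvd 1" by (simp add: cong_def mod_eq_0_iff_dvd)
    then show False using prime_gt_1_nat[OF q] by simp
  qed
  then have "m \<otimes> b [^] q = b [^] q \<otimes> m"
    by (intro invariant_subgroup_commutes[OF subgroup_M _ refl _ _ assms]) (use conj_M in \<open>auto intro!: bexI[of _ b]\<close>)
  then show ?thesis by simp
qed

text \<open>If \<open>f b\<close> commutes with \<open>f(M)\<close>, it is central in the image of \<open>f\<close>, so the commutators of the
  image are already commutators of \<open>f(M)\<close>; and \<open>f(M) = f(G')\<close> is generated by them.\<close>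

lemma M_image_perfect:
  assumes f: "f \<in> hom G G" and com: "\<And>m. m \<in> M \<Longrightarrow> f m \<otimes> f b = f b \<otimes> f m"
  shows "f ` M \<subseteq> generate G {f a \<otimes> f c \<otimes> inv (f a) \<otimes> inv (f c) | a c. a \<in> M \<and> c \<in> M}"
proof -
  interpret f: group_hom G G f by unfold_locales (rule f)
  define K where "K = f ` carrier G"
  have sK: "subgroup K G" unfolding K_def by (rule f.img_is_subgroup)
  interpret KG: group "G\<lparr>carrier := K\<rparr>" by (rule subgroup_imp_group[OF sK])
  have cen: "f b [^] (i::nat) \<otimes> k = k \<otimes> f b [^] i" if k: "k \<in> K" for i k
  proof -
    obtain g where g: "g \<in> carrier G" "k = f g" using k by (auto simp: K_def)
    obtain m j where m: "m \<in> M" "g = m \<otimes> b [^] (j::nat)" using decomp[OF g(1)] by blast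
    have fg: "k = f m \<otimes> f b [^] j" using g m f.hom_nat_pow[of b j] by simp
    have "f b [^] j \<otimes> f b = f b \<otimes> f b [^] j" by (rule commute_pow) simp_all
    then have "k \<otimes> f b = f b \<otimes> k" unfolding fg using com[OF m(1)] m(1) by (intro commute_mult) auto
    then show ?thesis using g(1) by (intro commute_pow) (auto simp: g(2))
  qed
  have "f ` derived_set G (carrier G) \<subseteq> {f a \<otimes> f c \<otimes> inv (f a) \<otimes> inv (f c) | a c. a \<in> M \<and> c \<in> M}"
  proof
    fix z assume "z \<in> f ` derived_set G (carrier G)"
    then obtain g h where g: "g \<in> carrier G" "h \<in> carrier G" "z = f (commutator g h)" by blast
    obtain a i where a: "a \<in> M" "g = a \<otimes> b [^] (i::nat)" using decomp[OF g(1)] by blast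
    obtain c j where c: "c \<in> M" "h = c \<otimes> b [^] (j::nat)" using decomp[OF g(2)] by blast
    have inK: "f m \<in> K" if "m \<in> carrier G" for m using that by (simp add: K_def)
    have bK: "f b [^] (i::nat) \<in> K" for i using inK[of "b [^] i"] f.hom_nat_pow[of b i] by simp
    have fg: "f g = f b [^] i \<otimes> f a" using a f.hom_nat_pow[of b i] cen[OF inK[of a]] by simp
    have fh: "f h = f b [^] j \<otimes> f c" using c f.hom_nat_pow[of b j] cen[OF inK[of c]] by simp
    have "z = f g \<otimes> f h \<otimes> inv (f g) \<otimes> inv (f h)" using g by simp
    also have "\<dots> = f a \<otimes> f c \<otimes> inv (f a) \<otimes> inv (f c)"
      unfolding fg fh
      using KG.commutator_mult_central[of "f b [^] i" "f b [^] j" "f a" "f c"] a c inK bK cen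
        subgroup.m_closed[OF sK]
      by (simp add: m_inv_consistent[OF sK])
    finally show "z \<in> {f a \<otimes> f c \<otimes> inv (f a) \<otimes> inv (f c) | a c. a \<in> M \<and> c \<in> M}" using a c by blast
  qed
  then have "generate G (f ` derived_set G (carrier G)) \<subseteq> generate G {f a \<otimes> f c \<otimes> inv (f a) \<otimes> inv (f c) | a c. a \<in> M \<and> c \<in> M}"
    by (rule mono_generate)
  moreover have "derived_set G (carrier G) \<subseteq> carrier G" by auto
  then have "generate G (f ` derived_set G (carrier G)) = f ` derived G (carrier G)"
    unfolding derived_def by (rule f.generate_img)
  ultimately show ?thesis by (simp add: derived_M)
qed

text \<open>The image of \<open>f\<close> is a proper subgroup, hence nilpotent. So \<open>f b\<close> commutes with \<open>f(M)\<close>, whose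
  order is prime to \<open>q\<close>; then \<open>f(M)\<close> is a perfect subgroup of a nilpotent group.\<close>

lemma noninjective_kills_M:
  assumes f: "f \<in> hom G G" and ninj: "\<not> inj_on f (carrier G)" and m: "m \<in> M"
  shows "f m = \<one>"
proof -
  interpret f: group_hom G G f by unfold_locales (rule f)
  define K where "K = f ` carrier G"
  have sK: "subgroup K G" unfolding K_def by (rule f.img_is_subgroup)
  interpret K: subgroup K G by (rule sK)
  interpret KG: group "G\<lparr>carrier := K\<rparr>" by (rule subgroup_imp_group[OF sK])
  have "K \<noteq> carrier G"
  proof
    assume "K = carrier G"
    then have "card (f ` carrier G) = card (carrier G)" unfolding K_def by simp
    then show False using ninj eq_card_imp_inj_on[OF fin] by blast
  qed
  then have nil: "nilpotent_group (G\<lparr>carrier := K\<rparr>)" by (rule proper_nilpotent[OF sK])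
  have inK: "f g \<in> K" if "g \<in> carrier G" for g using that by (simp add: K_def)
  have fbn: "f b [^] n = \<one>" by (rule hom_at_b(2)[OF f])
  have tors: "f a = \<one>" if a: "a \<in> M" "f a [^] n = \<one>" for a
  proof (rule coprime_torsion[OF _ a(2) _ coprime_n_M])
    have "f a [^] card M = f (a [^] card M)" by (rule f.hom_nat_pow[symmetric]) (use a in simp)
    then show "f a [^] card M = \<one>" using pow_card_subgroup[OF subgroup_M a(1)] by simp
  qed (use a in simp)
  have com: "f a \<otimes> f b = f b \<otimes> f a" if a: "a \<in> M" for a
  proof (rule nilpotent_subgroup_coprime_commute[OF sK nil _ inK[OF b] fbn])
    show "f ` M \<subseteq> K" using inK by auto
    show "r = \<one>" if "r \<in> f ` M" "r [^] n = \<one>" for r using tors that by auto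
    show "commutator r (f b) \<in> f ` M" if r: "r \<in> f ` M" for r
    proof -
      obtain c where c: "c \<in> M" "r = f c" using r by blast
      have "commutator r (f b) = f (commutator c b)" using c by simp
      then show ?thesis using commutator_M[OF c(1)] by blast
    qed
  qed (use a in blast)
  have "f ` M \<subseteq> {\<one>}"
  proof (rule nilpotent_perfect_trivial[OF sK nil])
    have "{f a \<otimes> f c \<otimes> inv (f a) \<otimes> inv (f c) | a c. a \<in> M \<and> c \<in> M}
      = {commutator a c | a c. a \<in> f ` M \<and> c \<in> f ` M}" by blast
    then show "f ` M \<subseteq> generate G {commutator a c | a c. a \<in> f ` M \<and> c \<in> f ` M}"
      using M_image_perfect[OF f com] by simp
  qed (use inK in auto)
  then show ?thesis using m by auto
qed

lemma M_nilpotent: "nilpotent_group (G\<lparr>carrier := M\<rparr>)"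
proof (rule proper_nilpotent[OF subgroup_M])
  have "b \<notin> M" using x_M[of b] xb b_ne_one by auto
  then show "M \<noteq> carrier G" using b by blast
qed

text \<open>Otherwise \<open>M\<close> is perfect by \<open>M_image_perfect\<close>, applied to the identity; as \<open>M\<close> is nilpotent,
  it is trivial, and \<open>G\<close> is abelian.\<close>

lemma C_ne_M: "C \<noteq> M"
proof
  assume CM: "C = M"
  have com: "m \<otimes> b = b \<otimes> m" if "m \<in> M" for m using that CM by (auto simp: C_def)
  have "(\<lambda>g. g) ` M \<subseteq> generate G {commutator a c | a c. a \<in> M \<and> c \<in> M}"
    by (rule M_image_perfect) (use com in \<open>auto intro: homI\<close>)
  then have M1: "M \<subseteq> {\<one>}" by (intro nilpotent_perfect_trivial[OF subgroup_M M_nilpotent]) auto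
  have "nilpotent_group G"
  proof (rule nilpotent_if_commutators_central)
    fix g h k assume g: "g \<in> carrier G" "h \<in> carrier G" "k \<in> carrier G"
    have "commutator g h \<in> derived G (carrier G)"
      unfolding derived_def by (rule generate.incl) (use g in blast)
    then have "commutator g h = \<one>" using M1 derived_M by blast
    then show "commutator g h \<otimes> k = k \<otimes> (commutator g h)" using g(3) by simp
  qed
  then show False using not_nilpotent by simp
qed

lemma M_ne_one: "M \<noteq> {\<one>}"
proof
  assume e: "M = {\<one>}"
  have "\<one> \<in> C" using subgroup.one_closed[OF subgroup_C] .
  then have "C = M" using C_sub unfolding e by blast
  then show False using C_ne_M by blast
qed

text \<open>The derived subgroup of the nilpotent group \<open>M\<close> is proper, and it is normalized by \<open>b\<close>.\<close>

lemma commutator_in_C: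
  assumes "a \<in> M" "c \<in> M" shows "commutator a c \<in> C"
proof -
  let ?f = "\<lambda>g. conjugate b g"
  interpret f: group_hom G G ?f by unfold_locales (auto intro!: homI simp: word_simps)
  define R where "R = derived G M"
  have RM: "R \<subseteq> M" unfolding R_def derived_def by (rule generate_subgroup_incl[OF _ subgroup_M]) blast
  have "R \<noteq> M"
  proof
    assume "R = M"
    moreover have "derived_set G M = {commutator a c | a c. a \<in> M \<and> c \<in> M}" by blast
    ultimately have "M \<subseteq> {\<one>}"
      by (intro nilpotent_perfect_trivial[OF subgroup_M M_nilpotent]) (auto simp: R_def derived_def)
    then show False using M_ne_one M.one_closed by blast
  qed
  moreover have "?f a \<in> R" if a: "a \<in> R" for a
  proof -
    have "?f ` M \<subseteq> M" using conj_M[OF b] by blast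
    then have "derived G (?f ` M) \<subseteq> R" unfolding R_def by (rule mono_derived) 
    then show ?thesis using f.derived_img[OF M_sub] a by (auto simp: R_def)
  qed
  moreover have "subgroup R G" unfolding R_def by (rule derived_is_subgroup[OF M_sub])
  ultimately have "R \<subseteq> C" using RM by (intro proper_invariant_in_C) auto
  moreover have "commutator a c \<in> R"
    unfolding R_def derived_def by (rule generate.incl) (use assms in blast)
  ultimately show ?thesis by blast
qed

text \<open>This is how \<open>[M, b] = M\<close> is used. If \<open>R\<close> were proper, it would lie in \<open>C\<close>; then \<open>b\<close> would
  commute with all commutators of \<open>M\<close> with \<open>b\<close>, hence with \<open>M\<close>.\<close>

lemma M_if_commutators_fixed:
  assumes R: "subgroup R G" "R \<subseteq> M" and inv: "\<And>a. a \<in> R \<Longrightarrow> conjugate b a \<in> R"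
    and com: "\<And>a. a \<in> M \<Longrightarrow> commutator a b \<in> R"
  shows "R = M"
proof (rule ccontr)
  assume "R \<noteq> M"
  then have "R \<subseteq> C" by (rule proper_invariant_in_C[OF R _ inv])
  then have "commutator a b \<in> C" if "a \<in> M" for a using com[OF that] by blast
  then have z: "(commutator a b) \<otimes> b = b \<otimes> (commutator a b)" if "a \<in> M" for a
    using C_comm that by blast
  have "a \<in> C" if "a \<in> M" for a
    using commutes_if_commutator_commutes[OF that z[OF that]] that unfolding C_def by blast
  then show False using C_ne_M C_sub by blast
qed

text \<open>Let \<open>R\<close> be the centralizer of \<open>C\<close> in \<open>M\<close>. It contains the commutators of \<open>M\<close> with \<open>b\<close>: for
  \<open>a\<close> in \<open>M\<close> and \<open>c\<close> in \<open>C\<close> the conjugate \<open>e = a\<inverse> c a\<close> belongs to \<open>C\<close>, because commutators of \<open>M\<close>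
  do, so it commutes with \<open>b\<close>; this is an instance of the three subgroups lemma.\<close>

lemma C_central:
  assumes c: "c \<in> C" and g: "g \<in> carrier G" shows "c \<otimes> g = g \<otimes> c"
proof -
  define R where "R = {a \<in> M. \<forall>c \<in> C. a \<otimes> c = c \<otimes> a}"
  have "R = M"
  proof (rule M_if_commutators_fixed)
    show "subgroup R G"
    proof (rule finite_subgroupI[OF fin])
      show "R \<subseteq> carrier G" by (auto simp: R_def)
      show "R \<noteq> {}" using M.one_closed C_closed by (auto simp: R_def intro!: exI[of _ \<one>])
      show "a \<otimes> d \<in> R" if ad: "a \<in> R" "d \<in> R" for a d
      proof -
        have "a \<otimes> d \<otimes> c = c \<otimes> (a \<otimes> d)" if "c \<in> C" for c
          by (rule commute_mult) (use ad \<open>c \<in> C\<close> C_closed in \<open>auto simp: R_def\<close>)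
        then show ?thesis using ad by (simp add: R_def)
      qed
    qed
    show "R \<subseteq> M" by (auto simp: R_def)
    show "conjugate b a \<in> R" if a: "a \<in> R" for a
    proof -
      have aM: "a \<in> M" using a by (simp add: R_def)
      have "conjugate b a \<otimes> c = c \<otimes> (conjugate b a)" if c: "c \<in> C" for c
      proof -
        have cb: "b \<otimes> c = c \<otimes> b" "inv b \<otimes> c = c \<otimes> inv b" "a \<otimes> c = c \<otimes> a"
          using C_comm[OF c] commute_inv[of b c] C_closed[OF c] a c by (auto simp: R_def)
        show ?thesis using cb aM C_closed[OF c] by (intro commute_mult) auto
      qed
      then show ?thesis using conj_M[OF b aM] by (simp add: R_def)
    qed
    show "commutator a b \<in> R" if a: "a \<in> M" for a
    proof -
      have "(commutator a b) \<otimes> c = c \<otimes> (commutator a b)" if c: "c \<in> C" for c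
      proof -
        have cG: "c \<in> carrier G" using C_closed[OF c] .
        \<comment> \<open>Conjugating \<open>c\<close> by \<open>a b a\<inverse>\<close> amounts to conjugating \<open>e\<close> by \<open>b\<close>.\<close>
        define e where "e = inv a \<otimes> c \<otimes> a"
        have "inv a \<otimes> c \<otimes> inv (inv a) \<otimes> inv c \<in> C" using commutator_in_C[of "inv a" c] a c C_sub by auto
        then have "(inv a \<otimes> c \<otimes> inv (inv a) \<otimes> inv c) \<otimes> c \<in> C" using c subgroup.m_closed[OF subgroup_C] by blast
        moreover have "(inv a \<otimes> c \<otimes> inv (inv a) \<otimes> inv c) \<otimes> c = e" using a cG by (simp add: e_def word_simps)
        ultimately have eC: "e \<in> C" by simp
        have "(commutator a b) \<otimes> c = conjugate a b \<otimes> (inv b \<otimes> c)" using a cG by (simp add: m_assoc)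
        also have "inv b \<otimes> c = c \<otimes> inv b" using commute_inv[of b c] C_comm[OF c] cG by simp
        also have "conjugate a b \<otimes> (c \<otimes> inv b) = conjugate a (b \<otimes> e) \<otimes> inv b"
          using a cG by (simp add: e_def word_simps)
        also have "b \<otimes> e = e \<otimes> b" using C_comm[OF eC] by simp
        also have "conjugate a (e \<otimes> b) \<otimes> inv b = c \<otimes> (commutator a b)"
          using a cG by (simp add: e_def word_simps)
        finally show ?thesis .
      qed
      then show ?thesis using commutator_M[OF a] by (simp add: R_def)
    qed
  qed
  then have cm: "m \<otimes> c = c \<otimes> m" if "m \<in> M" for m using that c by (auto simp: R_def)
  obtain m i where m: "m \<in> M" "g = m \<otimes> b [^] (i::nat)" using decomp[OF g] by blast
  have "b [^] i \<otimes> c = c \<otimes> b [^] i" by (rule commute_pow) (use C_comm[OF c] C_closed[OF c] in auto)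
  then have "g \<otimes> c = c \<otimes> g" unfolding m(2) by (intro commute_mult) (use m cm C_closed[OF c] in auto)
  then show ?thesis by simp
qed

text \<open>The inner automorphisms by \<open>M\<close>. As \<open>C\<close> is central, this group is a copy of \<open>M / C\<close>, and it
  is also the candidate for the Sylow subgroup of \<open>V(x)\<close>.\<close>

abbreviation J where "J \<equiv> (V_group G x)\<lparr>carrier := inn ` M\<rparr>"

lemma group_J: "group J" by (rule V.subgroup_imp_group[OF subgroup_inn])

lemma J_mult: "a \<in> M \<Longrightarrow> c \<in> M \<Longrightarrow> inn a \<otimes>\<^bsub>J\<^esub> inn c = inn (c \<otimes> a)"
  using inn_mult by simp

lemma J_one: "\<one>\<^bsub>J\<^esub> = inn \<one>"
  by (auto simp: inn_def)

lemma inn_eq: "a \<in> M \<Longrightarrow> c \<in> M \<Longrightarrow> inn a = inn c \<longleftrightarrow> inv a \<otimes> c \<in> C"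
  by (rule inn_eq_iff[OF C_central])

lemma inn_eq_one: "a \<in> M \<Longrightarrow> inn a = inn \<one> \<longleftrightarrow> a \<in> C"
  using inn_eq[of \<one> a] by auto

lemma comm_group_J: "comm_group J"
proof (rule group.group_comm_groupI[OF group_J])
  fix f h assume "f \<in> carrier J" "h \<in> carrier J"
  then obtain a c where a: "a \<in> M" "f = inn a" "c \<in> M" "h = inn c" by auto
  have "inv (c \<otimes> a) \<otimes> (a \<otimes> c) = inv a \<otimes> inv c \<otimes> inv (inv a) \<otimes> inv (inv c)"
    using a by (simp add: word_simps)
  also have "\<dots> \<in> C" by (rule commutator_in_C) (use a in auto)
  finally have "inn (c \<otimes> a) = inn (a \<otimes> c)" using a inn_eq[of "c \<otimes> a" "a \<otimes> c"] by simp
  then show "f \<otimes>\<^bsub>J\<^esub> h = h \<otimes>\<^bsub>J\<^esub> f" using J_mult a by simp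
qed

lemma card_J: "card (inn ` M) = card (cnj ` M)"
proof -
  have "card C > 0" using subgroup.finite_imp_card_positive[OF subgroup_C fin] .
  then show ?thesis using card_inn[OF C_central] card_M by simp
qed

lemma card_J_power: "\<exists>k > 0. card (inn ` M) = p ^ k"
proof -
  have "card (inn ` M) dvd p ^ s" using card_inn[OF C_central] card_M_p by simp
  then obtain k where k: "card (inn ` M) = p ^ k" using divides_primepow_nat[OF p] by blast
  have "k \<noteq> 0"
  proof
    assume "k = 0"
    then have "card C = card M" using card_inn[OF C_central] k by simp
    then have "C = M" using card_subset_eq[OF finM C_sub] by simp
    then show False using C_ne_M by simp
  qed
  then show ?thesis using k by auto
qed

lemma b_qt_central: "m \<in> M \<Longrightarrow> b [^] (q * t) \<otimes> m = m \<otimes> b [^] (q * t)"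
proof -
  assume m: "m \<in> M"
  have "(b [^] q) [^] t \<otimes> m = m \<otimes> (b [^] q) [^] t"
    by (rule commute_pow[OF nat_pow_closed[OF b] _ bq[OF m]]) (use m in simp)
  then show ?thesis by (simp add: nat_pow_pow)
qed

text \<open>Conjugation by \<open>b\<close> on \<open>M / C\<close>.\<close>

definition \<theta> where "\<theta> f = (\<lambda>g \<in> carrier G. b \<otimes> f (inv b \<otimes> g \<otimes> b) \<otimes> inv b)"

lemma theta_inn: "a \<in> M \<Longrightarrow> \<theta> (inn a) = inn (conjugate b a)"
  by (rule extensionalityI[of _ "carrier G"]) (auto simp: \<theta>_def inn_def word_simps)

text \<open>The preimage in \<open>M\<close> of an invariant subgroup is normalized by \<open>b\<close>, so it is \<open>M\<close> or lies in
  \<open>C\<close>.\<close>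

lemma irreducible_J:
  assumes k: "k > 0" "card (inn ` M) = p ^ k"
  shows "irreducible_action J \<theta> p k"
proof (intro irreducible_action.intro irreducible_action_axioms.intro)
  show "comm_group J" by (rule comm_group_J)
  show "\<theta> \<in> hom J J"
  proof (rule homI)
    fix f h assume "f \<in> carrier J" "h \<in> carrier J"
    then obtain a c where a: "a \<in> M" "f = inn a" "c \<in> M" "h = inn c" by auto
    have e: "conjugate b (c \<otimes> a) = (conjugate b c) \<otimes> (conjugate b a)" using a by (simp add: word_simps)
    show "\<theta> (f \<otimes>\<^bsub>J\<^esub> h) = \<theta> f \<otimes>\<^bsub>J\<^esub> \<theta> h"
      unfolding a(2,4) J_mult[OF a(1,3)] using a theta_inn conj_M[OF b] J_mult by (simp only: e M.m_closed)
  next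
    fix f assume "f \<in> carrier J"
    then obtain a where a: "a \<in> M" "f = inn a" by auto
    then show "\<theta> f \<in> carrier J" using theta_inn conj_M[OF b a(1)] by auto
  qed
  show "prime p" "k > 0" "card (carrier J) = p ^ k" using p k by auto
  fix B assume B: "subgroup B J" "\<theta> ` B \<subseteq> B"
  interpret B: subgroup B J by (rule B(1))
  define R where "R = {a \<in> M. inn a \<in> B}"
  have BJ: "B \<subseteq> inn ` M" using B.subset by simp
  have inB: "B = inn ` R" using BJ by (auto simp: R_def)
  have sR: "subgroup R G"
  proof (rule finite_subgroupI[OF fin])
    show "R \<subseteq> carrier G" by (auto simp: R_def)
    have "\<one> \<in> R" using B.one_closed J_one by (simp add: R_def)
    then show "R \<noteq> {}" by blast
    show "a \<otimes> c \<in> R" if "a \<in> R" "c \<in> R" for a c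
      using that B.m_closed[of "inn c" "inn a"] J_mult[of c a] by (simp add: R_def)
  qed
  have Rinv: "conjugate b a \<in> R" if "a \<in> R" for a
    using that theta_inn[of a] B(2) conj_M[OF b, of a] by (auto simp: R_def)
  show "B = {\<one>\<^bsub>J\<^esub>} \<or> B = carrier J"
  proof (cases "R = M")
    case True then show ?thesis using inB by simp
  next
    case False
    then have "R \<subseteq> C" using Rinv by (intro proper_invariant_in_C[OF sR]) (auto simp: R_def)
    then have "inn a = inn \<one>" if "a \<in> R" for a using that inn_eq_one by (auto simp: R_def)
    then have "B \<subseteq> {inn \<one>}" using inB by auto
    then show ?thesis using B.one_closed J_one by auto
  qed
qed

text \<open>Write \<open>|M / C| = p ^ k\<close>. As \<open>p ^ u\<close> is congruent to \<open>1\<close> modulo \<open>q\<close> and \<open>b ^ q\<close> centralizes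
  \<open>M\<close>, the element \<open>b ^ (p ^ u)\<close> acts like \<open>b\<close>, and the bound for irreducible actions gives
  \<open>k \<le> u\<close>. Counting conjugates modulo \<open>q\<close> shows that \<open>u\<close> divides \<open>k\<close>.\<close>

lemma card_cnj: "card (cnj ` M) = p ^ u" and exponent_J: "a \<in> M \<Longrightarrow> inn a [^]\<^bsub>J\<^esub> p = \<one>\<^bsub>J\<^esub>"
proof -
  obtain k where k: "k > 0" "card (inn ` M) = p ^ k" using card_J_power by blast
  interpret J: irreducible_action J \<theta> p k by (rule irreducible_J[OF k])
  show "inn a [^]\<^bsub>J\<^esub> p = \<one>\<^bsub>J\<^esub>" if "a \<in> M" using that by (intro J.exponent_p) simp
  have "card (carrier J) \<le> p ^ u"
  proof (rule J.card_le[OF u])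
    fix f assume "f \<in> carrier J"
    then obtain a where a: "a \<in> M" "f = inn a" by auto
    have it: "(\<theta> ^^ i) (inn a) = inn (conjugate (b [^] i) a)" for i :: nat
    proof -
      have "(conjugate b ^^ i) a \<in> M \<and> (\<theta> ^^ i) (inn a) = inn ((conjugate b ^^ i) a)"
        by (induction i) (use a conj_M[OF b] theta_inn in auto)
      then show ?thesis using conjugate_funpow[OF b, of a i] a by simp
    qed
    have "p ^ u mod q = 1" using pu prime_gt_1_nat[OF q] by (simp add: cong_def)
    then have e: "p ^ u = q * (p ^ u div q) + 1" using mult_div_mod_eq[of q "p ^ u"] by simp
    define t where "t = p ^ u div q"
    have "b [^] (p ^ u) = b [^] (q * t + 1)" using e by (simp add: t_def)
    also have "\<dots> = b \<otimes> b [^] (q * t)" by (simp add: nat_pow_mult[symmetric] commute_pow)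
    finally have bp: "b [^] (p ^ u) = b \<otimes> b [^] (q * t)" .
    have "b [^] (p ^ u) \<otimes> a \<otimes> inv (b [^] (p ^ u)) = b \<otimes> (b [^] (q * t) \<otimes> a) \<otimes> inv (b [^] (q * t)) \<otimes> inv b"
      using a by (simp add: bp word_simps)
    also have "b [^] (q * t) \<otimes> a = a \<otimes> b [^] (q * t)" by (rule b_qt_central[OF a(1)])
    also have "b \<otimes> (a \<otimes> b [^] (q * t)) \<otimes> inv (b [^] (q * t)) \<otimes> inv b = conjugate b a"
      using a by (simp add: word_simps)
    finally show "(\<theta> ^^ (p ^ u)) f = \<theta> f" using it[of "p ^ u"] a theta_inn by simp
  qed
  then have "p ^ k \<le> p ^ u" using k by simp
  then have ku: "k \<le> u" using prime_gt_1_nat[OF p] by simp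
  have "[card (cnj ` M) = 1] (mod q)" by (rule card_conjugates_mod_q[OF subgroup_M _ conj_M[OF b] bq]) auto
  then have "u dvd k" using k card_J by (intro order_u) simp
  then have "u \<le> k" using k by (simp add: dvd_imp_le)
  then show "card (cnj ` M) = p ^ u" using ku k card_J by simp
qed

lemma D_M: assumes "d \<in> D_set G x" "a \<in> M" shows "d a \<in> M"
proof -
  have dV: "d \<in> V_set G x" using assms(1) by (simp add: D_iff)
  show ?thesis by (rule M_I) (use V_props(4,5)[OF dV, of a] assms(2) in auto)
qed

lemma D_hom: assumes "d \<in> D_set G x"
  shows "d \<in> hom G G" "d b = b" "g \<in> carrier G \<Longrightarrow> h \<in> carrier G \<Longrightarrow> d (g \<otimes> h) = d g \<otimes> d h"
    "g \<in> carrier G \<Longrightarrow> d g \<in> carrier G" "g \<in> carrier G \<Longrightarrow> d (inv g) = inv (d g)"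
proof -
  have dV: "d \<in> V_set G x" using assms(1) by (simp add: D_iff)
  show h: "d \<in> hom G G" by (rule V_props(3)[OF dV])
  interpret d: group_hom G G d by unfold_locales (rule h)
  show "d b = b" using assms D_iff by blast
  show "g \<in> carrier G \<Longrightarrow> h \<in> carrier G \<Longrightarrow> d (g \<otimes> h) = d g \<otimes> d h"
    "g \<in> carrier G \<Longrightarrow> d g \<in> carrier G" "g \<in> carrier G \<Longrightarrow> d (inv g) = inv (d g)" by auto
qed

text \<open>If \<open>d a = a c\<close> with \<open>c\<close> in \<open>C\<close>, then \<open>d\<close> fixes the commutator of \<open>a\<close> and \<open>b\<close>.\<close>

lemma D_trivial_mod_C:
  assumes d: "d \<in> D_set G x" and mod_C: "\<And>a. a \<in> M \<Longrightarrow> inv a \<otimes> d a \<in> C" and g: "g \<in> carrier G"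
  shows "d g = g"
proof -
  note dh = D_hom[OF d]
  define R where "R = {a \<in> M. d a = a}"
  have "R = M"
  proof (rule M_if_commutators_fixed)
    show "subgroup R G"
    proof (rule finite_subgroupI[OF fin])
      have "d \<one> = \<one>" by (rule hom_simps_self(1)[OF dh(1)])
      then have "\<one> \<in> R" by (simp add: R_def)
      then show "R \<noteq> {}" by blast
    qed (auto simp: R_def dh)
    show "conjugate b a \<in> R" if "a \<in> R" for a
      using that conj_M[OF b, of a] by (simp add: R_def dh)
    show "commutator a b \<in> R" if a: "a \<in> M" for a
    proof -
      define c where "c = inv a \<otimes> d a"
      have cC: "c \<in> C" unfolding c_def by (rule mod_C[OF a])
      have cG: "c \<in> carrier G" using cC C_closed by simp
      have da: "d a = a \<otimes> c" using a dh(4)[of a] by (simp add: c_def word_simps)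
      have "d (commutator a b) = a \<otimes> (c \<otimes> b) \<otimes> inv c \<otimes> inv a \<otimes> inv b"
        using a cG by (simp add: dh da word_simps)
      also have "c \<otimes> b = b \<otimes> c" by (rule C_comm[OF cC])
      also have "a \<otimes> (b \<otimes> c) \<otimes> inv c \<otimes> inv a \<otimes> inv b = commutator a b"
        using a cG by (simp add: word_simps)
      finally show ?thesis using commutator_M[OF a] by (simp add: R_def)
    qed
  qed (auto simp: R_def)
  then have dm: "d m = m" if "m \<in> M" for m using that by (auto simp: R_def)
  obtain m i where m: "m \<in> M" "g = m \<otimes> b [^] (i::nat)" using decomp[OF g] by blast
  have "d (b [^] i) = b [^] i" using hom_simps_self(4)[OF dh(1) b] dh(2) by simp
  then show ?thesis using m dm dh(3)[of m "b [^] i"] by simp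
qed

lemma cnj_eq_iff_C: "a \<in> M \<Longrightarrow> c \<in> M \<Longrightarrow> cnj c = cnj a \<longleftrightarrow> inv a \<otimes> c \<in> C"
  using cnj_eq_iff[of c a] by (simp add: C_def)

text \<open>An element \<open>d\<close> of order \<open>p\<close> permutes the \<open>p ^ u\<close> conjugates of \<open>b\<close> and fixes \<open>b\<close>, so it
  fixes a further one. Hence the subgroup of those \<open>a\<close> in \<open>M\<close> on which \<open>d\<close> is trivial modulo \<open>C\<close>
  is not contained in \<open>C\<close>; as it is normalized by \<open>b\<close>, it is \<open>M\<close>.\<close>

lemma p_not_dvd_D: "\<not> p dvd card (D_set G x)"
proof
  assume dvd: "p dvd card (D_set G x)"
  let ?V = "V_group G x" and ?D = "(V_group G x)\<lparr>carrier := D_set G x\<rparr>"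
  interpret D: subgroup "D_set G x" ?V by (rule subgroup_D)
  interpret Dg: group ?D by (rule V.subgroup_imp_group[OF subgroup_D])
  have "finite (carrier ?D)" using finite_subset[OF _ finV] D.subset V_carrier by simp
  then obtain d where dD: "d \<in> D_set G x" and d: "d \<noteq> \<one>\<^bsub>?V\<^esub>" "d [^]\<^bsub>?D\<^esub> p = \<one>\<^bsub>?V\<^esub>"
    using Dg.element_of_prime_order[OF _ p] dvd by (auto simp: order_def)
  have dV: "d \<in> V_set G x" using dD by (simp add: D_iff)
  note dh = D_hom[OF dD]
  have "d [^]\<^bsub>?V\<^esub> p = \<one>\<^bsub>?V\<^esub>" using d(2) by (simp flip: V.nat_pow_consistent)
  then have dp: "(d ^^ p) g = g" if "g \<in> carrier G" for g using V_pow[OF dV that, of p] that by simp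
  have dcnj: "d (cnj a) = cnj (d a)" if "a \<in> M" for a using that by (simp add: cnj_def dh)
  have "[card (cnj ` M) = card {w \<in> cnj ` M. d w = w}] (mod p)"
  proof (rule cyclic_fixed_points[OF p, where v = 1 and n = p])
    show "d w \<in> cnj ` M" if "w \<in> cnj ` M" for w using that dcnj D_M[OF dD] by auto
    show "(d ^^ p) w = w" if "w \<in> cnj ` M" for w using that dp by auto
  qed (use finM in auto)
  moreover have "p dvd card (cnj ` M)" unfolding card_cnj using u by simp
  ultimately have pf: "p dvd card {w \<in> cnj ` M. d w = w}" by (simp only: cong_dvd_iff)
  define R where "R = {a \<in> M. d (cnj a) = cnj a}"
  have Riff: "a \<in> R \<longleftrightarrow> a \<in> M \<and> inv a \<otimes> d a \<in> C" for a
  proof (cases "a \<in> M")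
    case True
    then show ?thesis using dcnj[OF True] cnj_eq_iff_C[OF True D_M[OF dD True]] unfolding R_def by simp
  qed (simp add: R_def)
  have "R = M"
  proof (rule ccontr)
    assume ne: "R \<noteq> M"
    have "subgroup R G"
    proof (rule finite_subgroupI[OF fin])
      have d1: "d \<one> = \<one>" by (rule hom_simps_self(1)[OF dh(1)])
      have "\<one> \<in> R" using Riff[of \<one>] d1 subgroup.one_closed[OF subgroup_C] by simp
      then show "R \<noteq> {}" by blast
      fix a c assume ac: "a \<in> R" "c \<in> R"
      then have M: "a \<in> M" "c \<in> M" and z: "inv a \<otimes> d a \<in> C" "inv c \<otimes> d c \<in> C" by (auto simp: Riff)
      have "inv (a \<otimes> c) \<otimes> d (a \<otimes> c) = inv c \<otimes> ((inv a \<otimes> d a) \<otimes> d c)"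
        using M dh by (simp add: word_simps)
      also have "(inv a \<otimes> d a) \<otimes> d c = d c \<otimes> (inv a \<otimes> d a)" by (rule C_central[OF z(1)]) (use M dh in simp)
      also have "inv c \<otimes> (d c \<otimes> (inv a \<otimes> d a)) = (inv c \<otimes> d c) \<otimes> (inv a \<otimes> d a)" using M dh by (simp add: word_simps)
      also have "\<dots> \<in> C" using z subgroup.m_closed[OF subgroup_C] by blast
      finally show "a \<otimes> c \<in> R" using M by (simp add: Riff)
    qed (auto simp: R_def)
    moreover have "conjugate b a \<in> R" if a: "a \<in> R" for a
    proof -
      have aM: "a \<in> M" and z: "inv a \<otimes> d a \<in> C" using a by (auto simp: Riff)
      have "inv (conjugate b a) \<otimes> d (conjugate b a) = conjugate b (inv a \<otimes> d a)"
        using aM by (simp add: dh word_simps)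
      also have "\<dots> = (inv a \<otimes> d a) \<otimes> b \<otimes> inv b" by (simp only: C_comm[OF z])
      also have "\<dots> = inv a \<otimes> d a" using aM dh by (simp add: word_simps)
      finally show ?thesis using aM z conj_M[OF b aM] by (simp add: Riff)
    qed
    ultimately have RC: "R \<subseteq> C" by (intro proper_invariant_in_C[OF _ _ ne]) (auto simp: R_def)
    have "{w \<in> cnj ` M. d w = w} = {b}"
    proof
      show "{w \<in> cnj ` M. d w = w} \<subseteq> {b}"
      proof
        fix w assume "w \<in> {w \<in> cnj ` M. d w = w}"
        then obtain a where a: "a \<in> M" "w = cnj a" "d (cnj a) = cnj a" by blast
        then have "a \<in> R" by (simp add: R_def)
        then have "a \<in> C" using RC by blast
        then show "w \<in> {b}" using cnj_eq_b[OF a(1)] a(2) by simp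
      qed
      have "b = cnj \<one>" by (simp add: cnj_def)
      then show "{b} \<subseteq> {w \<in> cnj ` M. d w = w}" using M.one_closed dh(2) by blast
    qed
    then have "p dvd 1" using pf by simp
    then show False using prime_gt_1_nat[OF p] by simp
  qed
  then have "d g = g" if "g \<in> carrier G" for g
    using D_trivial_mod_C[OF dD _ that] Riff by blast
  then have "d = \<one>\<^bsub>?V\<^esub>"
    using V_props(2)[OF dV] by (intro extensionalityI[of _ "carrier G"]) auto
  then show False using d(1) by blast
qed

text \<open>Let \<open>t\<close> be in \<open>P\<close> and \<open>t b = a b a\<inverse>\<close>. Then \<open>t\<close> followed by the inner automorphism by \<open>a\<inverse>\<close> is
  an element \<open>d\<close> of \<open>D(x)\<close>. Modulo \<open>C\<close> the inner automorphism is trivial on \<open>M\<close>, so \<open>d\<close> and \<open>t\<close>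
  have the same iterates modulo \<open>C\<close>, and \<open>d ^ (p ^ u)\<close> is trivial modulo \<open>C\<close>, hence trivial. As
  \<open>p\<close> does not divide \<open>|D(x)|\<close>, it follows that \<open>d = 1\<close>, and \<open>t\<close> is the inner automorphism by
  \<open>a\<close>.\<close>

lemma sylow_V_eq:
  assumes P: "sylow_subgroup p P (V_group G x)"
  shows "P = inn ` M"
proof -
  let ?V = "V_group G x"
  have sP: "subgroup P ?V" using P by (simp add: sylow_subgroup_def)
  interpret P: subgroup P ?V by (rule sP)
  interpret Pg: group "?V\<lparr>carrier := P\<rparr>" by (rule V.subgroup_imp_group[OF sP])
  have cP: "card P = p ^ u"
    using P multiplicity_V[OF p p_not_dvd_D card_cnj] by (simp add: sylow_subgroup_def)
  have "t \<in> inn ` M" if t: "t \<in> P" for t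
  proof -
    have tV: "t \<in> V_set G x" using t P.subset V_carrier by auto
    have "t [^]\<^bsub>?V\<^esub> (p ^ u) = \<one>\<^bsub>?V\<^esub>" using Pg.pow_order_eq_1[of t] t cP by (simp add: order_def flip: V.nat_pow_consistent)
    then have tp: "(t ^^ (p ^ u)) g = g" if "g \<in> carrier G" for g using V_pow[OF tV that, of "p ^ u"] that by simp
    obtain a where a: "a \<in> M" "t b = cnj a" using V_moves_b[OF tV] by blast
    have tM: "t m \<in> M" if "m \<in> M" for m
      by (rule M_I) (use V_props(4,5)[OF tV, of m] that in auto)
    define d where "d = t \<otimes>\<^bsub>?V\<^esub> inn (inv a)"
    have dV: "d \<in> V_set G x" unfolding d_def using V.m_closed[of t "inn (inv a)"] tV inn_V[of "inv a"] a(1) by simp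
    have d_apply: "d g = inv a \<otimes> t g \<otimes> a" if "g \<in> carrier G" for g
      using that a(1) V_props(4)[OF tV that] by (simp add: d_def compose_def inn_def)
    have "d b = b" using a by (simp add: d_apply cnj_def word_simps)
    then have dD: "d \<in> D_set G x" using dV by (simp add: D_iff)
    note dh = D_hom[OF dD]
    have step: "inv (t m) \<otimes> d m \<in> C" if m: "m \<in> M" for m
    proof -
      have "inv (t m) \<otimes> inv a \<otimes> inv (inv (t m)) \<otimes> inv (inv a) \<in> C"
        by (rule commutator_in_C) (use tM[OF m] a in auto)
      then show ?thesis using tM[OF m] a m by (simp add: d_apply m_assoc)
    qed
    have tpM: "(t ^^ i) m \<in> M" if "m \<in> M" for m i using that tM by (induction i) auto
    have dC: "d c \<in> C" if c: "c \<in> C" for c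
    proof -
      have "d c \<otimes> b = d (c \<otimes> b)" using C_closed[OF c] dh by simp
      also have "\<dots> = d (b \<otimes> c)" by (simp only: C_comm[OF c])
      also have "\<dots> = b \<otimes> d c" using C_closed[OF c] dh by simp
      finally show ?thesis using D_M[OF dD] c C_sub unfolding C_def by blast
    qed
    have iter: "inv ((t ^^ i) m) \<otimes> (d ^^ i) m \<in> C \<and> (d ^^ i) m \<in> M" if m: "m \<in> M" for m i
    proof (induction i)
      case 0 then show ?case using m subgroup.one_closed[OF subgroup_C] by simp
    next
      case (Suc i)
      define y z where "y = (t ^^ i) m" and "z = (d ^^ i) m"
      have yz: "y \<in> M" "z \<in> M" "inv y \<otimes> z \<in> C" using Suc tpM[OF m] by (auto simp: y_def z_def)
      have "(inv (t y) \<otimes> d y) \<otimes> d (inv y \<otimes> z) \<in> C"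
        by (rule subgroup.m_closed[OF subgroup_C step[OF yz(1)] dC[OF yz(3)]])
      moreover have "(inv (t y) \<otimes> d y) \<otimes> d (inv y \<otimes> z) = inv (t y) \<otimes> d z"
        using yz tM[OF yz(1)] dh by (simp add: word_simps)
      ultimately show ?case using D_M[OF dD yz(2)] by (simp add: y_def z_def)
    qed
    have dpw: "d [^]\<^bsub>?V\<^esub> (p ^ u) \<in> D_set G x"
    proof -
      interpret D: subgroup "D_set G x" ?V by (rule subgroup_D)
      have "d [^]\<^bsub>?V\<^esub> i \<in> D_set G x" for i :: nat
      proof (induction i)
        case 0 then show ?case using D.one_closed by (simp only: V.nat_pow_0)
      next
        case (Suc i) then show ?case using D.m_closed[OF Suc dD] by (simp only: V.nat_pow_Suc)
      qed
      then show ?thesis .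
    qed
    have "(d ^^ (p ^ u)) g = g" if g: "g \<in> carrier G" for g
    proof -
      have "(d [^]\<^bsub>?V\<^esub> (p ^ u)) g = g"
      proof (rule D_trivial_mod_C[OF dpw _ g])
        fix m assume m: "m \<in> M"
        show "inv m \<otimes> (d [^]\<^bsub>?V\<^esub> (p ^ u)) m \<in> C"
          using iter[OF m, of "p ^ u"] tp[of m] V_pow[OF dV, of m "p ^ u"] m by simp
      qed
      then show ?thesis using V_pow[OF dV g] by simp
    qed
    then have dg: "d g = g" if "g \<in> carrier G" for g
      using D_p_element_trivial[OF p p_not_dvd_D dD _ that] by blast
    have "t g = inn a g" if g: "g \<in> carrier G" for g
    proof -
      have "a \<otimes> d g \<otimes> inv a = t g" using d_apply[OF g] V_props(4)[OF tV g] a(1) by (simp add: word_simps)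
      then show ?thesis using dg[OF g] g by (simp add: inn_def)
    qed
    then have "t = inn a"
      using V_props(2)[OF tV] inn_End[of a] a(1) by (intro extensionalityI[of _ "carrier G"]) auto
    then show ?thesis using a(1) by blast
  qed
  then have "P \<subseteq> inn ` M" by blast
  then show ?thesis using card_subset_eq[of "inn ` M" P] finM cP card_J card_cnj by simp
qed

lemma elementary_abelian_J: "elementary_abelian p J"
  unfolding elementary_abelian_def using comm_group_J exponent_J by auto

lemma kills_iff_noninjective:
  assumes z: "z \<in> carrier (End_monoid G)"
  shows "z \<notin> auto G \<longleftrightarrow> (\<forall>m \<in> M. z m = \<one>)"
proof
  assume "z \<notin> auto G"
  then show "\<forall>m \<in> M. z m = \<one>" using auto_iff_inj[OF fin z] noninjective_kills_M z by auto
next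
  assume k: "\<forall>m \<in> M. z m = \<one>"
  obtain m where m: "m \<in> M" "m \<noteq> \<one>" using M_ne_one M.one_closed by blast
  have "\<not> inj_on z (carrier G)"
  proof
    assume "inj_on z (carrier G)"
    moreover have "z m = z \<one>" using k m(1) M.one_closed by simp
    ultimately show False using m by (auto dest: inj_onD)
  qed
  then show "z \<notin> auto G" using auto_iff_inj[OF fin z] by simp
qed

text \<open>An idempotent other than the identity is not injective, so it kills \<open>M\<close>; let it send \<open>b\<close> to
  \<open>b ^ j\<close> modulo \<open>M\<close>. Then \<open>j\<close> is congruent to its square modulo \<open>n\<close>. If \<open>q\<close> divides \<open>j\<close>, the
  idempotent is nilpotent, hence zero; otherwise \<open>j\<close> is congruent to \<open>1\<close>, and it is a projection.\<close>

lemma I0_eq: "I0 G = proj ` M"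
proof
  show "proj ` M \<subseteq> I0 G" using proj_I0 M_ne_one by blast
  show "I0 G \<subseteq> proj ` M"
  proof
    fix y assume "y \<in> I0 G"
    then have y: "y \<in> carrier (End_monoid G)" "\<And>g. g \<in> carrier G \<Longrightarrow> y (y g) = y g"
      "y \<noteq> End_zero G" "y \<noteq> (\<lambda>g \<in> carrier G. g)" by (auto simp: I0_iff simp del: End_simps)
    have yh: "y \<in> hom G G" using y by simp
    have "y \<notin> auto G"
    proof
      assume "y \<in> auto G"
      then have inj: "inj_on y (carrier G)" using auto_iff_inj[OF fin y(1)] by simp
      have "y g = g" if "g \<in> carrier G" for g
        using inj_onD[OF inj y(2)[OF that]] hom_closedI[OF yh that] that by blast
      then have "y = (\<lambda>g \<in> carrier G. g)" using y(1) by (intro extensionalityI[of _ "carrier G"]) auto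
      then show False using y(4) by blast
    qed
    then have kill: "y m = \<one>" if "m \<in> M" for m using kills_iff_noninjective[OF y(1)] that by blast
    have yb: "y b \<in> carrier G" by (rule hom_closedI[OF yh b])
    obtain j :: nat where j: "x (y b) = b [^] j" using img[OF yb] by blast
    have "x ((y ^^ 2) b) = b [^] (j ^ 2)" by (rule killing_pow(1)[OF y(1) kill j])
    then have "b [^] j = b [^] (j ^ 2)" using y(2)[OF b] j by (simp add: numeral_2_eq_2)
    then have c: "[j = j ^ 2] (mod n)" unfolding b_pow_eq_iff .
    have "\<not> q dvd j"
    proof
      assume qj: "q dvd j"
      have "y [^]\<^bsub>End_monoid G\<^esub> v = End_zero G" using killing_pow_zero_iff[OF y(1) kill j] qj by blast
      moreover have "(y ^^ v) g = y g" if "g \<in> carrier G" for g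
      proof -
        obtain v' where v': "v = Suc v'" using v by (cases v) auto
        have "(y ^^ Suc i) g = y g" for i
          by (induction i) (use y(2)[OF that] in auto)
        then show ?thesis using v' by blast
      qed
      ultimately have "y g = End_zero G g" if "g \<in> carrier G" for g using End_pow[OF y(1) that, of v] that by simp
      then have "y = End_zero G"
        using y(1) by (intro extensionalityI[of _ "carrier G"]) (auto simp: End_zero_def)
      then show False using y(3) by blast
    qed
    then have cop: "coprime j n" unfolding n_def using prime_imp_coprime[OF q] by (simp add: coprime_commute)
    have "[j * 1 = j * j] (mod n)" using c by (simp add: power2_eq_square)
    then have "[1 = j] (mod n)" using cong_mult_lcancel_nat[OF cop] by blast
    then have "b [^] (1::nat) = b [^] j" unfolding b_pow_eq_iff .
    then have "x (y b) = b" using j by simp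
    then show "y \<in> proj ` M" using eq_proj[OF y(1) kill] by blast
  qed
qed

lemma b_pow_central_iff: "(\<forall>m \<in> M. m \<otimes> b [^] (j::nat) = b [^] j \<otimes> m) \<longleftrightarrow> q dvd j"
proof
  assume com: "\<forall>m \<in> M. m \<otimes> b [^] j = b [^] j \<otimes> m"
  show "q dvd j"
  proof (rule ccontr)
    assume "\<not> q dvd j"
    then have "coprime j n" unfolding n_def using prime_imp_coprime[OF q] by (simp add: coprime_commute)
    then obtain k where "[j * k = 1] (mod n)" using cong_solve_coprime_nat[of j n] by auto
    then have "b [^] (j * k) = b [^] (1::nat)" unfolding b_pow_eq_iff by simp
    then have e: "(b [^] j) [^] k = b" by (simp add: nat_pow_pow)
    have "b \<otimes> m = m \<otimes> b" if "m \<in> M" for m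
      using commute_pow[of "b [^] j" m k] com that by (simp add: e)
    then have "M \<subseteq> C" unfolding C_def by auto
    then show False using C_ne_M C_sub by blast
  qed
next
  assume "q dvd j"
  then obtain t where "j = q * t" by (rule dvdE)
  then show "\<forall>m \<in> M. m \<otimes> b [^] j = b [^] j \<otimes> m" using b_qt_central by simp
qed

text \<open>Lying in \<open>K\<close> of all projections means killing \<open>M\<close> and sending \<open>b\<close> to a power \<open>b ^ j\<close> that is
  fixed under conjugation by \<open>M\<close>, that is, \<open>q\<close> divides \<open>j\<close>. By \<open>killing_pow_zero_iff\<close> this is
  nilpotency.\<close>

lemma in_all_K_iff:
  assumes z: "z \<in> carrier (End_monoid G)"
  shows "z \<in> (\<Inter>y \<in> I0 G. K_set G y) \<longleftrightarrow> z [^]\<^bsub>End_monoid G\<^esub> v = End_zero G"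
proof
  assume "z \<in> (\<Inter>y \<in> I0 G. K_set G y)"
  then have zK: "z \<in> K_set G (proj m)" if "m \<in> M" for m using that by (auto simp: I0_eq)
  then have kill: "z m = \<one>" if "m \<in> M" for m using K_proj_iff[OF that] that by blast
  obtain j :: nat where j: "z b = \<one> \<otimes> b [^] j \<otimes> inv \<one>" using zK[OF M.one_closed] K_proj_iff[OF M.one_closed] by blast
  then have j: "z b = b [^] j" by simp
  have "m \<otimes> b [^] j = b [^] j \<otimes> m" if m: "m \<in> M" for m
  proof -
    obtain i :: nat where i: "z b = m \<otimes> b [^] i \<otimes> inv m" using zK[OF m] K_proj_iff[OF m] by blast
    have "x (z b) = b [^] i" using i m x_pow[of i] by simp
    then have "b [^] i = b [^] j" using j x_pow[of j] by simp
    then have "b [^] j = m \<otimes> b [^] j \<otimes> inv m" using i j by simp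
    then have "b [^] j \<otimes> m = m \<otimes> b [^] j \<otimes> inv m \<otimes> m" by simp
    then show ?thesis using m by (simp add: word_simps)
  qed
  then have "q dvd j" using b_pow_central_iff by blast
  then show "z [^]\<^bsub>End_monoid G\<^esub> v = End_zero G"
    using killing_pow_zero_iff[OF z kill, of j] j x_pow by simp
next
  assume zv: "z [^]\<^bsub>End_monoid G\<^esub> v = End_zero G"
  have zh: "z \<in> hom G G" using z by simp
  have "z \<notin> auto G"
  proof
    assume "z \<in> auto G"
    then have inj: "inj_on z (carrier G)" using auto_iff_inj[OF fin z] by simp
    have clos: "(z ^^ i) g \<in> carrier G" if "g \<in> carrier G" for i g
      using that hom_closedI[OF zh] by (induction i) auto
    have "(z ^^ i) g \<noteq> \<one>" if "g \<in> carrier G" "g \<noteq> \<one>" for i g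
    proof (induction i)
      case (Suc i)
      have "z ((z ^^ i) g) \<noteq> z \<one>" using inj_onD[OF inj] clos[OF that(1)] Suc by blast
      then show ?case using hom_simps_self(1)[OF zh] by simp
    qed (use that in simp)
    moreover have "(z ^^ v) b = \<one>" using End_pow[OF z b, of v] zv by (simp add: End_zero_def)
    ultimately show False using b_ne_one b by blast
  qed
  then have kill: "z m = \<one>" if "m \<in> M" for m using kills_iff_noninjective[OF z] that by blast
  obtain m and j :: nat where m: "m \<in> M" "z b = conjugate m (b [^] j)" and j: "x (z b) = b [^] j"
    using hom_at_b_conjugate[OF zh] by blast
  have qj: "q dvd j" using killing_pow_zero_iff[OF z kill j] zv by blast
  have cen: "a \<otimes> b [^] j \<otimes> inv a = b [^] j" if a: "a \<in> M" for a
  proof -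
    have "a \<otimes> b [^] j = b [^] j \<otimes> a" using b_pow_central_iff qj a by blast
    then show ?thesis using a by (simp add: word_simps)
  qed
  have "z \<in> K_set G (proj a)" if a: "a \<in> M" for a
  proof -
    have "z b = a \<otimes> b [^] j \<otimes> inv a" using m cen[OF m(1)] cen[OF a] by simp
    then show ?thesis using K_proj_iff[OF a] z kill by blast
  qed
  then show "z \<in> (\<Inter>y \<in> I0 G. K_set G y)" by (auto simp: I0_eq)
qed

lemma End_minus_auto: "carrier (End_monoid G) - auto G = (\<Union>y \<in> I0 G. K_set G y)"
proof
  show "carrier (End_monoid G) - auto G \<subseteq> (\<Union>y \<in> I0 G. K_set G y)"
  proof
    fix z assume "z \<in> carrier (End_monoid G) - auto G"
    then have z: "z \<in> carrier (End_monoid G)" "z \<notin> auto G" by blast+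
    have zh: "z \<in> hom G G" using z by simp
    have kill: "z m = \<one>" if "m \<in> M" for m using kills_iff_noninjective[OF z(1)] z(2) that by blast
    obtain m and j :: nat where m: "m \<in> M" "z b = conjugate m (b [^] j)"
      using hom_at_b_conjugate[OF zh] by blast
    then have "z \<in> K_set G (proj m)" using K_proj_iff[OF m(1)] z kill by blast
    then show "z \<in> (\<Union>y \<in> I0 G. K_set G y)" using m(1) by (auto simp: I0_eq)
  qed
  show "(\<Union>y \<in> I0 G. K_set G y) \<subseteq> carrier (End_monoid G) - auto G"
  proof
    fix z assume "z \<in> (\<Union>y \<in> I0 G. K_set G y)"
    then obtain m where m: "m \<in> M" "z \<in> K_set G (proj m)" by (auto simp: I0_eq)
    then show "z \<in> carrier (End_monoid G) - auto G"
      using K_proj_iff[OF m(1)] kills_iff_noninjective[of z] by blast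
  qed
qed

text \<open>For \<open>y\<close> in \<open>H(x)\<close> the value \<open>y b\<close> lies in \<open>M\<close> and has order dividing \<open>n\<close>, which is prime to
  \<open>|M|\<close>.\<close>

lemma H_set_trivial: "H_set G x = {End_zero G}"
proof
  show "H_set G x \<subseteq> {End_zero G}"
  proof
    fix y assume "y \<in> H_set G x"
    then have y: "y \<in> carrier (End_monoid G)" "\<And>g. g \<in> carrier G \<Longrightarrow> y (x g) = y g"
      "\<And>g. g \<in> carrier G \<Longrightarrow> x (y g) = \<one>" by (auto simp: H_set_iff simp del: End_simps)
    have yh: "y \<in> hom G G" using y by simp
    have y1: "y \<one> = \<one>" by (rule hom_simps_self(1)[OF yh])
    have "y b [^] n = \<one>" by (rule hom_at_b(2)[OF yh])
    moreover have "y b \<in> M" by (rule M_I[OF hom_closedI[OF yh b] y(3)[OF b]])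
    ultimately have yb: "y b = \<one>" using M_torsion[of "y b"] by blast
    have "y = End_zero G"
    proof (rule End_eqI[OF y(1)])
      show "End_zero G \<in> carrier (End_monoid G)" by (auto simp: End_zero_def intro!: homI)
      show "y m = End_zero G m" if "m \<in> M" for m using y(2)[of m] that y1 by (simp add: End_zero_def)
      show "y b = End_zero G b" using yb by (simp add: End_zero_def)
    qed
    then show "y \<in> {End_zero G}" by simp
  qed
  show "{End_zero G} \<subseteq> H_set G x"
    unfolding H_set_iff by (auto simp: H_set_iff End_zero_def intro!: homI simp: hom_closedI[OF x_hom])
qed

lemma p_complement_D: "p_complement_group p ((V_group G x)\<lparr>carrier := D_set G x\<rparr>)"
proof -
  have "finite (D_set G x)" using finite_subset[OF _ finV] D_iff by blast
  then show ?thesis using V.subgroup_imp_group[OF subgroup_D] p_not_dvd_D by (simp add: p_complement_group_def order_def)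
qed

lemma x_in_I0: "x \<in> I0 G"
  using I0_eq x_eq_proj M.one_closed by blast

lemma I0_idem_class: "I0 G = idem_class G x"
  using I0_eq idem_class_eq by simp

lemma card_I0: "card (I0 G) = p ^ u"
  using I0_eq card_proj card_cnj by simp

lemma K_x_iso_End: "(End_monoid G)\<lparr>carrier := K_set G x\<rparr> \<cong> End_monoid (integer_mod_group (q ^ v))"
proof -
  have "inv_into (carrier (End_monoid (integer_mod_group n))) (\<lambda>\<phi>. nat (\<phi> 1)) \<in> iso (mult_mod n) (End_monoid (integer_mod_group n))"
    by (rule iso_inverse[OF End_integer_mod_group[OF n1]])
      (rule monoid.m_closed[OF group.monoid_End[OF group_integer_mod_group]])
  then have "mult_mod n \<cong> End_monoid (integer_mod_group n)" by (rule is_isoI)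
  then show ?thesis using iso_trans[OF K_x_iso] unfolding n_def by blast
qed

lemma sylow_V_elementary_abelian:
  assumes "sylow_subgroup p P (V_group G x)"
  shows "elementary_abelian p ((V_group G x)\<lparr>carrier := P\<rparr>) \<and> card P = p ^ u"
  using sylow_V_eq[OF assms] elementary_abelian_J card_J card_cnj by simp

end

section \<open>The characterization\<close>

lemma (in group) schmidt_split_exists:
  fixes p q v u :: nat
  assumes fin: "finite (carrier G)" and p: "prime p" and q: "prime q" and pq: "p \<noteq> q" and v: "v \<ge> 1"
    and u0: "u > 0" and order_u: "\<And>k. [p ^ k = 1] (mod q) \<Longrightarrow> u dvd k" and pu: "[p ^ u = 1] (mod q)"
    and par: "schmidt_group_params G p q v"
  shows "\<exists>x b s. schmidt_split G x b q v p u s"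
proof -
  have sch: "schmidt_group G" using par by (simp add: schmidt_group_params_def)
  define D where "D = derived G (carrier G)"
  obtain s where s: "card D = p ^ s" using par by (auto simp: schmidt_group_params_def D_def)
  obtain b where b: "b \<in> carrier G" "card (generate G {b}) = q ^ v" "internal_semidirect G D (generate G {b})"
    using par by (auto simp: schmidt_group_params_def D_def)
  have D: "D \<lhd> G" and Db: "D \<inter> generate G {b} = {\<one>}" and DG: "D <#> generate G {b} = carrier G"
    using b(3) by (auto simp: internal_semidirect_def)
  interpret D: normal D G by (rule D)
  have gen: "generate G {b} = {b [^] (i::nat) | i. i \<in> UNIV}"
    using generate_pow_on_finite_carrier[OF fin b(1)] by simp
  have dec: "\<exists>m \<in> D. \<exists>i::nat. g = m \<otimes> b [^] i" if "g \<in> carrier G" for g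
  proof -
    have "g \<in> D <#> generate G {b}" using that DG by simp
    then show ?thesis unfolding set_mult_def gen by blast
  qed
  have bD: "b [^] i = \<one>" if "b [^] i \<in> D" for i :: nat using that Db unfolding gen by blast
  obtain h where h: "h \<in> hom G G" "\<And>m i. m \<in> D \<Longrightarrow> h (m \<otimes> b [^] (i::nat)) = b [^] i"
    using hom_from_cyclic_extension[OF group_axioms group_axioms D.subgroup_axioms D.inv_op_closed2 b(1) dec b(1) bD]
    by blast
  define x where "x = restrict h (carrier G)"
  have xE: "x \<in> carrier (End_monoid G)" unfolding x_def using h(1) by (auto intro!: homI simp: hom_multD[OF h(1)] hom_closedI)
  have xval: "x (m \<otimes> b [^] (i::nat)) = b [^] i" if "m \<in> D" for m i
    using h(2)[OF that] that b(1) by (simp add: x_def)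
  have xb: "x b = b" using xval[OF D.one_closed, of 1] b(1) by simp
  interpret cyclic_retract G x b q v
  proof unfold_locales
    show "\<exists>i::nat. x g = b [^] i" if "g \<in> carrier G" for g using dec[OF that] xval by blast
    show "ord b = q ^ v" using generate_pow_card[OF b(1)] b(2) by simp
  qed (use fin q v b(1) xb xE in auto)
  have MD: "M = D"
  proof
    show "M \<subseteq> D"
    proof
      fix g assume g: "g \<in> M"
      obtain m i where m: "m \<in> D" "g = m \<otimes> b [^] (i::nat)" using dec[of g] g by auto
      have "b [^] i = \<one>" using xval[OF m(1), of i] x_M[OF g] m(2) by simp
      then show "g \<in> D" using m by simp
    qed
    show "D \<subseteq> M"
    proof
      fix m assume m: "m \<in> D"
      show "m \<in> M" by (rule M_I) (use xval[OF m, of 0] m in auto)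
    qed
  qed
  have "\<not> q dvd p ^ s" using prime_dvd_power[OF q] primes_dvd_imp_eq[OF q p] pq by blast
  then have "schmidt_split G x b q v p u s"
    using sch u0 order_u pu p pq s MD
    by unfold_locales (auto simp: schmidt_group_def D_def)
  then show ?thesis by blast
qed

lemma (in group) schmidt_if_endomorphism_criterion:
  fixes p q v u :: nat
  assumes p: "prime p" and q: "prime q" and v: "v \<ge> 1"
    and order_u: "\<And>k. [p ^ k = 1] (mod q) \<Longrightarrow> u dvd k"
    and fin: "finite (carrier G)"
    and x: "x \<in> I0 G"
    and c1: "(End_monoid G)\<lparr>carrier := K_set G x\<rparr> \<cong> End_monoid (integer_mod_group (q ^ v))"
    and c2: "H_set G x = {End_zero G}"
    and c3: "I0 G = idem_class G x"
    and c4: "card (I0 G) = p ^ u"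
    and c5: "carrier (End_monoid G) - auto G = (\<Union>y \<in> I0 G. K_set G y)"
    and c6: "\<forall>z \<in> carrier (End_monoid G).
        z \<in> (\<Inter>y \<in> I0 G. K_set G y) \<longleftrightarrow> z [^]\<^bsub>End_monoid G\<^esub> v = End_zero G"
    and c7: "p_complement_group p ((V_group G x)\<lparr>carrier := D_set G x\<rparr>)"
    and c8: "\<forall>P. sylow_subgroup p P (V_group G x) \<longrightarrow>
        elementary_abelian p ((V_group G x)\<lparr>carrier := P\<rparr>) \<and> card P = p ^ u"
  shows "schmidt_group_params G p q v"
proof -
  have qv1: "q ^ v > 1" using v prime_gt_1_nat[OF q] by (intro one_less_power) auto
  have xE: "x \<in> carrier (End_monoid G)" and idem: "\<And>g. g \<in> carrier G \<Longrightarrow> x (x g) = x g"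
    and x_ne: "x \<noteq> (\<lambda>g \<in> carrier G. g)"
    using x by (auto simp: I0_iff simp del: End_simps)
  have K: "(End_monoid G)\<lparr>carrier := K_set G x\<rparr> \<cong> mult_mod (q ^ v)"
    using c1 End_integer_mod_group[OF qv1] iso_trans is_isoI by blast
  have "\<exists>b \<in> carrier G. x b = b \<and> (\<forall>g \<in> carrier G. \<exists>i::nat. x g = b [^] i) \<and> ord b = q ^ v"
    by (rule cyclic_image_if_K_set_iso[OF fin xE _ q refl K]) (rule idem)
  then obtain b where b: "b \<in> carrier G" "x b = b" "\<And>g. g \<in> carrier G \<Longrightarrow> \<exists>i::nat. x g = b [^] i"
    "ord b = q ^ v" by blast
  interpret cyclic_retract G x b q v
    by unfold_locales (use fin q v b xE in auto)
  interpret cyclic_split G x b q v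
    by unfold_locales (rule coprime_kernel_if_H_set_trivial[OF c2])
  have I0: "I0 G = proj ` M" using c3 idem_class_eq by simp
  have M1: "M \<noteq> {\<one>}"
  proof
    assume M1: "M = {\<one>}"
    have "x g = g" if g: "g \<in> carrier G" for g
    proof -
      obtain m i where m: "m \<in> M" "g = m \<otimes> b [^] (i::nat)" "x g = b [^] i" using decomp[OF g] by blast
      have "m = \<one>" using m(1) M1 by blast
      then show ?thesis using m by simp
    qed
    then have "x = (\<lambda>g \<in> carrier G. g)" using xE by (intro extensionalityI[of _ "carrier G"]) auto
    then show False using x_ne by blast
  qed
  interpret schmidt_criterion G x b q v p u
  proof unfold_locales
    show "prime p" "M \<noteq> {\<one>}" using p M1 by simp_all
    show "u dvd k" if "[p ^ k = 1] (mod q)" for k using order_u[OF that] .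
    show "card (cnj ` M) = p ^ u" using c4 I0 card_proj by simp
    show "\<not> p dvd card (D_set G x)" using c7 by (simp add: p_complement_group_def order_def)
    show "elementary_abelian p ((V_group G x)\<lparr>carrier := P\<rparr>)" if "sylow_subgroup p P (V_group G x)" for P
      using c8 that by blast
  next
    fix f m assume f: "f \<in> hom G G" "f b = \<one>" and m: "m \<in> M"
    let ?f = "restrict f (carrier G)"
    have fE: "?f \<in> carrier (End_monoid G)" using f(1) by (auto intro!: homI simp: hom_multD[OF f(1)] hom_closedI)
    have "?f b = ?f \<one>" using f hom_one[OF f(1) group_axioms group_axioms] by simp
    then have "\<not> inj_on ?f (carrier G)" using b_ne_one b(1) by (auto dest: inj_onD)
    then have "?f \<notin> auto G" using auto_iff_inj[OF fin fE] by blast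
    then have "?f \<in> (\<Union>y \<in> I0 G. K_set G y)" using fE by (simp only: c5[symmetric] Diff_iff not_False_eq_True simp_thms)
    then have "?f \<in> (\<Union>y \<in> proj ` M. K_set G y)" by (simp only: I0)
    then obtain a where a: "a \<in> M" "?f \<in> K_set G (proj a)" by (elim UN_E imageE) simp
    then have "\<forall>m \<in> M. ?f m = \<one>" using K_proj_iff[OF a(1), of ?f] by (elim iffD1[THEN conjunct2, THEN conjunct1])
    then have "?f m = \<one>" using m by (rule bspec)
    then show "f m = \<one>" using m by simp
  next
    fix m assume m: "m \<in> M"
    have "(b [^] q) [^] n = (b [^] n) [^] q" using b(1) by (simp add: nat_pow_pow mult.commute)
    then obtain z where z: "z \<in> carrier (End_monoid G)" "\<And>m. m \<in> M \<Longrightarrow> z m = \<one>" "z b = b [^] q"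
      using extendE[of "b [^] q"] b_pow_n by auto
    have "x (z b) = b [^] q" using z(3) x_pow by simp
    then have "z [^]\<^bsub>End_monoid G\<^esub> v = End_zero G" using killing_pow_zero_iff[OF z(1,2)] by simp
    then have "z \<in> (\<Inter>y \<in> I0 G. K_set G y)" using c6 z(1) by blast
    then have "z \<in> K_set G (proj m)" using I0 m by blast
    then have "proj m (z b) = z b" using b(1) by (simp add: K_set_iff)
    then have "m \<otimes> b [^] q \<otimes> inv m = b [^] q" using z(3) b(1) x_pow[of q] by (simp add: proj_def)
    then have "m \<otimes> b [^] q \<otimes> inv m \<otimes> m = b [^] q \<otimes> m" by simp
    then show "b [^] q \<otimes> m = m \<otimes> b [^] q" using m b(1) by (simp add: word_simps)
  qed
  show ?thesis by (rule schmidt)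
qed

theorem theorem3p1:
  fixes G :: "('a, 'b) monoid_scheme" and p q v u :: nat
  assumes "prime p" and "prime q" and "p \<noteq> q" and "v \<ge> 1"
    and "u = ord q p"
    and "group G" and "finite (carrier G)"
  shows "(\<exists>S :: 'a monoid. schmidt_group_params S p q v \<and> G \<cong> S) \<longleftrightarrow>
    (\<exists>x \<in> I0 G.
       (End_monoid G)\<lparr>carrier := K_set G x\<rparr> \<cong> End_monoid (integer_mod_group (q ^ v))
     \<and> H_set G x = {End_zero G}
     \<and> I0 G = idem_class G x
     \<and> card (I0 G) = p ^ u
     \<and> carrier (End_monoid G) - auto G = (\<Union>y \<in> I0 G. K_set G y)
     \<and> (\<forall>z \<in> carrier (End_monoid G).
          z \<in> (\<Inter>y \<in> I0 G. K_set G y) \<longleftrightarrow> z [^]\<^bsub>End_monoid G\<^esub> v = End_zero G)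
     \<and> subgroup (D_set G x) (V_group G x)
     \<and> p_complement_group p ((V_group G x)\<lparr>carrier := D_set G x\<rparr>)
     \<and> (\<forall>P. sylow_subgroup p P (V_group G x) \<longrightarrow>
          elementary_abelian p ((V_group G x)\<lparr>carrier := P\<rparr>) \<and> card P = p ^ u))"
    (is "?schmidt \<longleftrightarrow> ?criterion")
proof
  interpret G: group G by fact
  have order_u: "u dvd k" if "[p ^ k = 1] (mod q)" for k using that ord_divides assms(5) by simp
  assume ?schmidt
  then obtain S :: "'a monoid" and f where S: "schmidt_group_params S p q v" "f \<in> iso G S"
    by (auto simp: is_iso_def)
  have "group S" using S(1) by (simp add: schmidt_group_params_def schmidt_group_def)
  then have par: "schmidt_group_params G p q v"
    using schmidt_group_params_iso[OF G.iso_set_sym[OF S(2)] _ G.group_axioms S(1)] by blast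
  have "coprime q p" using assms(1-3) primes_coprime by metis
  then have "u > 0" using ord_eq_0[of q p] assms(5) by simp
  moreover have "[p ^ u = 1] (mod q)" using ord[of p q] assms(5) by simp
  ultimately obtain x b s where "schmidt_split G x b q v p u s"
    using G.schmidt_split_exists[OF assms(7,1,2,3,4) _ order_u _ par] by blast
  then interpret schmidt_split G x b q v p u s .
  show ?criterion
    by (intro bexI[OF _ x_in_I0] conjI ballI allI impI K_x_iso_End H_set_trivial I0_idem_class card_I0
        End_minus_auto in_all_K_iff subgroup_D p_complement_D
        sylow_V_elementary_abelian[THEN conjunct1] sylow_V_elementary_abelian[THEN conjunct2])
next
  interpret G: group G by fact
  have order_u: "u dvd k" if "[p ^ k = 1] (mod q)" for k using that ord_divides assms(5) by simp
  assume ?criterion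
  then have par: "schmidt_group_params G p q v"
    by (elim bexE conjE) (rule G.schmidt_if_endomorphism_criterion[OF assms(1,2,4) order_u assms(7)], assumption+)
  \<comment> \<open>The witness on the left-hand side has no further record fields.\<close>
  let ?S = "monoid.truncate G"
  have id: "id \<in> iso G ?S" by (auto simp: iso_def hom_def monoid.truncate_def)
  have "group ?S" using G.iso_imp_img_group[OF id] by (simp add: monoid.defs)
  then have "schmidt_group_params ?S p q v"
    using schmidt_group_params_iso[OF id G.group_axioms _ par] by blast
  then show ?schmidt using id is_isoI by blast
qed

end
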